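(* Let $R$ be the $k$-algebra generated by $x_1,x_2$ with relations $x_1x_2x_1x_2+x_2x_1x_2x_1=0$ and $x_1^2=x_2^2=0$. Then the algebra $\operatorname{Ext}_R^*(k,k)$ is generated by $\mathfrak a_1$, $\mathfrak a_2$ and $\mathfrak b$ with $\deg\mathfrak a_1=\deg\mathfrak a_2=1$ and $\deg\mathfrak b=2$, subject to the relations (i.e. it is presented by these generators and the relations) $$\mathfrak a_2\mathfrak a_1=\mathfrak a_1\mathfrak a_2=0,\quad \mathfrak a_1\mathfrak b=\mathfrak b\mathfrak a_1,\quad \mathfrak a_2\mathfrak b=\mathfrak b\mathfrak a_2.$$
   Context: $k$ is an algebraically closed field with $\operatorname{char}k\neq2$. $k$ is viewed as the trivial left $R$-module ($x_1,x_2$ act by $0$). $\operatorname{Ext}_R^*(k,k)$ is a graded algebra under the Yoneda product. In the paper $R$ is the presentation used for the Nichols algebra of type $A_2$ in the case $N=2$ (i.e. $q_{11}=q_{22}=-1$); $\dim R=8$. *)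

theory Defs
  imports "HOL-Algebra.Algebra" "HOL-Library.Poly_Mapping" "HOL-Computational_Algebra.Polynomial"
begin

section \<open>Free algebras and presentations\<close>

text \<open>
  A \<open>k\<close>-algebra (not necessarily commutative) is represented by a \<^typ>\<open>('k, 'a) module\<close> record:
  its ring fields carry the ring structure, \<^const>\<open>module.smult\<close> the action of the type \<open>'k\<close> of scalars.
\<close>

datatype 'x free_word = Free_Word (letters: "'x list")

instantiation free_word :: (type) monoid_add
begin

definition zero_free_word :: "'a free_word"
  where "0 = Free_Word []"

definition plus_free_word :: "'a free_word \<Rightarrow> 'a free_word \<Rightarrow> 'a free_word"
  where "u + v = Free_Word (letters u @ letters v)"

instance
  by standard (simp_all add: zero_free_word_def plus_free_word_def)

end

text \<open>
  Since \<open>+\<close> on words is concatenation, the convolution product of \<^typ>\<open>'a free_word \<Rightarrow>\<^sub>0 'k\<close> is the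
  product of the free algebra on \<open>'x\<close>.
\<close>

type_synonym ('x, 'k) nc_poly = "'x free_word \<Rightarrow>\<^sub>0 'k"

definition monomial :: "'x list \<Rightarrow> ('x, 'k::comm_ring_1) nc_poly"
  where "monomial w = Poly_Mapping.single (Free_Word w) 1"

definition free_algebra :: "('k::comm_ring_1, ('x, 'k) nc_poly) module"
  where "free_algebra =
    \<lparr>carrier = UNIV, monoid.mult = (*), one = 1, ring.zero = 0, add = (+),
     module.smult = (\<lambda>c p. Poly_Mapping.map ((*) c) p)\<rparr>"

text \<open>
  The quotient \<open>V / B\<close>, for \<open>V\<close> an algebra and \<open>B\<close> a two-sided ideal.  It is also used for a plain
  module \<open>V\<close> and a submodule \<open>B\<close>; the fields \<^const>\<open>monoid.mult\<close> and \<^const>\<open>one\<close> are then irrelevant.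
\<close>

definition quotient :: "('k, 'a) module \<Rightarrow> 'a set \<Rightarrow> ('k, 'a set) module"
  where "quotient V B =
    \<lparr>carrier = a_rcosets\<^bsub>V\<^esub> B, monoid.mult = rcoset_mult V B, one = B +>\<^bsub>V\<^esub> \<one>\<^bsub>V\<^esub>,
     ring.zero = B, add = set_add V,
     module.smult = (\<lambda>c S. \<Union>x\<in>S. B +>\<^bsub>V\<^esub> (c \<odot>\<^bsub>V\<^esub> x))\<rparr>"

definition presented_algebra ::
    "('x, 'k::comm_ring_1) nc_poly set \<Rightarrow> ('k, ('x, 'k) nc_poly set) module"
  where "presented_algebra rels = quotient free_algebra (Idl\<^bsub>free_algebra\<^esub> rels)"

definition presented_gen :: "('x, 'k::comm_ring_1) nc_poly set \<Rightarrow> 'x \<Rightarrow> ('x, 'k) nc_poly set"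
  where "presented_gen rels x = Idl\<^bsub>free_algebra\<^esub> rels +>\<^bsub>free_algebra\<^esub> monomial [x]"

definition algebra_iso :: "('k, 'a) module \<Rightarrow> ('k, 'b) module \<Rightarrow> ('a \<Rightarrow> 'b) set"
  where "algebra_iso A B =
    {h \<in> ring_iso A B. \<forall>c. \<forall>x\<in>carrier A. h (c \<odot>\<^bsub>A\<^esub> x) = c \<odot>\<^bsub>B\<^esub> h x}"

definition is_presented_by ::
    "('k::comm_ring_1, 'a) module \<Rightarrow> ('x \<Rightarrow> 'a) \<Rightarrow> ('x, 'k) nc_poly set \<Rightarrow> bool"
  where "is_presented_by A g rels \<longleftrightarrow>
    (\<exists>h \<in> algebra_iso (presented_algebra rels) A. \<forall>x. h (presented_gen rels x) = g x)"


section \<open>Left modules and free resolutions\<close>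

text \<open>
  The locale \<^locale>\<open>module\<close> requires a commutative ring; here the ring is arbitrary.
\<close>

locale left_module = R?: ring R + M?: abelian_group M
  for R :: "('k, 'r) module" (structure) and M :: "('r, 'm) module" (structure) +
  assumes smult_closed:
      "\<lbrakk>r \<in> carrier R; x \<in> carrier M\<rbrakk> \<Longrightarrow> r \<odot>\<^bsub>M\<^esub> x \<in> carrier M"
    and smult_l_distr:
      "\<lbrakk>r \<in> carrier R; s \<in> carrier R; x \<in> carrier M\<rbrakk> \<Longrightarrow>
        (r \<oplus>\<^bsub>R\<^esub> s) \<odot>\<^bsub>M\<^esub> x = r \<odot>\<^bsub>M\<^esub> x \<oplus>\<^bsub>M\<^esub> s \<odot>\<^bsub>M\<^esub> x"
    and smult_r_distr:
      "\<lbrakk>r \<in> carrier R; x \<in> carrier M; y \<in> carrier M\<rbrakk> \<Longrightarrow>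
        r \<odot>\<^bsub>M\<^esub> (x \<oplus>\<^bsub>M\<^esub> y) = r \<odot>\<^bsub>M\<^esub> x \<oplus>\<^bsub>M\<^esub> r \<odot>\<^bsub>M\<^esub> y"
    and smult_assoc:
      "\<lbrakk>r \<in> carrier R; s \<in> carrier R; x \<in> carrier M\<rbrakk> \<Longrightarrow>
        (r \<otimes>\<^bsub>R\<^esub> s) \<odot>\<^bsub>M\<^esub> x = r \<odot>\<^bsub>M\<^esub> (s \<odot>\<^bsub>M\<^esub> x)"
    and smult_one: "x \<in> carrier M \<Longrightarrow> \<one>\<^bsub>R\<^esub> \<odot>\<^bsub>M\<^esub> x = x"

definition lmod_hom ::
    "('k, 'r) module \<Rightarrow> ('r, 'm) module \<Rightarrow> ('r, 'n) module \<Rightarrow> ('m \<Rightarrow> 'n) set"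
  where "lmod_hom R M N =
    {f \<in> carrier M \<rightarrow>\<^sub>E carrier N.
      (\<forall>x\<in>carrier M. \<forall>y\<in>carrier M. f (x \<oplus>\<^bsub>M\<^esub> y) = f x \<oplus>\<^bsub>N\<^esub> f y) \<and>
      (\<forall>r\<in>carrier R. \<forall>x\<in>carrier M. f (r \<odot>\<^bsub>M\<^esub> x) = r \<odot>\<^bsub>N\<^esub> f x)}"

definition is_basis :: "('k, 'r) module \<Rightarrow> ('r, 'm) module \<Rightarrow> 'm set \<Rightarrow> bool"
  where "is_basis R M S \<longleftrightarrow>
    S \<subseteq> carrier M \<and>
    (\<forall>x\<in>carrier M. \<exists>!c. c \<in> S \<rightarrow>\<^sub>E carrier R \<and> finite {s\<in>S. c s \<noteq> \<zero>\<^bsub>R\<^esub>} \<and>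
       x = finsum M (\<lambda>s. c s \<odot>\<^bsub>M\<^esub> s) {s\<in>S. c s \<noteq> \<zero>\<^bsub>R\<^esub>})"

definition free_left_module :: "('k, 'r) module \<Rightarrow> ('r, 'm) module \<Rightarrow> bool"
  where "free_left_module R M \<longleftrightarrow> left_module R M \<and> (\<exists>S. is_basis R M S)"

text \<open>
  The resolution \<open>\<dots> \<rightarrow> P 2 \<rightarrow> P 1 \<rightarrow> P 0 \<rightarrow> M \<rightarrow> 0\<close>, with differentials \<open>d n : P (n + 1) \<rightarrow> P n\<close> and
  augmentation \<open>\<epsilon> : P 0 \<rightarrow> M\<close>.
\<close>

definition free_resolution ::
    "('k, 'r) module \<Rightarrow> ('r, 'n) module \<Rightarrow> (nat \<Rightarrow> ('r, 'm) module) \<Rightarrow> (nat \<Rightarrow> 'm \<Rightarrow> 'm) \<Rightarrow>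
      ('m \<Rightarrow> 'n) \<Rightarrow> bool"
  where "free_resolution R M P d \<epsilon> \<longleftrightarrow>
    left_module R M \<and>
    (\<forall>n. free_left_module R (P n)) \<and>
    (\<forall>n. d n \<in> lmod_hom R (P (Suc n)) (P n)) \<and>
    \<epsilon> \<in> lmod_hom R (P 0) M \<and>
    \<epsilon> ` carrier (P 0) = carrier M \<and>
    d 0 ` carrier (P 1) = {x \<in> carrier (P 0). \<epsilon> x = \<zero>\<^bsub>M\<^esub>} \<and>
    (\<forall>n. d (Suc n) ` carrier (P (Suc (Suc n))) =
         {x \<in> carrier (P (Suc n)). d n x = \<zero>\<^bsub>P n\<^esub>})"


section \<open>The Yoneda algebra\<close>

text \<open>
  For a left module \<open>M\<close> over a \<open>k\<close>-algebra \<open>R\<close> and a free resolution \<open>(P, d, \<epsilon>)\<close> of \<open>M\<close>,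
  \<open>Ext\<^sup>n(M, M)\<close> is the \<open>n\<close>-th cohomology of the complex \<open>Hom\<^sub>R(P, M)\<close>.
\<close>

definition ext_cocycles ::
    "('k, 'r) module \<Rightarrow> ('r, 'n) module \<Rightarrow> (nat \<Rightarrow> ('r, 'm) module) \<Rightarrow> (nat \<Rightarrow> 'm \<Rightarrow> 'm) \<Rightarrow>
      nat \<Rightarrow> ('k, 'm \<Rightarrow> 'n) module"
  where "ext_cocycles R M P d n =
    \<lparr>carrier = {f \<in> lmod_hom R (P n) M. \<forall>x\<in>carrier (P (Suc n)). f (d n x) = \<zero>\<^bsub>M\<^esub>},
     monoid.mult = undefined, one = undefined,
     ring.zero = (\<lambda>x\<in>carrier (P n). \<zero>\<^bsub>M\<^esub>),
     add = (\<lambda>f g. \<lambda>x\<in>carrier (P n). f x \<oplus>\<^bsub>M\<^esub> g x),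
     module.smult = (\<lambda>c f. \<lambda>x\<in>carrier (P n). (c \<odot>\<^bsub>R\<^esub> \<one>\<^bsub>R\<^esub>) \<odot>\<^bsub>M\<^esub> f x)\<rparr>"

fun ext_coboundaries ::
    "('k, 'r) module \<Rightarrow> ('r, 'n) module \<Rightarrow> (nat \<Rightarrow> ('r, 'm) module) \<Rightarrow> (nat \<Rightarrow> 'm \<Rightarrow> 'm) \<Rightarrow>
      nat \<Rightarrow> ('m \<Rightarrow> 'n) set"
  where
    "ext_coboundaries R M P d 0 = {\<lambda>x\<in>carrier (P 0). \<zero>\<^bsub>M\<^esub>}"
  | "ext_coboundaries R M P d (Suc n) =
      {compose (carrier (P (Suc n))) f (d n) | f. f \<in> lmod_hom R (P n) M}"

definition ext_group ::
    "('k, 'r) module \<Rightarrow> ('r, 'n) module \<Rightarrow> (nat \<Rightarrow> ('r, 'm) module) \<Rightarrow> (nat \<Rightarrow> 'm \<Rightarrow> 'm) \<Rightarrow>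
      nat \<Rightarrow> ('k, ('m \<Rightarrow> 'n) set) module"
  where "ext_group R M P d n = quotient (ext_cocycles R M P d n) (ext_coboundaries R M P d n)"

text \<open>
  The chain maps \<open>\<phi> : P (q + i) \<rightarrow> P i\<close> lifting a cocycle \<open>g : P q \<rightarrow> M\<close>.  The shift carries no sign.
\<close>

definition chain_lifts ::
    "('k, 'r) module \<Rightarrow> (nat \<Rightarrow> ('r, 'm) module) \<Rightarrow> (nat \<Rightarrow> 'm \<Rightarrow> 'm) \<Rightarrow> ('m \<Rightarrow> 'n) \<Rightarrow>
      nat \<Rightarrow> ('m \<Rightarrow> 'n) \<Rightarrow> (nat \<Rightarrow> 'm \<Rightarrow> 'm) set"
  where "chain_lifts R P d \<epsilon> q g =
    {\<phi>. (\<forall>i. \<phi> i \<in> lmod_hom R (P (q + i)) (P i)) \<and>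
        (\<forall>x\<in>carrier (P q). \<epsilon> (\<phi> 0 x) = g x) \<and>
        (\<forall>i. \<forall>x\<in>carrier (P (q + Suc i)). d i (\<phi> (Suc i) x) = \<phi> i (d (q + i) x))}"

text \<open>
  The Yoneda product \<open>Ext\<^sup>p \<times> Ext\<^sup>q \<rightarrow> Ext\<^sup>p\<^sup>+\<^sup>q\<close> sends the classes of \<open>f\<close> and \<open>g\<close> to the class of
  \<open>f \<circ> \<phi> p\<close>, where \<open>\<phi>\<close> lifts \<open>g\<close>.  This class depends on neither the representatives nor the lift,
  so all the cosets in the union below coincide.
\<close>

definition yoneda_prod ::
    "('k, 'r) module \<Rightarrow> ('r, 'n) module \<Rightarrow> (nat \<Rightarrow> ('r, 'm) module) \<Rightarrow> (nat \<Rightarrow> 'm \<Rightarrow> 'm) \<Rightarrow>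
      ('m \<Rightarrow> 'n) \<Rightarrow> nat \<Rightarrow> nat \<Rightarrow> ('m \<Rightarrow> 'n) set \<Rightarrow> ('m \<Rightarrow> 'n) set \<Rightarrow> ('m \<Rightarrow> 'n) set"
  where "yoneda_prod R M P d \<epsilon> p q \<alpha> \<beta> =
    (\<Union>f\<in>\<alpha>. \<Union>g\<in>\<beta>. \<Union>\<phi>\<in>chain_lifts R P d \<epsilon> q g.
       ext_coboundaries R M P d (p + q)
         +>\<^bsub>ext_cocycles R M P d (p + q)\<^esub> compose (carrier (P (p + q))) f (\<phi> p))"

definition ext_in_degree ::
    "('k, 'r) module \<Rightarrow> ('r, 'n) module \<Rightarrow> (nat \<Rightarrow> ('r, 'm) module) \<Rightarrow> (nat \<Rightarrow> 'm \<Rightarrow> 'm) \<Rightarrow>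
      nat \<Rightarrow> ('m \<Rightarrow> 'n) set \<Rightarrow> nat \<Rightarrow> ('m \<Rightarrow> 'n) set"
  where "ext_in_degree R M P d n \<alpha> = (\<lambda>i. if i = n then \<alpha> else \<zero>\<^bsub>ext_group R M P d i\<^esub>)"

text \<open>
  \<open>Ext\<^sup>*(M, M)\<close> is the direct sum of the groups \<open>Ext\<^sup>n(M, M)\<close>, represented by sequences with finitely
  many nonzero terms.  Its unit is the class of \<open>\<epsilon>\<close>, i.e. of the identity of \<open>M\<close>.
\<close>

definition ext_algebra ::
    "('k, 'r) module \<Rightarrow> ('r, 'n) module \<Rightarrow> (nat \<Rightarrow> ('r, 'm) module) \<Rightarrow> (nat \<Rightarrow> 'm \<Rightarrow> 'm) \<Rightarrow>
      ('m \<Rightarrow> 'n) \<Rightarrow> ('k, nat \<Rightarrow> ('m \<Rightarrow> 'n) set) module"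
  where "ext_algebra R M P d \<epsilon> =
    \<lparr>carrier = {u. (\<forall>n. u n \<in> carrier (ext_group R M P d n)) \<and>
                   finite {n. u n \<noteq> \<zero>\<^bsub>ext_group R M P d n\<^esub>}},
     monoid.mult = (\<lambda>u v n. finsum (ext_group R M P d n)
               (\<lambda>p. yoneda_prod R M P d \<epsilon> p (n - p) (u p) (v (n - p))) {..n}),
     one = ext_in_degree R M P d 0
             (ext_coboundaries R M P d 0 +>\<^bsub>ext_cocycles R M P d 0\<^esub> \<epsilon>),
     ring.zero = (\<lambda>n. \<zero>\<^bsub>ext_group R M P d n\<^esub>),
     add = (\<lambda>u v n. u n \<oplus>\<^bsub>ext_group R M P d n\<^esub> v n),
     module.smult = (\<lambda>c u n. c \<odot>\<^bsub>ext_group R M P d n\<^esub> u n)\<rparr>"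


section \<open>The trivial module and the presentations in question\<close>

text \<open>
  The field as a left module over a presented algebra, with all generators acting by \<open>0\<close>: the coset
  \<open>S\<close> acts by the common constant coefficient of its elements.  This requires that the relations have
  no constant term.
\<close>

definition trivial_module :: "(('x, 'k::comm_ring_1) nc_poly set, 'k) module"
  where "trivial_module =
    \<lparr>carrier = UNIV, monoid.mult = undefined, one = undefined, ring.zero = 0, add = (+),
     module.smult = (\<lambda>S c. the_elem ((\<lambda>p. Poly_Mapping.lookup p 0) ` S) * c)\<rparr>"

datatype R_gen = X1 | X2

definition R_rels :: "(R_gen, 'k::comm_ring_1) nc_poly set"
  where "R_rels =
    {monomial [X1, X2, X1, X2] + monomial [X2, X1, X2, X1],
     monomial [X1, X1],
     monomial [X2, X2]}"

definition R_algebra :: "('k::comm_ring_1, (R_gen, 'k) nc_poly set) module"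
  where "R_algebra = presented_algebra R_rels"

datatype ext_gen = G_a1 | G_a2 | G_b

definition ext_rels :: "(ext_gen, 'k::comm_ring_1) nc_poly set"
  where "ext_rels =
    {monomial [G_a2, G_a1],
     monomial [G_a1, G_a2],
     monomial [G_a1, G_b] - monomial [G_b, G_a1],
     monomial [G_a2, G_b] - monomial [G_b, G_a2]}"

end

theory Submission
  imports Defs
begin

text \<open>
  The proof compares an arbitrary free resolution with an explicit one.  With \<open>x = x\<^sub>1\<close> and \<open>y = x\<^sub>2\<close>,
  let \<open>Q\<^sub>n\<close> be free on symbols \<open>u\<^sub>a\<^sub>b\<close> with \<open>a + b = n\<close>, and let \<open>u\<^sub>a\<^sub>b\<close> be sent to
  \<open>\<alpha> u\<^sub>a\<^sub>-\<^sub>1\<^sub>,\<^sub>b + \<beta> u\<^sub>a\<^sub>,\<^sub>b\<^sub>-\<^sub>1\<close>, where \<open>\<alpha>\<close> is \<open>x\<close> if \<open>a > b\<close> and \<open>xyx\<close> otherwise, and \<open>\<beta>\<close> is \<open>y\<close> if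
  \<open>a < b\<close> and \<open>yxy\<close> otherwise.  The differential depends on \<open>a - b\<close> only, so exactness follows by
  induction on \<open>n\<close> along the diagonal shift \<open>u\<^sub>a\<^sub>+\<^sub>1\<^sub>,\<^sub>b\<^sub>+\<^sub>1 \<mapsto> u\<^sub>a\<^sub>b\<close>.  The resolution is minimal, hence
  \<open>Ext\<^sup>n(k, k)\<close> has the dual basis \<open>\<theta>\<^sub>a\<^sub>b\<close> with \<open>a + b = n\<close>, and explicit chain lifts show that
  \<open>\<theta>\<^sub>a\<^sub>b \<theta>\<^sub>i\<^sub>j\<close> is \<open>\<theta>\<^sub>a\<^sub>+\<^sub>i\<^sub>,\<^sub>b\<^sub>+\<^sub>j\<close> if \<open>(a, b)\<close> and \<open>(i, j)\<close> lie on the same side of the diagonal, and \<open>0\<close>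
  otherwise.  The generators are \<open>\<aa>\<^sub>1 = \<theta>\<^sub>1\<^sub>0\<close>, \<open>\<aa>\<^sub>2 = \<theta>\<^sub>0\<^sub>1\<close> and \<open>\<bb> = \<theta>\<^sub>1\<^sub>1\<close>.
\<close>

section \<open>Homomorphisms of left modules\<close>

text \<open>The Yoneda product is a union over all representatives and lifts in an unknown
  resolution, so nothing can be computed in \<open>P\<close> directly. A chain map \<open>F\<close>
  from \<open>P\<close> to the explicit resolution carries classes and products across. The explicit
  resolution is dictated by word length. The symbols \<open>u\<^sub>2\<^sub>0\<close>,
  \<open>u\<^sub>0\<^sub>2\<close>, \<open>u\<^sub>1\<^sub>1\<close> stand for the relations xx, yy
  and xyxy + yxyx, so \<open>u\<^sub>a\<^sub>b\<close> has length |a - b| + 4 min(a, b). Lowering an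
  index by one lowers this length by 1 or 3, which decides between x and xyx, and between y and yxy.
  The same count explains the product: the length equals 2(a + b) - |a - b|, hence is additive on
  pairs on one side of the diagonal, whereas for pairs strictly on opposite sides the sum is longer
  than its parts. There the coefficient of a lift has no constant term and dies under the
  augmentation. Calculations in the quotient ring are made possible by coordinates with respect to
  eight words, which turn equations and syzygies into equations between scalars.\<close>

lemma lmod_homI:
  assumes "\<And>x. x \<in> carrier M \<Longrightarrow> f x \<in> carrier N"
    and "\<And>x y. \<lbrakk>x \<in> carrier M; y \<in> carrier M\<rbrakk> \<Longrightarrow> f (x \<oplus>\<^bsub>M\<^esub> y) = f x \<oplus>\<^bsub>N\<^esub> f y"
    and "\<And>r x. \<lbrakk>r \<in> carrier R; x \<in> carrier M\<rbrakk> \<Longrightarrow> f (r \<odot>\<^bsub>M\<^esub> x) = r \<odot>\<^bsub>N\<^esub> f x"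
    and "left_module R M"
  shows "restrict f (carrier M) \<in> lmod_hom R M N"
proof -
  interpret left_module R M by fact
  show ?thesis
    using assms(1-3) smult_closed by (auto simp: lmod_hom_def)
qed

lemma lmod_hom_closed: "\<lbrakk>f \<in> lmod_hom R M N; x \<in> carrier M\<rbrakk> \<Longrightarrow> f x \<in> carrier N"
  and lmod_hom_add: "\<lbrakk>f \<in> lmod_hom R M N; x \<in> carrier M; y \<in> carrier M\<rbrakk> \<Longrightarrow>
    f (x \<oplus>\<^bsub>M\<^esub> y) = f x \<oplus>\<^bsub>N\<^esub> f y"
  and lmod_hom_smult: "\<lbrakk>f \<in> lmod_hom R M N; r \<in> carrier R; x \<in> carrier M\<rbrakk> \<Longrightarrow>
    f (r \<odot>\<^bsub>M\<^esub> x) = r \<odot>\<^bsub>N\<^esub> f x"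
  and lmod_hom_restrict: "f \<in> lmod_hom R M N \<Longrightarrow> restrict f (carrier M) = f"
  by (auto simp: lmod_hom_def PiE_def extensional_restrict)

lemma lmod_hom_zero:
  assumes "f \<in> lmod_hom R M N" "left_module R M" "left_module R N"
  shows "f \<zero>\<^bsub>M\<^esub> = \<zero>\<^bsub>N\<^esub>"
proof -
  interpret M: left_module R M by fact
  interpret N: left_module R N by fact
  have "f \<zero>\<^bsub>M\<^esub> = f \<zero>\<^bsub>M\<^esub> \<oplus>\<^bsub>N\<^esub> f \<zero>\<^bsub>M\<^esub>"
    using lmod_hom_add[OF assms(1), of "\<zero>\<^bsub>M\<^esub>" "\<zero>\<^bsub>M\<^esub>"] by simp
  moreover have "f \<zero>\<^bsub>M\<^esub> \<in> carrier N"
    using assms(1) by (simp add: lmod_hom_closed)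
  ultimately show ?thesis
    using N.add.r_cancel_one' by metis
qed

lemma lmod_hom_uminus:
  assumes "f \<in> lmod_hom R M N" "left_module R M" "left_module R N" "x \<in> carrier M"
  shows "f (\<ominus>\<^bsub>M\<^esub> x) = \<ominus>\<^bsub>N\<^esub> f x"
proof -
  interpret M: left_module R M by fact
  interpret N: left_module R N by fact
  have "f (\<ominus>\<^bsub>M\<^esub> x) \<oplus>\<^bsub>N\<^esub> f x = \<zero>\<^bsub>N\<^esub>"
    using lmod_hom_add[OF assms(1), of "\<ominus>\<^bsub>M\<^esub> x" x] lmod_hom_zero[OF assms(1-3)] assms(4)
    by (simp add: M.M.l_neg)
  then show ?thesis
    using assms by (metis N.M.minus_equality M.M.a_inv_closed lmod_hom_closed)
qed

lemma lmod_hom_minus: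
  assumes "f \<in> lmod_hom R M N" "left_module R M" "left_module R N" "x \<in> carrier M" "y \<in> carrier M"
  shows "f (x \<ominus>\<^bsub>M\<^esub> y) = f x \<ominus>\<^bsub>N\<^esub> f y"
proof -
  interpret M: left_module R M by fact
  show ?thesis
    using assms by (simp add: a_minus_def lmod_hom_add lmod_hom_uminus)
qed

lemma (in left_module) smult_zero: "r \<in> carrier R \<Longrightarrow> r \<odot>\<^bsub>M\<^esub> \<zero>\<^bsub>M\<^esub> = \<zero>\<^bsub>M\<^esub>"
  using smult_r_distr[of r "\<zero>\<^bsub>M\<^esub>" "\<zero>\<^bsub>M\<^esub>"] smult_closed[of r "\<zero>\<^bsub>M\<^esub>"]
  by (metis M.add.r_cancel_one' M.l_zero M.zero_closed)

lemma (in left_module) zero_smult: "x \<in> carrier M \<Longrightarrow> \<zero>\<^bsub>R\<^esub> \<odot>\<^bsub>M\<^esub> x = \<zero>\<^bsub>M\<^esub>"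
  using smult_l_distr[of "\<zero>\<^bsub>R\<^esub>" "\<zero>\<^bsub>R\<^esub>" x] smult_closed[of "\<zero>\<^bsub>R\<^esub>" x]
  by (metis M.add.r_cancel_one' R.l_zero R.zero_closed)

lemma (in left_module) smult_uminus:
  assumes "r \<in> carrier R" "x \<in> carrier M"
  shows "r \<odot>\<^bsub>M\<^esub> (\<ominus>\<^bsub>M\<^esub> x) = \<ominus>\<^bsub>M\<^esub> (r \<odot>\<^bsub>M\<^esub> x)"
proof -
  have "r \<odot>\<^bsub>M\<^esub> (\<ominus>\<^bsub>M\<^esub> x) \<oplus>\<^bsub>M\<^esub> r \<odot>\<^bsub>M\<^esub> x = \<zero>\<^bsub>M\<^esub>"
    using smult_r_distr[of r "\<ominus>\<^bsub>M\<^esub> x" x] assms by (simp add: M.l_neg smult_zero)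
  then show ?thesis
    using assms by (metis M.minus_equality M.a_inv_closed smult_closed)
qed

lemma (in left_module) smult_finsum:
  assumes "finite A" "r \<in> carrier R" "f \<in> A \<rightarrow> carrier M"
  shows "r \<odot>\<^bsub>M\<^esub> finsum M f A = finsum M (\<lambda>s. r \<odot>\<^bsub>M\<^esub> f s) A"
  using assms
proof (induction A rule: finite_induct)
  case (insert a A)
  then show ?case
    by (subst M.finsum_insert M.finsum_insert; auto simp: Pi_def smult_closed smult_r_distr)+
qed (simp add: smult_zero)

lemma lmod_hom_finsum:
  assumes f: "f \<in> lmod_hom R M N" "left_module R M" "left_module R N"
    and "finite A" "t \<in> A \<rightarrow> carrier M"
  shows "f (finsum M t A) = finsum N (\<lambda>s. f (t s)) A"
proof -
  interpret M: left_module R M by fact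
  interpret N: left_module R N by fact
  show ?thesis
    using assms(4,5)
  proof (induction A rule: finite_induct)
    case empty
    then show ?case using lmod_hom_zero[OF f] by simp
  next
    case (insert a A)
    then show ?case
      using f(1) by (auto simp: Pi_def lmod_hom_add lmod_hom_closed)
  qed
qed

lemma lmod_hom_compose:
  assumes "f \<in> lmod_hom R M N" "g \<in> lmod_hom R L M" "left_module R L"
  shows "compose (carrier L) f g \<in> lmod_hom R L N"
  unfolding compose_def using assms
  by (intro lmod_homI) (auto simp: lmod_hom_closed lmod_hom_add lmod_hom_smult)

lemma lmod_hom_sum:
  assumes "f \<in> lmod_hom R M N" "g \<in> lmod_hom R M N" "left_module R M" "left_module R N"
  shows "(\<lambda>x\<in>carrier M. f x \<oplus>\<^bsub>N\<^esub> g x) \<in> lmod_hom R M N"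
proof -
  interpret N: left_module R N by fact
  show ?thesis using assms
    by (intro lmod_homI)
      (simp_all add: lmod_hom_closed lmod_hom_add lmod_hom_smult N.smult_r_distr N.M.a_ac)
qed

lemma lmod_hom_diff:
  assumes "f \<in> lmod_hom R M N" "g \<in> lmod_hom R M N" "left_module R M" "left_module R N"
  shows "(\<lambda>x\<in>carrier M. f x \<ominus>\<^bsub>N\<^esub> g x) \<in> lmod_hom R M N"
proof -
  interpret N: left_module R N by fact
  show ?thesis using assms
    by (intro lmod_homI)
      (simp_all add: lmod_hom_closed lmod_hom_add lmod_hom_smult N.smult_r_distr N.smult_uminus
        a_minus_def N.M.minus_add N.M.a_ac)
qed

lemma lmod_hom_const_zero:
  assumes "left_module R M" "left_module R N"
  shows "(\<lambda>x\<in>carrier M. \<zero>\<^bsub>N\<^esub>) \<in> lmod_hom R M N"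
proof -
  interpret N: left_module R N by fact
  show ?thesis using assms by (intro lmod_homI) (simp_all add: N.smult_zero)
qed

lemma lmod_hom_ident: "left_module R M \<Longrightarrow> (\<lambda>x\<in>carrier M. x) \<in> lmod_hom R M M"
  by (rule lmod_homI) auto

section \<open>Linear combinations and lifting from free modules\<close>

lemma (in left_module) comb_superset:
  assumes "finite A" "{s \<in> S. c s \<noteq> \<zero>\<^bsub>R\<^esub>} \<subseteq> A" "A \<subseteq> S" "c \<in> S \<rightarrow> carrier R" "t \<in> S \<rightarrow> carrier M"
  shows "finsum M (\<lambda>s. c s \<odot>\<^bsub>M\<^esub> t s) {s \<in> S. c s \<noteq> \<zero>\<^bsub>R\<^esub>} = finsum M (\<lambda>s. c s \<odot>\<^bsub>M\<^esub> t s) A"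
  using assms
  by (intro M.add.finprod_mono_neutral_cong_left)
    (auto simp: Pi_def subset_iff smult_closed zero_smult)

text \<open>A preimage under \<beta> of the \<alpha>-value of each basis element determines
  \<gamma>. The hypothesis asks that the image of \<beta> cover that of \<alpha>; this is the form
  in which exactness of a resolution delivers it.\<close>

lemma free_module_lift:
  fixes M :: "('r, 'm) module" and L :: "('r, 'l) module" and N :: "('r, 'n) module"
  assumes free: "free_left_module R M" and L: "left_module R L" and N: "left_module R N"
    and \<alpha>: "\<alpha> \<in> lmod_hom R M N" and \<beta>: "\<beta> \<in> lmod_hom R L N"
    and im: "\<alpha> ` carrier M \<subseteq> \<beta> ` carrier L"
  shows "\<exists>\<gamma>\<in>lmod_hom R M L. \<forall>x\<in>carrier M. \<beta> (\<gamma> x) = \<alpha> x"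
proof -
  have lM: "left_module R M" using free by (simp add: free_left_module_def)
  interpret M: left_module R M by fact
  interpret L: left_module R L by fact
  interpret N: left_module R N by fact
  obtain S where S: "is_basis R M S" using free by (auto simp: free_left_module_def)
  then have SM: "S \<subseteq> carrier M" by (simp add: is_basis_def)
  define sup where "sup c = {s \<in> S. c s \<noteq> \<zero>\<^bsub>R\<^esub>}" for c :: "'m \<Rightarrow> 'r"
  define coord where "coord x c \<longleftrightarrow> c \<in> S \<rightarrow>\<^sub>E carrier R \<and> finite (sup c) \<and>
      x = finsum M (\<lambda>s. c s \<odot>\<^bsub>M\<^esub> s) (sup c)" for x c
  have ex1: "\<exists>!c. coord x c" if "x \<in> carrier M" for x
    using S that by (simp add: is_basis_def coord_def sup_def)
  define C where "C x = (THE c. coord x c)" for x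
  have C: "coord x (C x)" if "x \<in> carrier M" for x
    unfolding C_def by (rule theI'[OF ex1[OF that]])
  have C_eq: "C x = c" if "x \<in> carrier M" "coord x c" for x c
    using C[OF that(1)] ex1[OF that(1)] that(2) by auto
  have Cc: "C x \<in> S \<rightarrow> carrier R" and Cf: "finite (sup (C x))"
    and Cx: "x = finsum M (\<lambda>s. C x s \<odot>\<^bsub>M\<^esub> s) (sup (C x))" if "x \<in> carrier M" for x
    using C[OF that] by (auto simp: coord_def)
  have supS: "sup c \<subseteq> S" for c by (auto simp: sup_def)
  have "\<exists>y\<in>carrier L. \<beta> y = \<alpha> s" if "s \<in> S" for s
    using im SM that by (auto simp: subset_iff image_iff) metis
  then obtain t where t: "\<And>s. s \<in> S \<Longrightarrow> t s \<in> carrier L \<and> \<beta> (t s) = \<alpha> s" by metis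
  have idS: "(\<lambda>s. s) \<in> S \<rightarrow> carrier M" using SM by auto
  have tS: "t \<in> S \<rightarrow> carrier L" using t by auto
  define \<gamma> where "\<gamma> x = finsum L (\<lambda>s. C x s \<odot>\<^bsub>L\<^esub> t s) (sup (C x))" for x
  have combM0: "finsum M (\<lambda>s. c s \<odot>\<^bsub>M\<^esub> s) (sup c) = finsum M (\<lambda>s. c s \<odot>\<^bsub>M\<^esub> s) A"
    if "finite A" "sup c \<subseteq> A" "A \<subseteq> S" "c \<in> S \<rightarrow> carrier R" for c A
    using that idS unfolding sup_def by (intro M.comb_superset)
  have comb: "\<gamma> x = finsum L (\<lambda>s. C x s \<odot>\<^bsub>L\<^esub> t s) A"
    and combM: "x = finsum M (\<lambda>s. C x s \<odot>\<^bsub>M\<^esub> s) A"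
    if "x \<in> carrier M" "finite A" "sup (C x) \<subseteq> A" "A \<subseteq> S" for x A
    using L.comb_superset[of A S "C x" t] M.comb_superset[of A S "C x" "\<lambda>s. s"] that Cc[OF that(1)] tS Cx[OF that(1)] idS
    by (auto simp: \<gamma>_def sup_def)
  have closed: "\<gamma> x \<in> carrier L" if "x \<in> carrier M" for x
    unfolding \<gamma>_def using Cc[OF that] tS supS
    by (intro L.M.finsum_closed) (auto simp: Pi_def subset_iff L.smult_closed)
  \<comment> \<open>Uniqueness of coordinates makes \<open>C\<close> additive. The support of a sum
    may be smaller than the union of the supports, so combinations are compared over that
    union.\<close>
  have C_add: "C (x \<oplus>\<^bsub>M\<^esub> y) = (\<lambda>s\<in>S. C x s \<oplus>\<^bsub>R\<^esub> C y s)" if xy: "x \<in> carrier M" "y \<in> carrier M" for x y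
  proof (rule C_eq)
    let ?c = "\<lambda>s\<in>S. C x s \<oplus>\<^bsub>R\<^esub> C y s" and ?A = "sup (C x) \<union> sup (C y)"
    have fin: "finite ?A" using Cf xy by simp
    have sub: "sup ?c \<subseteq> ?A" by (auto simp: sup_def)
    have "x \<oplus>\<^bsub>M\<^esub> y = finsum M (\<lambda>s. C x s \<odot>\<^bsub>M\<^esub> s) ?A \<oplus>\<^bsub>M\<^esub> finsum M (\<lambda>s. C y s \<odot>\<^bsub>M\<^esub> s) ?A"
      using combM[OF xy(1) fin] combM[OF xy(2) fin] supS by simp
    also have "\<dots> = finsum M (\<lambda>s. C x s \<odot>\<^bsub>M\<^esub> s \<oplus>\<^bsub>M\<^esub> C y s \<odot>\<^bsub>M\<^esub> s) ?A"
      using Cc[OF xy(1)] Cc[OF xy(2)] supS SM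
      by (intro M.M.finsum_addf[symmetric]) (auto simp: Pi_def subset_iff M.smult_closed)
    also have "\<dots> = finsum M (\<lambda>s. ?c s \<odot>\<^bsub>M\<^esub> s) ?A"
      using Cc[OF xy(1)] Cc[OF xy(2)] supS SM
      by (intro M.M.finsum_cong') (auto simp: Pi_def subset_iff M.smult_closed M.smult_l_distr)
    also have "\<dots> = finsum M (\<lambda>s. ?c s \<odot>\<^bsub>M\<^esub> s) (sup ?c)"
      using Cc[OF xy(1)] Cc[OF xy(2)] supS
      by (intro combM0[symmetric] fin sub) (auto simp: Pi_def)
    finally show "coord (x \<oplus>\<^bsub>M\<^esub> y) ?c"
      using Cc[OF xy(1)] Cc[OF xy(2)] finite_subset[OF sub fin] by (auto simp: coord_def)
  qed (use xy in simp)
  have C_smult: "C (r \<odot>\<^bsub>M\<^esub> x) = (\<lambda>s\<in>S. r \<otimes>\<^bsub>R\<^esub> C x s)" if rx: "r \<in> carrier R" "x \<in> carrier M" for r x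
  proof (rule C_eq)
    let ?c = "\<lambda>s\<in>S. r \<otimes>\<^bsub>R\<^esub> C x s" and ?A = "sup (C x)"
    have fin: "finite ?A" using Cf rx by simp
    have sub: "sup ?c \<subseteq> ?A" using rx by (auto simp: sup_def)
    have "r \<odot>\<^bsub>M\<^esub> x = finsum M (\<lambda>s. r \<odot>\<^bsub>M\<^esub> (C x s \<odot>\<^bsub>M\<^esub> s)) ?A"
      using Cx[OF rx(2)] M.smult_finsum[OF fin rx(1), of "\<lambda>s. C x s \<odot>\<^bsub>M\<^esub> s"] Cc[OF rx(2)] supS SM
      by (auto simp: Pi_def subset_iff M.smult_closed)
    also have "\<dots> = finsum M (\<lambda>s. ?c s \<odot>\<^bsub>M\<^esub> s) ?A"
      using Cc[OF rx(2)] supS SM rx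
      by (intro M.M.finsum_cong') (auto simp: Pi_def subset_iff M.smult_closed M.smult_assoc)
    also have "\<dots> = finsum M (\<lambda>s. ?c s \<odot>\<^bsub>M\<^esub> s) (sup ?c)"
      using Cc[OF rx(2)] supS rx
      by (intro combM0[symmetric] fin sub) (auto simp: Pi_def)
    finally show "coord (r \<odot>\<^bsub>M\<^esub> x) ?c"
      using Cc[OF rx(2)] rx finite_subset[OF sub fin] by (auto simp: coord_def)
  qed (use rx M.smult_closed in simp)
  have add: "\<gamma> (x \<oplus>\<^bsub>M\<^esub> y) = \<gamma> x \<oplus>\<^bsub>L\<^esub> \<gamma> y" if xy: "x \<in> carrier M" "y \<in> carrier M" for x y
  proof -
    let ?A = "sup (C x) \<union> sup (C y)"
    have fin: "finite ?A" using Cf xy by simp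
    have sub: "sup (C (x \<oplus>\<^bsub>M\<^esub> y)) \<subseteq> ?A" using C_add[OF xy] by (auto simp: sup_def)
    have "\<gamma> (x \<oplus>\<^bsub>M\<^esub> y) = finsum L (\<lambda>s. C (x \<oplus>\<^bsub>M\<^esub> y) s \<odot>\<^bsub>L\<^esub> t s) ?A"
      using comb[OF _ fin sub] supS xy by simp
    also have "\<dots> = finsum L (\<lambda>s. C x s \<odot>\<^bsub>L\<^esub> t s \<oplus>\<^bsub>L\<^esub> C y s \<odot>\<^bsub>L\<^esub> t s) ?A"
      using Cc[OF xy(1)] Cc[OF xy(2)] supS tS C_add[OF xy]
      by (intro L.M.finsum_cong') (auto simp: Pi_def subset_iff L.smult_closed L.smult_l_distr)
    also have "\<dots> = finsum L (\<lambda>s. C x s \<odot>\<^bsub>L\<^esub> t s) ?A \<oplus>\<^bsub>L\<^esub> finsum L (\<lambda>s. C y s \<odot>\<^bsub>L\<^esub> t s) ?A"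
      using Cc[OF xy(1)] Cc[OF xy(2)] supS tS
      by (intro L.M.finsum_addf) (auto simp: Pi_def subset_iff L.smult_closed)
    finally show ?thesis
      using comb[OF xy(1) fin] comb[OF xy(2) fin] supS by simp
  qed
  have smult: "\<gamma> (r \<odot>\<^bsub>M\<^esub> x) = r \<odot>\<^bsub>L\<^esub> \<gamma> x" if rx: "r \<in> carrier R" "x \<in> carrier M" for r x
  proof -
    let ?A = "sup (C x)"
    have fin: "finite ?A" using Cf rx by simp
    have sub: "sup (C (r \<odot>\<^bsub>M\<^esub> x)) \<subseteq> ?A" using C_smult[OF rx] rx by (auto simp: sup_def)
    have "\<gamma> (r \<odot>\<^bsub>M\<^esub> x) = finsum L (\<lambda>s. C (r \<odot>\<^bsub>M\<^esub> x) s \<odot>\<^bsub>L\<^esub> t s) ?A"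
      using comb[OF _ fin sub] supS rx M.smult_closed by simp
    also have "\<dots> = finsum L (\<lambda>s. r \<odot>\<^bsub>L\<^esub> (C x s \<odot>\<^bsub>L\<^esub> t s)) ?A"
      using Cc[OF rx(2)] supS tS C_smult[OF rx] rx
      by (intro L.M.finsum_cong') (auto simp: Pi_def subset_iff L.smult_closed L.smult_assoc)
    also have "\<dots> = r \<odot>\<^bsub>L\<^esub> \<gamma> x"
      unfolding \<gamma>_def using Cc[OF rx(2)] supS tS rx fin
      by (intro L.smult_finsum[symmetric]) (auto simp: Pi_def subset_iff L.smult_closed)
    finally show ?thesis .
  qed
  have "\<beta> (\<gamma> x) = \<alpha> x" if x: "x \<in> carrier M" for x
  proof -
    have "\<beta> (\<gamma> x) = finsum N (\<lambda>s. \<beta> (C x s \<odot>\<^bsub>L\<^esub> t s)) (sup (C x))"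
      unfolding \<gamma>_def using Cc[OF x] Cf[OF x] supS tS
      by (intro lmod_hom_finsum[OF \<beta> L N]) (auto simp: Pi_def subset_iff L.smult_closed)
    also have "\<dots> = finsum N (\<lambda>s. \<alpha> (C x s \<odot>\<^bsub>M\<^esub> s)) (sup (C x))"
      using Cc[OF x] supS t SM \<alpha> \<beta>
      by (intro N.M.finsum_cong')
        (auto simp: Pi_def subset_iff M.smult_closed N.smult_closed lmod_hom_closed lmod_hom_smult)
    also have "\<dots> = \<alpha> (finsum M (\<lambda>s. C x s \<odot>\<^bsub>M\<^esub> s) (sup (C x)))"
      using Cc[OF x] Cf[OF x] supS SM
      by (intro lmod_hom_finsum[OF \<alpha> lM N, symmetric]) (auto simp: Pi_def subset_iff M.smult_closed)
    finally show ?thesis using Cx[OF x] by simp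
  qed
  moreover have "restrict \<gamma> (carrier M) \<in> lmod_hom R M L"
    using closed add smult lM by (rule lmod_homI)
  ultimately show ?thesis by (intro bexI[of _ "restrict \<gamma> (carrier M)"]) simp_all
qed

section \<open>Comparison of free resolutions\<close>

text \<open>\<open>chain_lifts\<close> with a second resolution as target. For \<open>q = 0\<close>
  and the augmentation as \<open>g\<close> these are comparison maps of resolutions; for zero as
  \<open>g\<close> they are the chain maps to be contracted by a homotopy.\<close>

definition chain_lifts_between ::
    "('k, 'r) module \<Rightarrow> (nat \<Rightarrow> ('r, 'm) module) \<Rightarrow> (nat \<Rightarrow> 'm \<Rightarrow> 'm) \<Rightarrow>
      (nat \<Rightarrow> ('r, 'l) module) \<Rightarrow> (nat \<Rightarrow> 'l \<Rightarrow> 'l) \<Rightarrow> ('l \<Rightarrow> 'n) \<Rightarrow>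
      nat \<Rightarrow> ('m \<Rightarrow> 'n) \<Rightarrow> (nat \<Rightarrow> 'm \<Rightarrow> 'l) set"
  where "chain_lifts_between R P d Q e \<eta> q g =
    {\<phi>. (\<forall>i. \<phi> i \<in> lmod_hom R (P (q + i)) (Q i)) \<and>
        (\<forall>x\<in>carrier (P q). \<eta> (\<phi> 0 x) = g x) \<and>
        (\<forall>i. \<forall>x\<in>carrier (P (q + Suc i)). e i (\<phi> (Suc i) x) = \<phi> i (d (q + i) x))}"

lemma chain_lifts_eq: "chain_lifts R P d \<epsilon> = chain_lifts_between R P d P d \<epsilon>"
  by (auto simp: chain_lifts_def chain_lifts_between_def fun_eq_iff)

lemma free_resolutionD:
  assumes "free_resolution R M P d \<epsilon>"
  shows "left_module R M" "\<And>n. free_left_module R (P n)" "\<And>n. left_module R (P n)"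
    "\<And>n. d n \<in> lmod_hom R (P (Suc n)) (P n)" "\<epsilon> \<in> lmod_hom R (P 0) M"
    "\<epsilon> ` carrier (P 0) = carrier M"
    "d 0 ` carrier (P (Suc 0)) = {x \<in> carrier (P 0). \<epsilon> x = \<zero>\<^bsub>M\<^esub>}"
    "\<And>n. d (Suc n) ` carrier (P (Suc (Suc n))) = {x \<in> carrier (P (Suc n)). d n x = \<zero>\<^bsub>P n\<^esub>}"
    "\<And>x. x \<in> carrier (P (Suc 0)) \<Longrightarrow> \<epsilon> (d 0 x) = \<zero>\<^bsub>M\<^esub>"
    "\<And>n x. x \<in> carrier (P (Suc (Suc n))) \<Longrightarrow> d n (d (Suc n) x) = \<zero>\<^bsub>P n\<^esub>"
    "\<And>n x. x \<in> carrier (P (Suc n)) \<Longrightarrow> d n x \<in> carrier (P n)"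
proof -
  show *: "left_module R M" "\<And>n. free_left_module R (P n)" "\<And>n. left_module R (P n)"
    "\<And>n. d n \<in> lmod_hom R (P (Suc n)) (P n)" "\<epsilon> \<in> lmod_hom R (P 0) M"
    "\<epsilon> ` carrier (P 0) = carrier M"
    "d 0 ` carrier (P (Suc 0)) = {x \<in> carrier (P 0). \<epsilon> x = \<zero>\<^bsub>M\<^esub>}"
    "\<And>n. d (Suc n) ` carrier (P (Suc (Suc n))) = {x \<in> carrier (P (Suc n)). d n x = \<zero>\<^bsub>P n\<^esub>}"
    using assms by (auto simp: free_resolution_def free_left_module_def)
  show "\<And>x. x \<in> carrier (P (Suc 0)) \<Longrightarrow> \<epsilon> (d 0 x) = \<zero>\<^bsub>M\<^esub>"
    using *(7) by blast
  show "\<And>n x. x \<in> carrier (P (Suc (Suc n))) \<Longrightarrow> d n (d (Suc n) x) = \<zero>\<^bsub>P n\<^esub>"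
    using *(8) by blast
  show "\<And>n x. x \<in> carrier (P (Suc n)) \<Longrightarrow> d n x \<in> carrier (P n)"
    by (rule lmod_hom_closed[OF *(4)])
qed

text \<open>Freeness of \<open>P\<close> supplies the next component as soon as the previous one
  sends boundaries to cycles of \<open>Q\<close>, which are boundaries by exactness.\<close>

lemma ex_chain_lift:
  fixes P :: "nat \<Rightarrow> ('r, 'm) module" and Q :: "nat \<Rightarrow> ('r, 'l) module" and M :: "('r, 'n) module"
  assumes P: "free_resolution R M' P d \<epsilon>" and Q: "free_resolution R M Q e \<eta>"
    and g: "g \<in> lmod_hom R (P q) M" "\<And>x. x \<in> carrier (P (Suc q)) \<Longrightarrow> g (d q x) = \<zero>\<^bsub>M\<^esub>"
  obtains \<phi> where "\<phi> \<in> chain_lifts_between R P d Q e \<eta> q g"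
proof -
  note p = free_resolutionD[OF P] and q = free_resolutionD[OF Q]
  \<comment> \<open>The last conjunct is carried along because the choice of the next component
    depends on it; the condition for \<open>n = 0\<close> fixes the augmentation.\<close>
  define K where "K n f \<longleftrightarrow> f \<in> lmod_hom R (P (q + n)) (Q n) \<and>
      (n = 0 \<longrightarrow> (\<forall>x\<in>carrier (P q). \<eta> (f x) = g x)) \<and>
      (\<forall>x\<in>carrier (P (Suc (q + n))). f (d (q + n) x) \<in> e n ` carrier (Q (Suc n)))" for n f
  have "\<exists>\<phi>. \<forall>n. K n (\<phi> n) \<and> (\<forall>x\<in>carrier (P (q + Suc n)). e n (\<phi> (Suc n) x) = \<phi> n (d (q + n) x))"
  proof (rule dependent_nat_choice)
    have "g ` carrier (P q) \<subseteq> \<eta> ` carrier (Q 0)"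
      using lmod_hom_closed[OF g(1)] q(6) by auto
    then obtain f where f: "f \<in> lmod_hom R (P q) (Q 0)" "\<And>x. x \<in> carrier (P q) \<Longrightarrow> \<eta> (f x) = g x"
      using free_module_lift[OF p(2) q(3) q(1) g(1) q(5)] by blast
    have "f (d q x) \<in> e 0 ` carrier (Q (Suc 0))" if x: "x \<in> carrier (P (Suc q))" for x
      using lmod_hom_closed[OF f(1) p(11)[OF x]] f(2)[OF p(11)[OF x]] g(2)[OF x] by (simp add: q(7))
    then have "K 0 f" using f by (simp add: K_def)
    then show "\<exists>f. K 0 f" by (rule exI[of _ f])
  next
    fix f n
    assume K: "K n f"
    then have f: "f \<in> lmod_hom R (P (q + n)) (Q n)" by (simp add: K_def)
    have fd: "compose (carrier (P (Suc (q + n)))) f (d (q + n)) \<in> lmod_hom R (P (Suc (q + n))) (Q n)"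
      by (rule lmod_hom_compose[OF f p(4) p(3)])
    have "compose (carrier (P (Suc (q + n)))) f (d (q + n)) ` carrier (P (Suc (q + n))) \<subseteq> e n ` carrier (Q (Suc n))"
      using K by (auto simp: K_def compose_eq)
    from free_module_lift[OF p(2) q(3) q(3) fd q(4) this]
    obtain h where h: "h \<in> lmod_hom R (P (Suc (q + n))) (Q (Suc n))"
      "\<And>x. x \<in> carrier (P (Suc (q + n))) \<Longrightarrow> e n (h x) = f (d (q + n) x)"
      by (auto simp: compose_eq)
    have "h (d (Suc (q + n)) x) \<in> e (Suc n) ` carrier (Q (Suc (Suc n)))"
      if x: "x \<in> carrier (P (Suc (Suc (q + n))))" for x
      using h(2)[OF p(11)[OF x]] lmod_hom_closed[OF h(1) p(11)[OF x]] lmod_hom_zero[OF f p(3) q(3)] p(10)[OF x]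
      by (simp add: q(8))
    then have "K (Suc n) h" using h by (simp add: K_def)
    then show "\<exists>h. K (Suc n) h \<and> (\<forall>x\<in>carrier (P (q + Suc n)). e n (h x) = f (d (q + n) x))"
      using h(2) by auto
  qed
  then obtain \<phi> where "\<And>n. K n (\<phi> n)"
    "\<And>n x. x \<in> carrier (P (q + Suc n)) \<Longrightarrow> e n (\<phi> (Suc n) x) = \<phi> n (d (q + n) x)" by blast
  then show thesis
    by (intro that[of \<phi>]) (auto simp: chain_lifts_between_def K_def)
qed

text \<open>Each new component of \<open>h\<close> lifts the difference of \<chi> and
  \<open>h d\<close> through \<open>e\<close>; this is possible because \<open>e\<close> kills that
  difference. The start needs that \<chi> augments to zero.\<close>

lemma ex_homotopy:
  fixes P :: "nat \<Rightarrow> ('r, 'm) module" and Q :: "nat \<Rightarrow> ('r, 'l) module" and M :: "('r, 'n) module"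
  assumes P: "free_resolution R M' P d \<epsilon>" and Q: "free_resolution R M Q e \<eta>"
    and c: "\<chi> \<in> chain_lifts_between R P d Q e \<eta> q (\<lambda>x. \<zero>\<^bsub>M\<^esub>)"
  obtains h where "\<And>i. h i \<in> lmod_hom R (P (q + i)) (Q (Suc i))"
    "\<And>x. x \<in> carrier (P q) \<Longrightarrow> \<chi> 0 x = e 0 (h 0 x)"
    "\<And>i x. x \<in> carrier (P (Suc (q + i))) \<Longrightarrow>
      \<chi> (Suc i) x = e (Suc i) (h (Suc i) x) \<oplus>\<^bsub>Q (Suc i)\<^esub> h i (d (q + i) x)"
proof -
  note p = free_resolutionD[OF P] and q = free_resolutionD[OF Q]
  have \<chi>: "\<And>i. \<chi> i \<in> lmod_hom R (P (q + i)) (Q i)"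
    and \<chi>0: "\<And>x. x \<in> carrier (P q) \<Longrightarrow> \<eta> (\<chi> 0 x) = \<zero>\<^bsub>M\<^esub>"
    and \<chi>d: "\<And>i x. x \<in> carrier (P (Suc (q + i))) \<Longrightarrow> e i (\<chi> (Suc i) x) = \<chi> i (d (q + i) x)"
    using c by (auto simp: chain_lifts_between_def)
  have \<chi>S: "\<chi> (Suc i) \<in> lmod_hom R (P (Suc (q + i))) (Q (Suc i))" for i
    using \<chi>[of "Suc i"] by simp
  define K where "K n f \<longleftrightarrow> f \<in> lmod_hom R (P (q + n)) (Q (Suc n)) \<and>
      (n = 0 \<longrightarrow> (\<forall>x\<in>carrier (P q). e 0 (f x) = \<chi> 0 x)) \<and>
      (\<forall>x\<in>carrier (P (Suc (q + n))). \<chi> (Suc n) x \<ominus>\<^bsub>Q (Suc n)\<^esub> f (d (q + n) x) \<in> e (Suc n) ` carrier (Q (Suc (Suc n))))" for n f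
  have KI: "\<chi> (Suc n) x \<ominus>\<^bsub>Q (Suc n)\<^esub> f (d (q + n) x) \<in> e (Suc n) ` carrier (Q (Suc (Suc n)))"
    if x: "x \<in> carrier (P (Suc (q + n)))" and f: "f \<in> lmod_hom R (P (q + n)) (Q (Suc n))"
      and eq: "e n (f (d (q + n) x)) = \<chi> n (d (q + n) x)" for n f x
  proof -
    interpret Qn: left_module R "Q n" by (rule q(3))
    interpret Qs: left_module R "Q (Suc n)" by (rule q(3))
    have cl: "f (d (q + n) x) \<in> carrier (Q (Suc n))" "\<chi> (Suc n) x \<in> carrier (Q (Suc n))"
      using lmod_hom_closed[OF f p(11)[OF x]] lmod_hom_closed[OF \<chi>S x] by auto
    have "e n (\<chi> (Suc n) x \<ominus>\<^bsub>Q (Suc n)\<^esub> f (d (q + n) x)) = e n (\<chi> (Suc n) x) \<ominus>\<^bsub>Q n\<^esub> e n (f (d (q + n) x))"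
      by (rule lmod_hom_minus[OF q(4) q(3) q(3) cl(2,1)])
    also have "\<dots> = \<zero>\<^bsub>Q n\<^esub>"
      using eq \<chi>d[OF x] lmod_hom_closed[OF \<chi> p(11)[OF x]] by (simp add: a_minus_def Qn.M.r_neg)
    finally show ?thesis using cl by (simp add: q(8))
  qed
  have "\<exists>h. \<forall>n. K n (h n) \<and> (\<forall>x\<in>carrier (P (Suc (q + n))).
      e (Suc n) (h (Suc n) x) = \<chi> (Suc n) x \<ominus>\<^bsub>Q (Suc n)\<^esub> h n (d (q + n) x))"
  proof (rule dependent_nat_choice)
    have \<chi>00: "\<chi> 0 \<in> lmod_hom R (P q) (Q 0)" using \<chi>[of 0] by simp
    have "\<chi> 0 ` carrier (P q) \<subseteq> e 0 ` carrier (Q (Suc 0))"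
      using \<chi>0 lmod_hom_closed[OF \<chi>00] by (auto simp: q(7))
    from free_module_lift[OF p(2) q(3) q(3) \<chi>00 q(4) this]
    obtain f where f: "f \<in> lmod_hom R (P q) (Q (Suc 0))" "\<And>x. x \<in> carrier (P q) \<Longrightarrow> e 0 (f x) = \<chi> 0 x"
      by blast
    have "K 0 f"
      using f KI[of _ 0 f] p(11) by (simp add: K_def)
    then show "\<exists>f. K 0 f" by (rule exI[of _ f])
  next
    fix f n
    assume K: "K n f"
    then have f: "f \<in> lmod_hom R (P (q + n)) (Q (Suc n))" by (simp add: K_def)
    let ?g = "\<lambda>x\<in>carrier (P (Suc (q + n))). \<chi> (Suc n) x \<ominus>\<^bsub>Q (Suc n)\<^esub> compose (carrier (P (Suc (q + n)))) f (d (q + n)) x"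
    have fd: "compose (carrier (P (Suc (q + n)))) f (d (q + n)) \<in> lmod_hom R (P (Suc (q + n))) (Q (Suc n))"
      by (rule lmod_hom_compose[OF f p(4) p(3)])
    have g: "?g \<in> lmod_hom R (P (Suc (q + n))) (Q (Suc n))"
      by (rule lmod_hom_diff[OF \<chi>S fd p(3) q(3)])
    have "?g ` carrier (P (Suc (q + n))) \<subseteq> e (Suc n) ` carrier (Q (Suc (Suc n)))"
      using K by (auto simp: K_def compose_eq)
    from free_module_lift[OF p(2) q(3) q(3) g q(4) this]
    obtain h where h: "h \<in> lmod_hom R (P (Suc (q + n))) (Q (Suc (Suc n)))"
      "\<And>x. x \<in> carrier (P (Suc (q + n))) \<Longrightarrow> e (Suc n) (h x) = \<chi> (Suc n) x \<ominus>\<^bsub>Q (Suc n)\<^esub> f (d (q + n) x)"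
      by (auto simp: compose_eq)
    \<comment> \<open>On a boundary the term \<open>f d\<close> vanishes by \<open>d d = 0\<close>,
      so the hypothesis of \<open>KI\<close> holds one degree higher.\<close>
    have "e (Suc n) (h (d (Suc (q + n)) x)) = \<chi> (Suc n) (d (Suc (q + n)) x)"
      if x: "x \<in> carrier (P (Suc (Suc (q + n))))" for x
    proof -
      interpret Qs: left_module R "Q (Suc n)" by (rule q(3))
      show ?thesis
        using h(2)[OF p(11)[OF x]] p(10)[OF x] lmod_hom_zero[OF f p(3) q(3)] lmod_hom_closed[OF \<chi>S p(11)[OF x]]
        by (simp add: a_minus_def)
    qed
    then have "K (Suc n) h" using h KI[of _ "Suc n" h] by (simp add: K_def)
    then show "\<exists>h. K (Suc n) h \<and> (\<forall>x\<in>carrier (P (Suc (q + n))).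
        e (Suc n) (h x) = \<chi> (Suc n) x \<ominus>\<^bsub>Q (Suc n)\<^esub> f (d (q + n) x))"
      using h(2) by auto
  qed
  then obtain h where hK: "\<And>n. K n (h n)" and
    h: "\<And>n x. x \<in> carrier (P (Suc (q + n))) \<Longrightarrow>
      e (Suc n) (h (Suc n) x) = \<chi> (Suc n) x \<ominus>\<^bsub>Q (Suc n)\<^esub> h n (d (q + n) x)" by blast
  show thesis
  proof
    show hom: "h i \<in> lmod_hom R (P (q + i)) (Q (Suc i))" for i using hK by (simp add: K_def)
    show "\<chi> 0 x = e 0 (h 0 x)" if "x \<in> carrier (P q)" for x
      using hK[of 0] that by (simp add: K_def)
    show "\<chi> (Suc i) x = e (Suc i) (h (Suc i) x) \<oplus>\<^bsub>Q (Suc i)\<^esub> h i (d (q + i) x)"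
      if x: "x \<in> carrier (P (Suc (q + i)))" for i x
    proof -
      interpret Qs: left_module R "Q (Suc i)" by (rule q(3))
      have "h i (d (q + i) x) \<in> carrier (Q (Suc i))" "\<chi> (Suc i) x \<in> carrier (Q (Suc i))"
        using lmod_hom_closed[OF hom p(11)[OF x]] lmod_hom_closed[OF \<chi>S x] by auto
      then show ?thesis using h[OF x] by (simp add: a_minus_def Qs.M.a_assoc Qs.M.l_neg)
    qed
  qed
qed

text \<open>
  This one statement yields the independence of the Yoneda product from all choices and both halves of
  the comparison of Ext groups: \<open>\<chi>\<close> will be a difference of two chain maps whose augmentations differ
  by a coboundary.
\<close>

lemma cocycle_chain_map_coboundary:
  fixes P :: "nat \<Rightarrow> ('r, 'm) module" and Q :: "nat \<Rightarrow> ('r, 'l) module" and M :: "('r, 'n) module"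
    and N :: "('r, 'n2) module"
  assumes P: "free_resolution R M' P d \<epsilon>" and Q: "free_resolution R M Q e \<eta>" and N: "left_module R N"
    and \<chi>: "\<chi> \<in> chain_lifts_between R P d Q e \<eta> q g" and g: "g \<in> ext_coboundaries R M P d q"
    and f: "f \<in> lmod_hom R (Q p) N" "\<And>x. x \<in> carrier (Q (Suc p)) \<Longrightarrow> f (e p x) = \<zero>\<^bsub>N\<^esub>"
  shows "compose (carrier (P (q + p))) f (\<chi> p) \<in> ext_coboundaries R N P d (q + p)"
proof -
  note pp = free_resolutionD[OF P] and qq = free_resolutionD[OF Q]
  interpret N: left_module R N by fact
  \<comment> \<open>For zero augmentation, \<psi> is \<open>e h + h d\<close> in positive degree.
    The cocycle \<open>f\<close> kills the first summand and the second becomes the coboundary of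
    \<open>f h\<close>.\<close>
  have main: "compose (carrier (P (q + Suc p'))) f (\<psi> (Suc p')) \<in> ext_coboundaries R N P d (q + Suc p')"
    if \<psi>: "\<psi> \<in> chain_lifts_between R P d Q e \<eta> q (\<lambda>x. \<zero>\<^bsub>M\<^esub>)" and p: "p = Suc p'" for \<psi> p'
  proof -
    obtain h where h: "\<And>i. h i \<in> lmod_hom R (P (q + i)) (Q (Suc i))"
      and "\<And>x. x \<in> carrier (P q) \<Longrightarrow> \<psi> 0 x = e 0 (h 0 x)"
      and h2: "\<And>i x. x \<in> carrier (P (Suc (q + i))) \<Longrightarrow>
        \<psi> (Suc i) x = e (Suc i) (h (Suc i) x) \<oplus>\<^bsub>Q (Suc i)\<^esub> h i (d (q + i) x)"
      by (rule ex_homotopy[OF P Q \<psi>]) blast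
    have "compose (carrier (P (Suc (q + p')))) f (\<psi> (Suc p')) =
        compose (carrier (P (Suc (q + p')))) (compose (carrier (P (q + p'))) f (h p')) (d (q + p'))"
    proof (rule ext)
      fix x
      show "compose (carrier (P (Suc (q + p')))) f (\<psi> (Suc p')) x =
        compose (carrier (P (Suc (q + p')))) (compose (carrier (P (q + p'))) f (h p')) (d (q + p')) x"
      proof (cases "x \<in> carrier (P (Suc (q + p')))")
        case True
        have 1: "h (Suc p') x \<in> carrier (Q (Suc (Suc p')))"
          using lmod_hom_closed[OF h[of "Suc p'"]] True by simp
        have 2: "h p' (d (q + p') x) \<in> carrier (Q (Suc p'))"
          using lmod_hom_closed[OF h pp(11)[OF True]] .
        have "f (\<psi> (Suc p') x) = f (e (Suc p') (h (Suc p') x)) \<oplus>\<^bsub>N\<^esub> f (h p' (d (q + p') x))"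
          using h2[OF True] lmod_hom_add[OF f(1)[unfolded p] qq(11)[OF 1] 2] by simp
        also have "\<dots> = f (h p' (d (q + p') x))"
          using f(2)[unfolded p, OF 1] lmod_hom_closed[OF f(1)[unfolded p] 2] by simp
        finally show ?thesis using True pp(11)[OF True] by (simp add: compose_def)
      qed (simp add: compose_def)
    qed
    moreover have "compose (carrier (P (q + p'))) f (h p') \<in> lmod_hom R (P (q + p')) N"
      using lmod_hom_compose[OF f(1)[unfolded p] h pp(3)] .
    ultimately show ?thesis by auto
  qed
  show ?thesis
  proof (cases q)
    case 0
    then have \<psi>: "\<chi> \<in> chain_lifts_between R P d Q e \<eta> q (\<lambda>x. \<zero>\<^bsub>M\<^esub>)"
      using \<chi> g by (auto simp: chain_lifts_between_def)
    show ?thesis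
    proof (cases p)
      case p: 0
      obtain h where h: "\<And>i. h i \<in> lmod_hom R (P (q + i)) (Q (Suc i))"
        and h2: "\<And>x. x \<in> carrier (P q) \<Longrightarrow> \<chi> 0 x = e 0 (h 0 x)"
        and "\<And>i x. x \<in> carrier (P (Suc (q + i))) \<Longrightarrow>
          \<chi> (Suc i) x = e (Suc i) (h (Suc i) x) \<oplus>\<^bsub>Q (Suc i)\<^esub> h i (d (q + i) x)"
        by (rule ex_homotopy[OF P Q \<psi>]) blast
      have "f (\<chi> 0 x) = \<zero>\<^bsub>N\<^esub>" if "x \<in> carrier (P 0)" for x
        using f(2)[of "h 0 x"] h2[of x] lmod_hom_closed[OF h[of 0], of x] that p 0 by simp
      then show ?thesis by (auto simp: p 0 compose_def)
    qed (use main[OF \<psi>] in simp)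
  next
    case (Suc q')
    obtain g' where g': "g' \<in> lmod_hom R (P q') M" and gg': "g = compose (carrier (P (Suc q'))) g' (d q')"
      using g Suc by auto
    have "g' ` carrier (P q') \<subseteq> \<eta> ` carrier (Q 0)"
      using lmod_hom_closed[OF g'] qq(6) by auto
    \<comment> \<open>Since \<open>s\<close> lifts \<open>g'\<close>, the composite
      \<open>s d\<close> augments to \<open>g\<close>. Subtracting it from \<open>\<chi> 0\<close>
      alone gives zero augmentation, and \<open>s d d = 0\<close> keeps the component above
      compatible.\<close>
    then obtain s where s: "s \<in> lmod_hom R (P q') (Q 0)" "\<And>x. x \<in> carrier (P q') \<Longrightarrow> \<eta> (s x) = g' x"
      using free_module_lift[OF pp(2) qq(3) qq(1) g' qq(5)] by blast
    interpret Q0: left_module R "Q 0" by (rule qq(3))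
    interpret M: left_module R M by (rule qq(1))
    define t where "t = compose (carrier (P q)) s (d q')"
    have t: "t \<in> lmod_hom R (P q) (Q 0)"
      unfolding t_def Suc by (rule lmod_hom_compose[OF s(1) pp(4) pp(3)])
    have \<chi>h: "\<And>i. \<chi> i \<in> lmod_hom R (P (q + i)) (Q i)"
      and \<chi>0: "\<And>x. x \<in> carrier (P q) \<Longrightarrow> \<eta> (\<chi> 0 x) = g x"
      and \<chi>d: "\<And>i x. x \<in> carrier (P (Suc (q + i))) \<Longrightarrow> e i (\<chi> (Suc i) x) = \<chi> i (d (q + i) x)"
      using \<chi> by (auto simp: chain_lifts_between_def)
    have \<chi>00: "\<chi> 0 \<in> lmod_hom R (P q) (Q 0)" using \<chi>h[of 0] by simp
    define \<psi>0 where "\<psi>0 = (\<lambda>x\<in>carrier (P q). \<chi> 0 x \<ominus>\<^bsub>Q 0\<^esub> t x)"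
    have \<psi>0: "\<psi>0 \<in> lmod_hom R (P q) (Q 0)"
      unfolding \<psi>0_def by (rule lmod_hom_diff[OF \<chi>00 t pp(3) qq(3)])
    have td: "t (d q x) = \<zero>\<^bsub>Q 0\<^esub>" if x: "x \<in> carrier (P (Suc q))" for x
      using pp(11)[OF x] pp(10)[OF x[unfolded Suc]] lmod_hom_zero[OF s(1) pp(3) qq(3)]
      by (simp add: t_def compose_def Suc)
    have "\<eta> (\<psi>0 x) = \<zero>\<^bsub>M\<^esub>" if x: "x \<in> carrier (P q)" for x
    proof -
      have "\<eta> (\<psi>0 x) = \<eta> (\<chi> 0 x) \<ominus>\<^bsub>M\<^esub> \<eta> (t x)"
        using lmod_hom_minus[OF qq(5) qq(3) qq(1) lmod_hom_closed[OF \<chi>00 x] lmod_hom_closed[OF t x]] x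
        by (simp add: \<psi>0_def)
      also have "\<eta> (t x) = g x"
        using s(2)[OF pp(11)[OF x[unfolded Suc]]] x by (simp add: t_def gg' compose_def Suc)
      finally show ?thesis
        using \<chi>0[OF x] lmod_hom_closed[OF qq(5) lmod_hom_closed[OF \<chi>00 x]]
          by (simp add: a_minus_def M.M.r_neg)
    qed
    moreover have "e 0 (\<chi> (Suc 0) x) = \<psi>0 (d q x)" if x: "x \<in> carrier (P (Suc q))" for x
      using \<chi>d[of x 0] x td[OF x] pp(11)[OF x] lmod_hom_closed[OF \<chi>00 pp(11)[OF x]]
      by (simp add: \<psi>0_def a_minus_def)
    ultimately have \<psi>: "\<chi>(0 := \<psi>0) \<in> chain_lifts_between R P d Q e \<eta> q (\<lambda>x. \<zero>\<^bsub>M\<^esub>)"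
      using \<chi>h \<chi>d \<psi>0 unfolding chain_lifts_between_def mem_Collect_eq
      apply (intro conjI allI ballI)
        apply (simp add: fun_upd_def)
       apply simp
      subgoal for i x by (cases i) auto
      done
    show ?thesis
    proof (cases p)
      case p: 0
      obtain h where h: "\<And>i. h i \<in> lmod_hom R (P (q + i)) (Q (Suc i))"
        and h2: "\<And>x. x \<in> carrier (P q) \<Longrightarrow> (\<chi>(0 := \<psi>0)) 0 x = e 0 (h 0 x)"
        and "\<And>i x. x \<in> carrier (P (Suc (q + i))) \<Longrightarrow>
          (\<chi>(0 := \<psi>0)) (Suc i) x = e (Suc i) (h (Suc i) x) \<oplus>\<^bsub>Q (Suc i)\<^esub> h i (d (q + i) x)"
        by (rule ex_homotopy[OF P Q \<psi>]) blast
      \<comment> \<open>Only in degree 0 does the correction enter the result, and its contribution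
        \<open>f s d\<close> is again a coboundary.\<close>
      have "f (\<chi> 0 x) = f (s (d q' x))" if x: "x \<in> carrier (P (Suc q'))" for x
      proof -
        have x': "x \<in> carrier (P q)" using x Suc by simp
        have hx: "h 0 x \<in> carrier (Q (Suc 0))" using lmod_hom_closed[OF h[of 0]] x' by simp
        have "e 0 (h 0 x) = \<chi> 0 x \<ominus>\<^bsub>Q 0\<^esub> t x"
          using h2[OF x'] x' by (simp add: \<psi>0_def)
        then have "\<chi> 0 x = e 0 (h 0 x) \<oplus>\<^bsub>Q 0\<^esub> t x"
          using lmod_hom_closed[OF \<chi>00 x'] lmod_hom_closed[OF t x']
          by (simp add: a_minus_def Q0.M.a_assoc Q0.M.l_neg)
        then have "f (\<chi> 0 x) = f (e 0 (h 0 x)) \<oplus>\<^bsub>N\<^esub> f (t x)"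
          using lmod_hom_add[OF f(1)[unfolded p] qq(11)[OF hx] lmod_hom_closed[OF t x']] by simp
        also have "\<dots> = f (t x)"
          using f(2)[unfolded p, OF hx] lmod_hom_closed[OF f(1)[unfolded p] lmod_hom_closed[OF t x']] by simp
        finally show ?thesis using x' x by (simp add: t_def compose_def)
      qed
      then have "compose (carrier (P (Suc q'))) f (\<chi> 0) =
          compose (carrier (P (Suc q'))) (compose (carrier (P q')) f s) (d q')"
        using pp(11) by (auto simp: compose_def fun_eq_iff)
      moreover have "compose (carrier (P q')) f s \<in> lmod_hom R (P q') N"
        using lmod_hom_compose[OF f(1)[unfolded p] s(1) pp(3)] .
      ultimately show ?thesis by (auto simp: p Suc)
    next
      case (Suc p')
      then show ?thesis using main[OF \<psi> Suc] by simp
    qed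
  qed
qed

section \<open>Ext groups and the Yoneda product\<close>

lemma (in abelian_subgroup) coset_eq_iff:
  assumes "x \<in> carrier G" "y \<in> carrier G"
  shows "H +> x = H +> y \<longleftrightarrow> x \<ominus> y \<in> H"
  using assms a_rcos_self[of x] a_rcos_module[of y x] a_repr_independence'[of x y]
  by (auto simp: a_minus_def)

lemma abelian_group_quotient:
  fixes G (structure)
  assumes "abelian_subgroup H G"
  shows "abelian_group (quotient G H)"
proof -
  interpret abelian_subgroup H G by fact
  have *: "A \<in> a_rcosets H \<Longrightarrow> \<exists>x\<in>carrier G. A = H +> x" for A
    by (auto simp: A_RCOSETS_def')
  show ?thesis
  proof (rule abelian_groupI; simp add: quotient_def)
    show "A <+>\<^bsub>G\<^esub> B \<in> a_rcosets H" if "A \<in> a_rcosets H" "B \<in> a_rcosets H" for A B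
      using that by (rule a_setmult_closed)
    show "H \<in> a_rcosets H" by (rule a_subgroup_in_rcosets)
    show "A <+>\<^bsub>G\<^esub> B <+>\<^bsub>G\<^esub> C = A <+>\<^bsub>G\<^esub> (B <+>\<^bsub>G\<^esub> C)"
      if "A \<in> a_rcosets H" "B \<in> a_rcosets H" "C \<in> a_rcosets H" for A B C
      using that by (rule a_rcosets_assoc)
    show "A <+>\<^bsub>G\<^esub> B = B <+>\<^bsub>G\<^esub> A" if "A \<in> a_rcosets H" "B \<in> a_rcosets H" for A B
      using that[THEN *] by (auto simp: a_rcos_sum a_comm)
    show "H <+>\<^bsub>G\<^esub> A = A" if "A \<in> a_rcosets H" for A
      using that by (rule rcosets_add_eq)
    show "\<exists>B\<in>a_rcosets H. B <+>\<^bsub>G\<^esub> A = H" if "A \<in> a_rcosets H" for A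
      using a_rcosets_inv_mult_group_eq[OF that] a_setinv_closed[OF that] by blast
  qed
qed

lemma chain_lift_hom: "\<phi> \<in> chain_lifts_between S V a Y b c q g \<Longrightarrow> \<phi> i \<in> lmod_hom S (V (q + i)) (Y i)"
  and chain_lift_aug: "\<lbrakk>\<phi> \<in> chain_lifts_between S V a Y b c q g; x \<in> carrier (V q)\<rbrakk> \<Longrightarrow> c (\<phi> 0 x) = g x"
  and chain_lift_d: "\<lbrakk>\<phi> \<in> chain_lifts_between S V a Y b c q g; x \<in> carrier (V (Suc (q + i)))\<rbrakk> \<Longrightarrow>
      b i (\<phi> (Suc i) x) = \<phi> i (a (q + i) x)"
  by (auto simp: chain_lifts_between_def)

lemma chain_lift_hom_Suc: "\<phi> \<in> chain_lifts_between S V a Y b c q g \<Longrightarrow>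
    \<phi> (Suc i) \<in> lmod_hom S (V (Suc (q + i))) (Y (Suc i))"
  using chain_lift_hom[of \<phi> S V a Y b c q g "Suc i"] by simp

definition ext_class ::
    "('k, 'r) module \<Rightarrow> ('r, 'n) module \<Rightarrow> (nat \<Rightarrow> ('r, 'm) module) \<Rightarrow> (nat \<Rightarrow> 'm \<Rightarrow> 'm) \<Rightarrow>
      nat \<Rightarrow> ('m \<Rightarrow> 'n) \<Rightarrow> ('m \<Rightarrow> 'n) set"
  where "ext_class R M P d n f = ext_coboundaries R M P d n +>\<^bsub>ext_cocycles R M P d n\<^esub> f"

locale ext_groups =
  fixes R :: "('k, 'r) module" and M' :: "('r, 'n2) module" and P :: "nat \<Rightarrow> ('r, 'm) module"
    and d \<epsilon> and N :: "('r, 'n) module"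
  assumes P: "free_resolution R M' P d \<epsilon>" and N: "left_module R N"
begin

abbreviation "Z n \<equiv> ext_cocycles R N P d n"
abbreviation "B n \<equiv> ext_coboundaries R N P d n"

lemmas p = free_resolutionD[OF P]

sublocale N: left_module R N by (rule N)

lemma cocycle_iff: "f \<in> carrier (Z n) \<longleftrightarrow>
    f \<in> lmod_hom R (P n) N \<and> (\<forall>x\<in>carrier (P (Suc n)). f (d n x) = \<zero>\<^bsub>N\<^esub>)"
  by (simp add: ext_cocycles_def)

lemma cocycle_hom: "f \<in> carrier (Z n) \<Longrightarrow> f \<in> lmod_hom R (P n) N"
  by (simp add: ext_cocycles_def)

lemma cocycle_closed: "f \<in> carrier (Z n) \<Longrightarrow> x \<in> carrier (P n) \<Longrightarrow> f x \<in> carrier N"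
  by (rule lmod_hom_closed[OF cocycle_hom])

lemma cocycle_eqI:
  assumes "f \<in> carrier (Z n)" "g \<in> carrier (Z n)" "\<And>x. x \<in> carrier (P n) \<Longrightarrow> f x = g x"
  shows "f = g"
proof -
  have "restrict f (carrier (P n)) = restrict g (carrier (P n))"
    using assms(3) by (rule restrict_ext)
  then show ?thesis
    using assms(1,2) by (simp add: lmod_hom_restrict[OF cocycle_hom])
qed

lemma Z_simps:
  "f \<oplus>\<^bsub>Z n\<^esub> g = (\<lambda>x\<in>carrier (P n). f x \<oplus>\<^bsub>N\<^esub> g x)"
  "\<zero>\<^bsub>Z n\<^esub> = (\<lambda>x\<in>carrier (P n). \<zero>\<^bsub>N\<^esub>)"
  by (simp_all add: ext_cocycles_def)

lemma zero_cocycle: "(\<lambda>x\<in>carrier (P n). \<zero>\<^bsub>N\<^esub>) \<in> carrier (Z n)"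
  using lmod_hom_const_zero[OF p(3) N] p(11) by (simp add: cocycle_iff)

lemma add_cocycle:
  assumes "f \<in> carrier (Z n)" "g \<in> carrier (Z n)"
  shows "(\<lambda>x\<in>carrier (P n). f x \<oplus>\<^bsub>N\<^esub> g x) \<in> carrier (Z n)"
  using assms lmod_hom_sum[OF _ _ p(3) N] p(11) by (simp add: cocycle_iff)

lemma diff_cocycle:
  assumes "f \<in> carrier (Z n)" "g \<in> carrier (Z n)"
  shows "(\<lambda>x\<in>carrier (P n). f x \<ominus>\<^bsub>N\<^esub> g x) \<in> carrier (Z n)"
  using assms lmod_hom_diff[OF _ _ p(3) N] p(11) by (simp add: cocycle_iff a_minus_def)

sublocale Z: abelian_group "Z n" for n
proof (rule abelian_groupI; (unfold Z_simps)?)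
  fix f assume f: "f \<in> carrier (Z n)"
  show "\<exists>g\<in>carrier (Z n). (\<lambda>x\<in>carrier (P n). g x \<oplus>\<^bsub>N\<^esub> f x) = (\<lambda>x\<in>carrier (P n). \<zero>\<^bsub>N\<^esub>)"
    using diff_cocycle[OF zero_cocycle f] cocycle_closed[OF f]
    by (intro bexI[where x = "\<lambda>x\<in>carrier (P n). (\<lambda>x\<in>carrier (P n). \<zero>\<^bsub>N\<^esub>) x \<ominus>\<^bsub>N\<^esub> f x"])
      (auto intro!: restrict_ext simp: a_minus_def N.M.l_neg)
next
  fix f g h assume f: "f \<in> carrier (Z n)" "g \<in> carrier (Z n)" "h \<in> carrier (Z n)"
  then show "(\<lambda>x\<in>carrier (P n). (\<lambda>x\<in>carrier (P n). f x \<oplus>\<^bsub>N\<^esub> g x) x \<oplus>\<^bsub>N\<^esub> h x) =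
      (\<lambda>x\<in>carrier (P n). f x \<oplus>\<^bsub>N\<^esub> (\<lambda>x\<in>carrier (P n). g x \<oplus>\<^bsub>N\<^esub> h x) x)"
    by (auto intro!: restrict_ext simp: cocycle_closed N.M.a_assoc)
next
  fix f g assume f: "f \<in> carrier (Z n)" "g \<in> carrier (Z n)"
  then show "(\<lambda>x\<in>carrier (P n). f x \<oplus>\<^bsub>N\<^esub> g x) = (\<lambda>x\<in>carrier (P n). g x \<oplus>\<^bsub>N\<^esub> f x)"
    by (auto intro!: restrict_ext simp: cocycle_closed N.M.a_comm)
next
  fix f assume f: "f \<in> carrier (Z n)"
  show "(\<lambda>x\<in>carrier (P n). (\<lambda>x\<in>carrier (P n). \<zero>\<^bsub>N\<^esub>) x \<oplus>\<^bsub>N\<^esub> f x) = f"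
    by (rule cocycle_eqI[OF add_cocycle[OF zero_cocycle f] f]) (simp add: cocycle_closed[OF f])
qed (simp_all add: zero_cocycle add_cocycle)

lemma Z_minus:
  assumes "f \<in> carrier (Z n)" "g \<in> carrier (Z n)"
  shows "f \<ominus>\<^bsub>Z n\<^esub> g = (\<lambda>x\<in>carrier (P n). f x \<ominus>\<^bsub>N\<^esub> g x)"
proof -
  let ?h = "\<lambda>x\<in>carrier (P n). f x \<ominus>\<^bsub>N\<^esub> g x"
  have "?h \<oplus>\<^bsub>Z n\<^esub> g = f"
    unfolding Z_simps
    by (rule cocycle_eqI[OF add_cocycle[OF diff_cocycle[OF assms] assms(2)] assms(1)])
      (simp add: cocycle_closed[OF assms(1)] cocycle_closed[OF assms(2)] a_minus_def N.M.a_assoc N.M.l_neg)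
  then show ?thesis
    using Z.add.inv_solve_right'[OF diff_cocycle[OF assms] assms] by (simp add: a_minus_def)
qed

lemma coboundaryI: "f \<in> lmod_hom R (P n) N \<Longrightarrow> compose (carrier (P (Suc n))) f (d n) \<in> B (Suc n)"
  by auto

lemma coboundary_cocycle: "B n \<subseteq> carrier (Z n)"
proof (cases n)
  case 0
  then show ?thesis using zero_cocycle by auto
next
  case (Suc m)
  show ?thesis
  proof
    fix b assume "b \<in> B n"
    then obtain f where f: "f \<in> lmod_hom R (P m) N" "b = compose (carrier (P (Suc m))) f (d m)"
      using Suc by auto
    then show "b \<in> carrier (Z n)"
      using lmod_hom_compose[OF f(1) p(4) p(3)] p(10) p(11) lmod_hom_zero[OF f(1) p(3) N]
      by (simp add: cocycle_iff Suc compose_eq)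
  qed
qed

lemma zero_coboundary: "(\<lambda>x\<in>carrier (P n). \<zero>\<^bsub>N\<^esub>) \<in> B n"
proof (cases n)
  case (Suc m)
  have eq: "compose (carrier (P (Suc m))) (\<lambda>x\<in>carrier (P m). \<zero>\<^bsub>N\<^esub>) (d m) = (\<lambda>x\<in>carrier (P (Suc m)). \<zero>\<^bsub>N\<^esub>)"
    using p(11) by (auto simp: compose_def fun_eq_iff)
  show ?thesis
    unfolding Suc eq[symmetric] by (rule coboundaryI[OF lmod_hom_const_zero[OF p(3) N]])
qed simp

lemma diff_coboundary:
  assumes "f \<in> B n" "g \<in> B n"
  shows "(\<lambda>x\<in>carrier (P n). f x \<ominus>\<^bsub>N\<^esub> g x) \<in> B n"
proof (cases n)
  case 0
  then show ?thesis using assms by (auto intro!: restrict_ext simp: a_minus_def N.M.r_neg)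
next
  case (Suc m)
  obtain f' g' where f: "f' \<in> lmod_hom R (P m) N" "f = compose (carrier (P (Suc m))) f' (d m)"
    and g: "g' \<in> lmod_hom R (P m) N" "g = compose (carrier (P (Suc m))) g' (d m)"
    using assms Suc by auto
  have eq: "(\<lambda>x\<in>carrier (P n). f x \<ominus>\<^bsub>N\<^esub> g x) =
      compose (carrier (P (Suc m))) (\<lambda>x\<in>carrier (P m). f' x \<ominus>\<^bsub>N\<^esub> g' x) (d m)"
    using p(11) by (auto simp: compose_def fun_eq_iff Suc f g)
  show ?thesis
    unfolding eq unfolding Suc by (rule coboundaryI[OF lmod_hom_diff[OF f(1) g(1) p(3) N]])
qed

sublocale B: abelian_subgroup "B n" "Z n" for n
proof (rule abelian_subgroupI3)
  have minus: "a \<ominus>\<^bsub>Z n\<^esub> b \<in> B n" if "a \<in> B n" "b \<in> B n" for a b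
    using diff_coboundary[OF that] that[THEN subsetD[OF coboundary_cocycle]] by (simp add: Z_minus)
  have z: "\<zero>\<^bsub>Z n\<^esub> \<in> B n" unfolding Z_simps by (rule zero_coboundary)
  have inv: "\<ominus>\<^bsub>Z n\<^esub> b \<in> B n" if "b \<in> B n" for b
    using minus[OF z that] subsetD[OF coboundary_cocycle that] by (simp add: a_minus_def)
  show "additive_subgroup (B n) (Z n)"
  proof (rule additive_subgroupI, rule Z.add.subgroupI)
    fix a b assume ab: "a \<in> B n" "b \<in> B n"
    then show "a \<oplus>\<^bsub>Z n\<^esub> b \<in> B n"
      using minus[OF ab(1) inv[OF ab(2)]] subsetD[OF coboundary_cocycle] by (simp add: a_minus_def)
  qed (use coboundary_cocycle z inv in auto)
qed (rule Z.abelian_group_axioms)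

lemma add_coboundary:
  assumes "f \<in> B n" "g \<in> B n"
  shows "(\<lambda>x\<in>carrier (P n). f x \<oplus>\<^bsub>N\<^esub> g x) \<in> B n"
  using B.a_closed[OF assms] by (simp add: Z_simps)

abbreviation "cl n f \<equiv> ext_class R N P d n f"
abbreviation "E n \<equiv> ext_group R N P d n"

lemma carrier_ext_group: "carrier (E n) = cl n ` carrier (Z n)"
  by (auto simp: ext_group_def quotient_def A_RCOSETS_def' ext_class_def)

lemma zero_ext_group: "\<zero>\<^bsub>E n\<^esub> = B n"
  by (simp add: ext_group_def quotient_def)

lemma class_eq_iff:
  assumes "f \<in> carrier (Z n)" "g \<in> carrier (Z n)"
  shows "cl n f = cl n g \<longleftrightarrow> (\<lambda>x\<in>carrier (P n). f x \<ominus>\<^bsub>N\<^esub> g x) \<in> B n"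
  using B.coset_eq_iff[OF assms] by (simp add: ext_class_def Z_minus[OF assms])

lemma class_eq_zero_iff:
  assumes "f \<in> carrier (Z n)"
  shows "cl n f = B n \<longleftrightarrow> f \<in> B n"
  unfolding ext_class_def
  using Z.a_coset_join1[OF _ assms B.a_subgroup] Z.a_coset_join2[OF assms B.a_subgroup] by blast

lemma class_add:
  assumes "f \<in> carrier (Z n)" "g \<in> carrier (Z n)"
  shows "cl n f \<oplus>\<^bsub>E n\<^esub> cl n g = cl n (\<lambda>x\<in>carrier (P n). f x \<oplus>\<^bsub>N\<^esub> g x)"
  using B.a_rcos_sum[OF assms] by (simp add: ext_group_def quotient_def ext_class_def Z_simps)

lemma mem_class:
  assumes "f \<in> carrier (Z n)"
  shows "g \<in> cl n f \<longleftrightarrow> g \<in> carrier (Z n) \<and> (\<lambda>x\<in>carrier (P n). g x \<ominus>\<^bsub>N\<^esub> f x) \<in> B n"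
proof -
  have "cl n f \<subseteq> carrier (Z n)"
    unfolding ext_class_def by (intro Z.a_r_coset_subset_G coboundary_cocycle assms)
  then show ?thesis
    using B.a_rcos_module[OF assms, of g] Z_minus[OF _ assms, of g]
    by (auto simp: ext_class_def a_minus_def)
qed

sublocale E: abelian_group "E n" for n
  unfolding ext_group_def by (rule abelian_group_quotient) (rule B.abelian_subgroup_axioms)

end

section \<open>Transport of classes and Yoneda products along a comparison map\<close>

locale resolution_comparison =
  P: ext_groups R M P d \<epsilon> M + Q: ext_groups R M Q e \<eta> M
  for R :: "('k, 'r) module" and M :: "('r, 'n) module"
    and P :: "nat \<Rightarrow> ('r, 'm) module" and d \<epsilon>
    and Q :: "nat \<Rightarrow> ('r, 'l) module" and e \<eta> +
  fixes F :: "nat \<Rightarrow> 'm \<Rightarrow> 'l"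
  assumes F: "F \<in> chain_lifts_between R P d Q e \<eta> 0 \<epsilon>"
begin

lemma F_hom: "F n \<in> lmod_hom R (P n) (Q n)"
  and F_aug: "x \<in> carrier (P 0) \<Longrightarrow> \<eta> (F 0 x) = \<epsilon> x"
  and F_d: "x \<in> carrier (P (Suc n)) \<Longrightarrow> F n (d n x) = e n (F (Suc n) x)"
  using F by (auto simp: chain_lifts_between_def)

lemma F_closed: "x \<in> carrier (P n) \<Longrightarrow> F n x \<in> carrier (Q n)"
  by (rule lmod_hom_closed[OF F_hom])

abbreviation "pull n f \<equiv> compose (carrier (P n)) f (F n)"

lemma pull_hom: "f \<in> lmod_hom R (Q n) M \<Longrightarrow> pull n f \<in> lmod_hom R (P n) M"
  by (rule lmod_hom_compose[OF _ F_hom P.p(3)])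

lemma pull_cocycle: "f \<in> carrier (Q.Z n) \<Longrightarrow> pull n f \<in> carrier (P.Z n)"
  using P.p(11) F_closed
  by (auto simp: P.cocycle_iff Q.cocycle_iff pull_hom compose_eq F_d)

text \<open>Writing \<open>b = f d\<close>, the chain map property moves the differential to the
  right: \<open>f d \<phi> = f \<phi> d\<close>. In degree 0 the only coboundary is zero.\<close>

lemma coboundary_chain_lift:
  assumes b: "b \<in> P.B p" and \<phi>: "\<phi> \<in> chain_lifts_between R P d P d \<epsilon> q g"
  shows "compose (carrier (P (q + p))) b (\<phi> p) \<in> P.B (q + p)"
proof (cases p)
  case 0
  have "\<phi> 0 x \<in> carrier (P 0)" if "x \<in> carrier (P q)" for x
    using lmod_hom_closed[OF chain_lift_hom[OF \<phi>, of 0]] that by simp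
  then have "compose (carrier (P (q + p))) b (\<phi> p) = (\<lambda>x\<in>carrier (P (q + p)). \<zero>\<^bsub>M\<^esub>)"
    using b 0 by (auto simp: compose_def fun_eq_iff)
  then show ?thesis using P.zero_coboundary by simp
next
  case (Suc m)
  obtain f where f: "f \<in> lmod_hom R (P m) M" "b = compose (carrier (P (Suc m))) f (d m)"
    using b Suc by auto
  have "compose (carrier (P (Suc (q + m)))) b (\<phi> (Suc m)) =
      compose (carrier (P (Suc (q + m)))) (compose (carrier (P (q + m))) f (\<phi> m)) (d (q + m))"
    using lmod_hom_closed[OF chain_lift_hom_Suc[OF \<phi>]] P.p(11)
    by (auto simp: compose_def fun_eq_iff f chain_lift_d[OF \<phi>])
  then show ?thesis
    using P.coboundaryI[OF lmod_hom_compose[OF f(1) chain_lift_hom[OF \<phi>] P.p(3)]] Suc by simp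
qed

text \<open>Products in \<open>P\<close> can thus be computed from one convenient lift in
  \<open>Q\<close>. For arbitrary representatives and lifts, \<open>f' \<phi> - f \<psi> F = f (F
  \<phi> - \<psi> F) + (f' - f F) \<phi>\<close>, and both summands are coboundaries. Hence all
  cosets in the union defining the product agree.\<close>

theorem yoneda_prod_pull:
  assumes f: "f \<in> carrier (Q.Z p)" and g: "g \<in> carrier (Q.Z q)" and \<psi>: "\<psi> \<in> chain_lifts R Q e \<eta> q g"
  shows "yoneda_prod R M P d \<epsilon> p q (P.cl p (pull p f)) (P.cl q (pull q g)) =
    P.cl (p + q) (pull (p + q) (compose (carrier (Q (p + q))) f (\<psi> p)))"
proof -
  have \<psi>': "\<psi> \<in> chain_lifts_between R Q e Q e \<eta> q g" using \<psi> by (simp add: chain_lifts_eq)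
  have qp: "p + q = q + p" by simp
  have \<psi>p: "\<psi> p \<in> lmod_hom R (Q (q + p)) (Q p)" by (rule chain_lift_hom[OF \<psi>'])
  have fh: "f \<in> lmod_hom R (Q p) M" and fz: "\<And>x. x \<in> carrier (Q (Suc p)) \<Longrightarrow> f (e p x) = \<zero>\<^bsub>M\<^esub>"
    using f by (auto simp: Q.cocycle_iff)
  define h where "h = compose (carrier (Q (q + p))) f (\<psi> p)"
  have "f (\<psi> p (e (q + p) x)) = \<zero>\<^bsub>M\<^esub>" if x: "x \<in> carrier (Q (Suc (q + p)))" for x
    using chain_lift_d[OF \<psi>' x] fz[OF lmod_hom_closed[OF chain_lift_hom_Suc[OF \<psi>'] x]] by simp
  then have h: "h \<in> carrier (Q.Z (q + p))"
    using lmod_hom_compose[OF fh \<psi>p Q.p(3)] Q.p(11) by (auto simp: Q.cocycle_iff h_def compose_eq)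
  have key: "P.cl (p + q) (compose (carrier (P (p + q))) f' (\<phi> p)) = P.cl (p + q) (pull (p + q) h)"
    if f': "f' \<in> P.cl p (pull p f)" and g': "g' \<in> P.cl q (pull q g)"
      and \<phi>: "\<phi> \<in> chain_lifts R P d \<epsilon> q g'" for f' g' \<phi>
  proof -
    have \<phi>': "\<phi> \<in> chain_lifts_between R P d P d \<epsilon> q g'" using \<phi> by (simp add: chain_lifts_eq)
    have f'Z: "f' \<in> carrier (P.Z p)" and f'B: "(\<lambda>x\<in>carrier (P p). f' x \<ominus>\<^bsub>M\<^esub> pull p f x) \<in> P.B p"
      using f' by (auto simp: P.mem_class[OF pull_cocycle[OF f]])
    have g'Z: "g' \<in> carrier (P.Z q)" and g'B: "(\<lambda>x\<in>carrier (P q). g' x \<ominus>\<^bsub>M\<^esub> pull q g x) \<in> P.B q"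
      using g' by (auto simp: P.mem_class[OF pull_cocycle[OF g]])
    have \<phi>c: "\<phi> i x \<in> carrier (P i)" if "x \<in> carrier (P (q + i))" for i x
      using lmod_hom_closed[OF chain_lift_hom[OF \<phi>'] that] .
    have \<psi>c: "\<psi> i x \<in> carrier (Q i)" if "x \<in> carrier (Q (q + i))" for i x
      using lmod_hom_closed[OF chain_lift_hom[OF \<psi>'] that] .
    \<comment> \<open>The two ways around the square of chain maps. Their difference augments to
      \<open>g' - g F\<close>, a coboundary because \<open>g'\<close> represents the class of
      \<open>g F\<close>, so \<open>cocycle_chain_map_coboundary\<close> applies.\<close>
    define \<chi> where "\<chi> i = (\<lambda>x\<in>carrier (P (q + i)).
        compose (carrier (P (q + i))) (F i) (\<phi> i) x \<ominus>\<^bsub>Q i\<^esub> compose (carrier (P (q + i))) (\<psi> i) (F (q + i)) x)" for i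
    have "\<chi> \<in> chain_lifts_between R P d Q e \<eta> q (\<lambda>x\<in>carrier (P q). g' x \<ominus>\<^bsub>M\<^esub> pull q g x)"
      unfolding chain_lifts_between_def mem_Collect_eq
    proof (intro conjI allI ballI)
      show "\<chi> i \<in> lmod_hom R (P (q + i)) (Q i)" for i
        unfolding \<chi>_def
        by (intro lmod_hom_diff lmod_hom_compose[OF F_hom] lmod_hom_compose[OF _ F_hom]
            chain_lift_hom[OF \<phi>'] chain_lift_hom[OF \<psi>'] P.p(3) Q.p(3))
      show "\<eta> (\<chi> 0 x) = (\<lambda>x\<in>carrier (P q). g' x \<ominus>\<^bsub>M\<^esub> pull q g x) x" if x: "x \<in> carrier (P q)" for x
      proof -
        have "F 0 (\<phi> 0 x) \<in> carrier (Q 0)" "\<psi> 0 (F q x) \<in> carrier (Q 0)"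
          using \<phi>c[of x 0] \<psi>c[of "F q x" 0] F_closed x by auto
        then show ?thesis
          using x lmod_hom_minus[OF Q.p(5) Q.p(3) Q.p(1)] \<phi>c[of x 0] F_closed
            chain_lift_aug[OF \<phi>' x] chain_lift_aug[OF \<psi>' F_closed[OF x]]
          by (simp add: \<chi>_def compose_eq F_aug)
      qed
      show "e i (\<chi> (Suc i) x) = \<chi> i (d (q + i) x)" if x': "x \<in> carrier (P (q + Suc i))" for i x
      proof -
        have x: "x \<in> carrier (P (Suc (q + i)))" using x' by simp
        have "F (Suc i) (\<phi> (Suc i) x) \<in> carrier (Q (Suc i))" "\<psi> (Suc i) (F (Suc (q + i)) x) \<in> carrier (Q (Suc i))"
          using \<phi>c[of x "Suc i"] \<psi>c[of "F (Suc (q + i)) x" "Suc i"] F_closed[of _ "Suc i"] F_closed[OF x] x by auto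
        then show ?thesis
          using x lmod_hom_minus[OF Q.p(4) Q.p(3) Q.p(3)] \<phi>c[of x "Suc i"] P.p(11)[OF x]
            F_d[of "\<phi> (Suc i) x" i] F_d[OF x] chain_lift_d[OF \<phi>' x] chain_lift_d[OF \<psi>' F_closed[OF x]]
          by (simp add: \<chi>_def compose_eq)
      qed
    qed
    from cocycle_chain_map_coboundary[OF P.P Q.P Q.N this g'B fh fz]
    have 1: "compose (carrier (P (q + p))) f (\<chi> p) \<in> P.B (q + p)" by simp
    have 2: "compose (carrier (P (q + p))) (\<lambda>x\<in>carrier (P p). f' x \<ominus>\<^bsub>M\<^esub> pull p f x) (\<phi> p) \<in> P.B (q + p)"
      by (rule coboundary_chain_lift[OF f'B \<phi>'])
    have eq: "f' (\<phi> p x) \<ominus>\<^bsub>M\<^esub> h (F (q + p) x) = f (\<chi> p x) \<oplus>\<^bsub>M\<^esub> (f' (\<phi> p x) \<ominus>\<^bsub>M\<^esub> f (F p (\<phi> p x)))"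
      if x: "x \<in> carrier (P (q + p))" for x
    proof -
      have c: "\<phi> p x \<in> carrier (P p)" "F p (\<phi> p x) \<in> carrier (Q p)" "F (q + p) x \<in> carrier (Q (q + p))"
        "\<psi> p (F (q + p) x) \<in> carrier (Q p)"
        using \<phi>c[OF x] F_closed F_closed[OF x] \<psi>c by auto
      have c2: "f' (\<phi> p x) \<in> carrier M" "f (F p (\<phi> p x)) \<in> carrier M" "f (\<psi> p (F (q + p) x)) \<in> carrier M"
        using c P.cocycle_closed[OF f'Z] Q.cocycle_closed[OF f] by auto
      have "f (\<chi> p x) = f (F p (\<phi> p x)) \<ominus>\<^bsub>M\<^esub> f (\<psi> p (F (q + p) x))"
        using lmod_hom_minus[OF fh Q.p(3) Q.p(1)] c x by (simp add: \<chi>_def compose_eq)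
      then show ?thesis
        using c c2
        by (simp add: h_def compose_eq a_minus_def P.N.M.a_ac P.N.M.r_neg2 P.N.M.r_neg1)
    qed
    have "(\<lambda>x\<in>carrier (P (q + p)). compose (carrier (P (q + p))) f' (\<phi> p) x \<ominus>\<^bsub>M\<^esub> pull (q + p) h x) \<in> P.B (q + p)"
      using P.add_coboundary[OF 1 2] \<phi>c eq by (simp add: compose_eq cong: restrict_cong)
    moreover have "compose (carrier (P (q + p))) f' (\<phi> p) \<in> carrier (P.Z (q + p))"
    proof -
      have "f' (\<phi> p (d (q + p) x)) = \<zero>\<^bsub>M\<^esub>" if x: "x \<in> carrier (P (Suc (q + p)))" for x
        using f'Z \<phi>c[of x "Suc p"] x chain_lift_d[OF \<phi>' x, symmetric] by (simp add: P.cocycle_iff)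
      then show ?thesis
        using lmod_hom_compose[OF P.cocycle_hom[OF f'Z] chain_lift_hom[OF \<phi>'] P.p(3)] P.p(11)
        by (auto simp: P.cocycle_iff compose_eq)
    qed
    ultimately show ?thesis
      unfolding qp by (subst P.class_eq_iff) (use pull_cocycle[OF h] in auto)
  qed
  \<comment> \<open>Equality of the cosets is not enough: the union must be non-empty. The pulled
    back cocycles and some lift of the second one provide a member.\<close>
  have f0: "pull p f \<in> P.cl p (pull p f)" and g0: "pull q g \<in> P.cl q (pull q g)"
    unfolding ext_class_def by (intro P.B.a_rcos_self pull_cocycle f g)+
  have gc: "pull q g \<in> carrier (P.Z q)" by (rule pull_cocycle[OF g])
  have "pull q g (d q x) = \<zero>\<^bsub>M\<^esub>" if "x \<in> carrier (P (Suc q))" for x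
    using gc that by (simp add: P.cocycle_iff)
  then obtain \<phi> where \<phi>: "\<phi> \<in> chain_lifts R P d \<epsilon> q (pull q g)"
    unfolding chain_lifts_eq by (rule ex_chain_lift[OF P.P P.P P.cocycle_hom[OF gc]])
  have "yoneda_prod R M P d \<epsilon> p q (P.cl p (pull p f)) (P.cl q (pull q g)) = P.cl (p + q) (pull (p + q) h)"
    unfolding yoneda_prod_def ext_class_def[of R M P d "p + q", symmetric]
  proof (rule equalityI)
    show "P.cl (p + q) (pull (p + q) h) \<subseteq> (\<Union>f\<in>P.cl p (pull p f). \<Union>g\<in>P.cl q (pull q g).
        \<Union>\<phi>\<in>chain_lifts R P d \<epsilon> q g. P.cl (p + q) (compose (carrier (P (p + q))) f (\<phi> p)))"
    proof
      fix x assume "x \<in> P.cl (p + q) (pull (p + q) h)"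
      then show "x \<in> (\<Union>f\<in>P.cl p (pull p f). \<Union>g\<in>P.cl q (pull q g).
          \<Union>\<phi>\<in>chain_lifts R P d \<epsilon> q g. P.cl (p + q) (compose (carrier (P (p + q))) f (\<phi> p)))"
        by (intro UN_I[OF f0] UN_I[OF g0] UN_I[OF \<phi>]) (simp add: key[OF f0 g0 \<phi>])
    qed
  qed (intro UN_least, simp add: key)
  then show ?thesis by (simp add: h_def add.commute)
qed

lemma ex_back: obtains G where "G \<in> chain_lifts_between R Q e P d \<epsilon> 0 \<eta>"
  by (rule ex_chain_lift[OF Q.P P.P Q.p(5) Q.p(9)])

text \<open>For a comparison map \<open>G\<close> in the other direction, \<open>id - G F\<close>
  lifts zero, so \<open>h\<close> and \<open>h G F\<close> differ by a coboundary. The cocycle on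
  \<open>Q\<close> is \<open>h G\<close>.\<close>

theorem class_pull_surj:
  assumes h: "h \<in> carrier (P.Z n)"
  shows "\<exists>f\<in>carrier (Q.Z n). P.cl n (pull n f) = P.cl n h"
proof -
  obtain G where G: "G \<in> chain_lifts_between R Q e P d \<epsilon> 0 \<eta>" by (rule ex_back)
  have Gh: "G i \<in> lmod_hom R (Q i) (P i)" for i using chain_lift_hom[OF G, of i] by simp
  have Gc: "x \<in> carrier (Q i) \<Longrightarrow> G i x \<in> carrier (P i)" for i x using lmod_hom_closed[OF Gh] .
  have Gd: "x \<in> carrier (Q (Suc i)) \<Longrightarrow> d i (G (Suc i) x) = G i (e i x)" for i x
    using chain_lift_d[OF G, of x i] by simp
  define \<chi> where "\<chi> i = (\<lambda>x\<in>carrier (P i). (\<lambda>x\<in>carrier (P i). x) x \<ominus>\<^bsub>P i\<^esub> compose (carrier (P i)) (G i) (F i) x)" for i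
  have "\<chi> \<in> chain_lifts_between R P d P d \<epsilon> 0 (\<lambda>x\<in>carrier (P 0). \<zero>\<^bsub>M\<^esub>)"
    unfolding chain_lifts_between_def mem_Collect_eq
  proof (intro conjI allI ballI)
    show "\<chi> i \<in> lmod_hom R (P (0 + i)) (P i)" for i
      unfolding \<chi>_def add_0
      by (intro lmod_hom_diff lmod_hom_compose[OF Gh F_hom] P.p(3) lmod_hom_ident)
    show "\<epsilon> (\<chi> 0 x) = (\<lambda>x\<in>carrier (P 0). \<zero>\<^bsub>M\<^esub>) x" if x: "x \<in> carrier (P 0)" for x
      using lmod_hom_minus[OF P.p(5) P.p(3) P.p(1) x Gc[OF F_closed[OF x]]] x
        chain_lift_aug[OF G F_closed[OF x]] F_aug[OF x] lmod_hom_closed[OF P.p(5) x]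
      by (simp add: \<chi>_def compose_eq P.N.M.r_neg a_minus_def)
    show "d i (\<chi> (Suc i) x) = \<chi> i (d (0 + i) x)" if "x \<in> carrier (P (0 + Suc i))" for i x
    proof -
      have x: "x \<in> carrier (P (Suc i))" using that by simp
      show ?thesis
        using lmod_hom_minus[OF P.p(4) P.p(3) P.p(3) x Gc[OF F_closed[OF x]]] x
          Gd[OF F_closed[OF x]] F_d[OF x] P.p(11)[OF x]
        by (simp add: \<chi>_def compose_eq)
    qed
  qed
  from cocycle_chain_map_coboundary[OF P.P P.P P.N this, of h n]
  have 1: "compose (carrier (P n)) h (\<chi> n) \<in> P.B n"
    using h by (auto simp: P.cocycle_iff)
  define f where "f = compose (carrier (Q n)) h (G n)"
  have f: "f \<in> carrier (Q.Z n)"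
    using lmod_hom_compose[OF P.cocycle_hom[OF h] Gh Q.p(3)] h Q.p(11) Gc Gd[symmetric]
    by (auto simp: Q.cocycle_iff P.cocycle_iff f_def compose_eq)
  have "h (\<chi> n x) = h x \<ominus>\<^bsub>M\<^esub> pull n f x" if x: "x \<in> carrier (P n)" for x
    using lmod_hom_minus[OF P.cocycle_hom[OF h] P.p(3) P.p(1) x Gc[OF F_closed[OF x]]] x F_closed[OF x]
    by (simp add: \<chi>_def f_def compose_eq)
  with 1 have "(\<lambda>x\<in>carrier (P n). h x \<ominus>\<^bsub>M\<^esub> pull n f x) \<in> P.B n"
    by (simp add: compose_def cong: restrict_cong)
  then have "P.cl n h = P.cl n (pull n f)"
    using P.class_eq_iff[OF h pull_cocycle[OF f]] by simp
  with f show ?thesis by metis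
qed

text \<open>Here \<open>id - F G\<close> lifts zero on \<open>Q\<close>. In
  \<open>f = f (id - F G) + (f F) G\<close> the second summand inherits being a coboundary from
  \<open>f F\<close>.\<close>

theorem class_pull_inj:
  assumes f: "f \<in> carrier (Q.Z n)" and B: "pull n f \<in> P.B n"
  shows "f \<in> Q.B n"
proof -
  obtain G where G: "G \<in> chain_lifts_between R Q e P d \<epsilon> 0 \<eta>" by (rule ex_back)
  have Gh: "G i \<in> lmod_hom R (Q i) (P i)" for i using chain_lift_hom[OF G, of i] by simp
  have Gc: "x \<in> carrier (Q i) \<Longrightarrow> G i x \<in> carrier (P i)" for i x using lmod_hom_closed[OF Gh] .
  have Gd: "x \<in> carrier (Q (Suc i)) \<Longrightarrow> d i (G (Suc i) x) = G i (e i x)" for i x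
    using chain_lift_d[OF G, of x i] by simp
  define \<chi> where "\<chi> i = (\<lambda>x\<in>carrier (Q i). (\<lambda>x\<in>carrier (Q i). x) x \<ominus>\<^bsub>Q i\<^esub> compose (carrier (Q i)) (F i) (G i) x)" for i
  have "\<chi> \<in> chain_lifts_between R Q e Q e \<eta> 0 (\<lambda>x\<in>carrier (Q 0). \<zero>\<^bsub>M\<^esub>)"
    unfolding chain_lifts_between_def mem_Collect_eq
  proof (intro conjI allI ballI)
    show "\<chi> i \<in> lmod_hom R (Q (0 + i)) (Q i)" for i
      unfolding \<chi>_def add_0
      by (intro lmod_hom_diff lmod_hom_compose[OF F_hom Gh] Q.p(3) lmod_hom_ident)
    show "\<eta> (\<chi> 0 x) = (\<lambda>x\<in>carrier (Q 0). \<zero>\<^bsub>M\<^esub>) x" if x: "x \<in> carrier (Q 0)" for x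
      using lmod_hom_minus[OF Q.p(5) Q.p(3) Q.p(1) x F_closed[OF Gc[OF x]]] x
        chain_lift_aug[OF G x] F_aug[OF Gc[OF x]] lmod_hom_closed[OF Q.p(5) x]
      by (simp add: \<chi>_def compose_eq P.N.M.r_neg a_minus_def)
    show "e i (\<chi> (Suc i) x) = \<chi> i (e (0 + i) x)" if "x \<in> carrier (Q (0 + Suc i))" for i x
    proof -
      have x: "x \<in> carrier (Q (Suc i))" using that by simp
      show ?thesis
        using lmod_hom_minus[OF Q.p(4) Q.p(3) Q.p(3) x F_closed[OF Gc[OF x]]] x
          Gd[OF x] F_d[OF Gc[OF x]] Q.p(11)[OF x]
        by (simp add: \<chi>_def compose_eq)
    qed
  qed
  from cocycle_chain_map_coboundary[OF Q.P Q.P Q.N this, of f n]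
  have 1: "compose (carrier (Q n)) f (\<chi> n) \<in> Q.B n"
    using f by (auto simp: Q.cocycle_iff)
  have 2: "compose (carrier (Q n)) (pull n f) (G n) \<in> Q.B n"
  proof (cases n)
    case 0
    then show ?thesis using B Gc by (auto simp: compose_def fun_eq_iff)
  next
    case (Suc m)
    obtain b where b: "b \<in> lmod_hom R (P m) M" "pull n f = compose (carrier (P (Suc m))) b (d m)"
      using B Suc by auto
    have "compose (carrier (Q n)) (pull n f) (G n) =
        compose (carrier (Q (Suc m))) (compose (carrier (Q m)) b (G m)) (e m)"
      using Gc[of _ "Suc m"] Q.p(11) unfolding b by (auto simp: compose_def fun_eq_iff Suc Gd)
    then show ?thesis
      using Q.coboundaryI[OF lmod_hom_compose[OF b(1) Gh Q.p(3)]] Suc by simp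
  qed
  have "f (\<chi> n x) \<oplus>\<^bsub>M\<^esub> pull n f (G n x) = f x" if x: "x \<in> carrier (Q n)" for x
    using lmod_hom_minus[OF Q.cocycle_hom[OF f] Q.p(3) Q.p(1) x F_closed[OF Gc[OF x]]] x Gc[OF x]
      Q.cocycle_closed[OF f x] Q.cocycle_closed[OF f F_closed[OF Gc[OF x]]]
    by (simp add: \<chi>_def compose_eq a_minus_def P.N.M.a_assoc P.N.M.l_neg)
  then have "(\<lambda>x\<in>carrier (Q n). compose (carrier (Q n)) f (\<chi> n) x \<oplus>\<^bsub>M\<^esub> compose (carrier (Q n)) (pull n f) (G n) x) = f"
    using lmod_hom_restrict[OF Q.cocycle_hom[OF f]]
    by (simp add: compose_eq cong: restrict_cong)
  with Q.add_coboundary[OF 1 2] show ?thesis by simp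
qed

end

section \<open>Presented algebras\<close>

lemma free_algebra_simps [simp]:
  "carrier free_algebra = UNIV" "p \<otimes>\<^bsub>free_algebra\<^esub> q = p * q" "\<one>\<^bsub>free_algebra\<^esub> = 1"
  "\<zero>\<^bsub>free_algebra\<^esub> = 0" "p \<oplus>\<^bsub>free_algebra\<^esub> q = p + q"
  "c \<odot>\<^bsub>free_algebra\<^esub> p = Poly_Mapping.single 0 c * p"
  by (simp_all add: free_algebra_def mult_map_scale_conv_mult)

lemma ring_free_algebra: "ring (free_algebra :: ('k::comm_ring_1, ('x, 'k) nc_poly) module)"
proof (rule ringI)
  show "abelian_group (free_algebra :: ('k, ('x, 'k) nc_poly) module)"
    by (rule abelian_groupI) (auto simp: add_ac intro: exI[of _ "- _"])
  show "monoid (free_algebra :: ('k, ('x, 'k) nc_poly) module)"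
    by (rule monoidI) (auto simp: mult.assoc)
qed (auto simp: algebra_simps)

interpretation free: ring free_algebra
  by (rule ring_free_algebra)

lemma free_algebra_minus [simp]:
  fixes p q :: "('x, 'k::comm_ring_1) nc_poly"
  shows "\<ominus>\<^bsub>free_algebra\<^esub> p = - p" "p \<ominus>\<^bsub>free_algebra\<^esub> q = p - q"
proof -
  show *: "\<ominus>\<^bsub>free_algebra\<^esub> p = - p" for p :: "('x, 'k::comm_ring_1) nc_poly"
    by (rule free.minus_equality) auto
  show "p \<ominus>\<^bsub>free_algebra\<^esub> q = p - q"
    by (simp add: a_minus_def *)
qed

lemma monomial_Nil: "monomial [] = 1"
  by (simp add: monomial_def flip: zero_free_word_def)

lemma monomial_append: "monomial (u @ v) = monomial u * monomial v"
  by (simp add: monomial_def mult_single plus_free_word_def)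

lemma monomial_Cons: "monomial (x # w) = monomial [x] * monomial w"
  using monomial_append[of "[x]" w] by simp

lemma single_eq_monomial: "Poly_Mapping.single k c = Poly_Mapping.single 0 c * monomial (letters k)"
  by (cases k) (simp add: monomial_def mult_single zero_free_word_def plus_free_word_def)

lemma single_zero_mult:
  "Poly_Mapping.single 0 (a * b) = Poly_Mapping.single 0 a * (Poly_Mapping.single 0 b :: ('x, 'k::comm_ring_1) nc_poly)"
  by (simp add: mult_single)

lemma nc_poly_induct [case_names scaled_monomial add]:
  fixes p :: "('x, 'k::comm_ring_1) nc_poly"
  assumes "\<And>c w. Q (Poly_Mapping.single 0 c * monomial w)" "\<And>p q. Q p \<Longrightarrow> Q q \<Longrightarrow> Q (p + q)"
  shows "Q p"
proof -
  have eq: "p = (\<Sum>k\<in>Poly_Mapping.keys p. Poly_Mapping.single k (Poly_Mapping.lookup p k))"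
    by (rule poly_mapping_eqI) (auto simp: lookup_sum lookup_single when_def in_keys_iff)
  have Q0: "Q 0" using assms(1)[of 0 "[]"] by simp
  have "Q (\<Sum>k\<in>A. Poly_Mapping.single k (f k))" if "finite A" for A :: "'x free_word set" and f
    using that
  proof (induction A rule: finite_induct)
    case (insert k A)
    then show ?case using assms(1)[of "f k" "letters k"] by (simp add: assms(2) flip: single_eq_monomial)
  qed (simp add: Q0)
  then show ?thesis by (subst eq) simp
qed

lemma single_zero_commute:
  fixes p :: "('x, 'k::comm_ring_1) nc_poly"
  shows "p * Poly_Mapping.single 0 c = Poly_Mapping.single 0 c * p"
  by (induction p rule: nc_poly_induct)
    (simp_all add: distrib_left distrib_right monomial_def mult_single mult.commute)

text \<open>Extension from words to polynomials. The scalar is an argument of \<open>f\<close>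
  because the targets (scalars, elements of the model, polynomials) have no common scalar
  multiplication.\<close>

definition lin_ext :: "('x list \<Rightarrow> 'k \<Rightarrow> 'a) \<Rightarrow> ('x, 'k::comm_ring_1) nc_poly \<Rightarrow> 'a::ab_group_add"
  where "lin_ext f p = (\<Sum>k\<in>Poly_Mapping.keys p. f (letters k) (Poly_Mapping.lookup p k))"

lemma lin_ext_add:
  assumes "\<And>w a b. f w (a + b) = f w a + f w b"
  shows "lin_ext f (p + q) = lin_ext f p + lin_ext f q"
proof -
  have "f w 0 = 0" for w using assms[of w 0 0] by simp
  then show ?thesis
    unfolding lin_ext_def using assms by (intro setsum_keys_plus_distrib) auto
qed

lemma lin_ext_monomial:
  assumes "\<And>w. f w 0 = 0"
  shows "lin_ext f (Poly_Mapping.single 0 c * monomial w) = f w c"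
proof -
  have "Poly_Mapping.single 0 c * monomial w = Poly_Mapping.single (Free_Word w) c"
    by (simp add: single_eq_monomial[of "Free_Word w"])
  then show ?thesis using assms by (simp add: lin_ext_def)
qed

context
  fixes rels :: "('x, 'k::comm_ring_1) nc_poly set"
begin

abbreviation "rel_ideal \<equiv> Idl\<^bsub>free_algebra\<^esub> rels"
abbreviation "rel_coset p \<equiv> rel_ideal +>\<^bsub>free_algebra\<^esub> p"

lemma ideal_rels: "ideal rel_ideal free_algebra"
  by (rule free.genideal_ideal) simp

lemma ideal_rels_closed:
  "0 \<in> rel_ideal" "p \<in> rel_ideal \<Longrightarrow> q \<in> rel_ideal \<Longrightarrow> p + q \<in> rel_ideal" "p \<in> rel_ideal \<Longrightarrow> q \<in> rel_ideal \<Longrightarrow> p - q \<in> rel_ideal"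
  "p \<in> rel_ideal \<Longrightarrow> q * p \<in> rel_ideal" "p \<in> rel_ideal \<Longrightarrow> p * q \<in> rel_ideal" "p \<in> rel_ideal \<Longrightarrow> - p \<in> rel_ideal"
proof -
  interpret ideal rel_ideal free_algebra by (rule ideal_rels)
  show "0 \<in> rel_ideal" using zero_closed by simp
  show *: "p \<in> rel_ideal \<Longrightarrow> q \<in> rel_ideal \<Longrightarrow> p + q \<in> rel_ideal" for p q using a_closed[of p q] by simp
  show **: "p \<in> rel_ideal \<Longrightarrow> - p \<in> rel_ideal" for p using a_inv_closed[of p] by simp
  show "p \<in> rel_ideal \<Longrightarrow> q \<in> rel_ideal \<Longrightarrow> p - q \<in> rel_ideal" using *[of p "- q"] **[of q] by simp
  show "p \<in> rel_ideal \<Longrightarrow> q * p \<in> rel_ideal" using I_l_closed[of p q] by simp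
  show "p \<in> rel_ideal \<Longrightarrow> p * q \<in> rel_ideal" using I_r_closed[of p q] by simp
qed

lemma rels_subset_ideal: "rels \<subseteq> rel_ideal"
  by (rule free.genideal_self) simp

lemma presented_coset_eq_iff: "rel_coset p = rel_coset q \<longleftrightarrow> p - q \<in> rel_ideal"
proof -
  interpret ideal rel_ideal free_algebra by (rule ideal_rels)
  interpret abelian_subgroup rel_ideal free_algebra
    by (rule abelian_subgroupI3) (rule is_additive_subgroup, rule free.abelian_group_axioms)
  show ?thesis using coset_eq_iff[of p q] by simp
qed

lemma mem_coset_iff: "q \<in> rel_coset p \<longleftrightarrow> q - p \<in> rel_ideal"
  by (auto simp: a_r_coset_def' intro!: bexI[of _ "q - p"])

lemma presented_algebra_simps:
  "carrier (presented_algebra rels) = range rel_coset"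
  "rel_coset p \<otimes>\<^bsub>presented_algebra rels\<^esub> rel_coset q = rel_coset (p * q)"
  "rel_coset p \<oplus>\<^bsub>presented_algebra rels\<^esub> rel_coset q = rel_coset (p + q)"
  "\<one>\<^bsub>presented_algebra rels\<^esub> = rel_coset 1"
  "\<zero>\<^bsub>presented_algebra rels\<^esub> = rel_coset 0"
  "c \<odot>\<^bsub>presented_algebra rels\<^esub> rel_coset p = rel_coset (Poly_Mapping.single 0 c * p)"
proof -
  interpret ideal rel_ideal free_algebra by (rule ideal_rels)
  interpret abelian_subgroup rel_ideal free_algebra
    by (rule abelian_subgroupI3) (rule is_additive_subgroup, rule free.abelian_group_axioms)
  show "carrier (presented_algebra rels) = range rel_coset"
    by (auto simp: presented_algebra_def quotient_def A_RCOSETS_def')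
  show "rel_coset p \<otimes>\<^bsub>presented_algebra rels\<^esub> rel_coset q = rel_coset (p * q)"
    using rcoset_mult_add[of p q] by (simp add: presented_algebra_def quotient_def)
  show "rel_coset p \<oplus>\<^bsub>presented_algebra rels\<^esub> rel_coset q = rel_coset (p + q)"
    using a_rcos_sum[of p q] by (simp add: presented_algebra_def quotient_def)
  show "\<one>\<^bsub>presented_algebra rels\<^esub> = rel_coset 1"
    by (simp add: presented_algebra_def quotient_def)
  show "\<zero>\<^bsub>presented_algebra rels\<^esub> = rel_coset 0"
    using free.a_coset_add_zero[of rel_ideal] by (simp add: presented_algebra_def quotient_def)
  have "(\<Union>q\<in>rel_coset p. rel_coset (Poly_Mapping.single 0 c * q)) = rel_coset (Poly_Mapping.single 0 c * p)"
  proof (intro UN_constant_eq ballI)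
    show "p \<in> rel_coset p" by (simp add: mem_coset_iff ideal_rels_closed(1))
    fix q assume "q \<in> rel_coset p"
    then show "rel_coset (Poly_Mapping.single 0 c * q) = rel_coset (Poly_Mapping.single 0 c * p)"
      using ideal_rels_closed(4)[of "q - p" "Poly_Mapping.single 0 c"]
      by (simp add: mem_coset_iff presented_coset_eq_iff right_diff_distrib)
  qed
  then show "c \<odot>\<^bsub>presented_algebra rels\<^esub> rel_coset p = rel_coset (Poly_Mapping.single 0 c * p)"
    by (simp only: presented_algebra_def quotient_def module.simps free_algebra_simps)
qed

definition coset_map :: "(('x, 'k) nc_poly \<Rightarrow> 'a) \<Rightarrow> ('x, 'k) nc_poly set \<Rightarrow> 'a"
  where "coset_map H S = H (SOME p. p \<in> S)"

lemma coset_map_coset: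
  assumes "\<And>p q. p - q \<in> rel_ideal \<Longrightarrow> H p = H q"
  shows "coset_map H (rel_coset p) = H p"
proof -
  have "(SOME q. q \<in> rel_coset p) \<in> rel_coset p"
    by (rule someI[of _ p]) (simp add: mem_coset_iff ideal_rels_closed)
  then show ?thesis by (auto simp: coset_map_def mem_coset_iff intro: assms)
qed

text \<open>The first isomorphism theorem for the free algebra: with it, a presentation is
  established by a surjective homomorphism and a description of its kernel, without cosets.\<close>

lemma is_presented_byI:
  fixes H :: "('x, 'k) nc_poly \<Rightarrow> 'a"
  assumes carrier: "range H = carrier A"
    and add: "\<And>p q. H (p + q) = H p \<oplus>\<^bsub>A\<^esub> H q"
    and mult: "\<And>p q. H (p * q) = H p \<otimes>\<^bsub>A\<^esub> H q"
    and one: "H 1 = \<one>\<^bsub>A\<^esub>"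
    and smult: "\<And>c p. H (Poly_Mapping.single 0 c * p) = c \<odot>\<^bsub>A\<^esub> H p"
    and ker: "\<And>p q. H p = H q \<longleftrightarrow> p - q \<in> rel_ideal"
    and gen: "\<And>x. H (monomial [x]) = g x"
  shows "is_presented_by A g rels"
proof -
  have cm: "coset_map H (rel_coset p) = H p" for p by (rule coset_map_coset) (simp add: ker)
  have "coset_map H \<in> algebra_iso (presented_algebra rels) A"
    unfolding algebra_iso_def ring_iso_def ring_hom_def
  proof (safe, goal_cases)
    case 5 then show ?case
      using carrier by (auto simp: bij_betw_def inj_on_def presented_algebra_simps(1) cm ker presented_coset_eq_iff image_image)
  next
    case (6 c x)
    then show ?case
      by (auto simp only: presented_algebra_simps(1) presented_algebra_simps(6) cm smult)
  qed (use carrier in \<open>auto simp: presented_algebra_simps cm add mult one\<close>)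
  then show ?thesis
    unfolding is_presented_by_def
    by (rule bexI[rotated]) (simp add: presented_gen_def cm gen)
qed

end

lemma ring_presented_algebra: "ring (presented_algebra rels)"
proof -
  let ?A = "presented_algebra rels"
  have c: "x \<in> carrier ?A \<Longrightarrow> \<exists>p. x = Idl\<^bsub>free_algebra\<^esub> rels +>\<^bsub>free_algebra\<^esub> p" for x
    by (auto simp: presented_algebra_simps)
  show ?thesis
  proof (rule ringI)
    show "abelian_group ?A"
    proof (rule abelian_groupI)
      fix x assume "x \<in> carrier ?A"
      then obtain p where "x = Idl\<^bsub>free_algebra\<^esub> rels +>\<^bsub>free_algebra\<^esub> p" using c by blast
      then have "(Idl\<^bsub>free_algebra\<^esub> rels +>\<^bsub>free_algebra\<^esub> (- p)) \<oplus>\<^bsub>?A\<^esub> x = \<zero>\<^bsub>?A\<^esub>"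
        by (simp add: presented_algebra_simps)
      then show "\<exists>y\<in>carrier ?A. y \<oplus>\<^bsub>?A\<^esub> x = \<zero>\<^bsub>?A\<^esub>"
        by (rule bexI) (simp add: presented_algebra_simps)
    qed (auto dest!: c simp: presented_algebra_simps(2-) add_ac presented_algebra_simps(1))
    show "monoid ?A"
      by (rule monoidI) (auto dest!: c simp: presented_algebra_simps(2-) mult.assoc presented_algebra_simps(1))
  qed (auto dest!: c simp: presented_algebra_simps algebra_simps)
qed

section \<open>Evaluation homomorphisms on the free algebra\<close>

locale nc_evaluation =
  fixes con :: "'k::comm_ring_1 \<Rightarrow> 'a::ring_1" and gen :: "'x \<Rightarrow> 'a"
  assumes con_add: "con (a + b) = con a + con b" and con_mult: "con (a * b) = con a * con b"
    and con_one: "con 1 = 1" and con_central: "y * con a = con a * y"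
begin

definition eval_nc :: "('x, 'k) nc_poly \<Rightarrow> 'a"
  where "eval_nc = lin_ext (\<lambda>w c. con c * prod_list (map gen w))"

lemma con_zero: "con 0 = 0" using con_add[of 0 0] by simp

lemma eval_add: "eval_nc (p + q) = eval_nc p + eval_nc q"
  unfolding eval_nc_def by (rule lin_ext_add) (simp add: con_add distrib_right)

lemma eval_scaled_monomial: "eval_nc (Poly_Mapping.single 0 c * monomial w) = con c * prod_list (map gen w)"
  unfolding eval_nc_def by (rule lin_ext_monomial) (simp add: con_zero)

lemma eval_monomial: "eval_nc (monomial w) = prod_list (map gen w)"
  using eval_scaled_monomial[of 1 w] by (simp add: con_one)

lemma eval_zero: "eval_nc 0 = 0" by (simp add: eval_nc_def lin_ext_def)

lemma eval_uminus: "eval_nc (- p) = - eval_nc p"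
  using eval_add[of p "- p"] by (simp add: eval_zero eq_neg_iff_add_eq_0 add.commute)

lemma eval_diff: "eval_nc (p - q) = eval_nc p - eval_nc q"
  using eval_add[of p "- q"] by (simp add: eval_uminus)

lemma eval_mult: "eval_nc (p * q) = eval_nc p * eval_nc q"
proof (induction p rule: nc_poly_induct)
  case (scaled_monomial c w)
  show ?case
  proof (induction q rule: nc_poly_induct)
    case (scaled_monomial c' w')
    have "Poly_Mapping.single 0 c * monomial w * (Poly_Mapping.single 0 c' * monomial w') =
        Poly_Mapping.single 0 (c * c') * monomial (w @ w')"
      unfolding single_zero_mult monomial_append mult.assoc
      by (metis mult.assoc single_zero_commute)
    then show ?case
      by (simp add: eval_scaled_monomial con_mult mult.assoc) (metis con_central mult.assoc)
  qed (simp add: distrib_left eval_add)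
qed (simp add: distrib_right eval_add)

lemma eval_one: "eval_nc 1 = 1"
  using eval_monomial[of "[]"] by (simp add: monomial_Nil)

lemma eval_const: "eval_nc (Poly_Mapping.single 0 c) = con c"
  using eval_scaled_monomial[of c "[]"] by (simp add: monomial_Nil)

text \<open>The kernel of evaluation is an ideal, and the ideal of relations is the smallest one
  that contains them.\<close>

lemma eval_Idl:
  assumes "\<And>r. r \<in> rels \<Longrightarrow> eval_nc r = 0" "p \<in> Idl\<^bsub>free_algebra\<^esub> rels"
  shows "eval_nc p = 0"
proof -
  have "ideal {p. eval_nc p = 0} free_algebra"
  proof (rule idealI[OF ring_free_algebra])
    show "subgroup {p. eval_nc p = 0} (add_monoid free_algebra)"
      by (rule free.add.subgroupI) (auto simp: eval_zero eval_add eval_uminus intro: exI[of _ 0])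
  qed (auto simp: eval_mult)
  then show ?thesis
    using free.genideal_minimal[of "{p. eval_nc p = 0}" rels] assms by auto
qed

end

section \<open>An eight-dimensional model of the algebra\<close>

text \<open>
  The fields are the coordinates with respect to \<open>1, x, y, xy, yx, xyx, yxy, xyxy\<close>;
  note that \<open>yxyx = - xyxy\<close>.
\<close>

datatype 'k r8 = R8 (c1: 'k) (cx: 'k) (cy: 'k) (cxy: 'k) (cyx: 'k) (cxyx: 'k) (cyxy: 'k) (cxyxy: 'k)

lemma r8_eq_iff: "r = s \<longleftrightarrow> c1 r = c1 s \<and> cx r = cx s \<and> cy r = cy s \<and> cxy r = cxy s \<and>
    cyx r = cyx s \<and> cxyx r = cxyx s \<and> cyxy r = cyxy s \<and> cxyxy r = cxyxy s"
  by (cases r; cases s) simp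

instantiation r8 :: (comm_ring_1) ring_1
begin

definition "0 = R8 0 0 0 0 0 0 0 0"
definition "1 = R8 1 0 0 0 0 0 0 0"
definition "r + s = R8 (c1 r + c1 s) (cx r + cx s) (cy r + cy s) (cxy r + cxy s) (cyx r + cyx s)
  (cxyx r + cxyx s) (cyxy r + cyxy s) (cxyxy r + cxyxy s)"
definition "r - s = R8 (c1 r - c1 s) (cx r - cx s) (cy r - cy s) (cxy r - cxy s) (cyx r - cyx s)
  (cxyx r - cxyx s) (cyxy r - cyxy s) (cxyxy r - cxyxy s)"
definition "- r = R8 (- c1 r) (- cx r) (- cy r) (- cxy r) (- cyx r) (- cxyx r) (- cyxy r) (- cxyxy r)"
text \<open>The negative terms are the three cuts of yxyx into two non-empty words: y with xyx, yx
  with yx, yxy with x. Products of total length above four vanish.\<close>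

definition "r * s = R8 (c1 r * c1 s) (c1 r * cx s + cx r * c1 s) (c1 r * cy s + cy r * c1 s)
  (c1 r * cxy s + cx r * cy s + cxy r * c1 s) (c1 r * cyx s + cy r * cx s + cyx r * c1 s)
  (c1 r * cxyx s + cx r * cyx s + cxy r * cx s + cxyx r * c1 s)
  (c1 r * cyxy s + cy r * cxy s + cyx r * cy s + cyxy r * c1 s)
  (c1 r * cxyxy s + cx r * cyxy s + cxy r * cxy s + cxyx r * cy s + cxyxy r * c1 s
    - cy r * cxyx s - cyx r * cyx s - cyxy r * cx s)"

instance
proof
  fix a b c :: "'a r8"
  show "a * b * c = a * (b * c)"
    by (simp add: times_r8_def algebra_simps)
  show "(a + b) * c = a * c + b * c" "a * (b + c) = a * b + a * c"
    by (simp_all add: times_r8_def plus_r8_def algebra_simps)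
qed (simp_all add: zero_r8_def one_r8_def plus_r8_def minus_r8_def uminus_r8_def times_r8_def r8_eq_iff add_ac)

end

lemmas r8_defs = zero_r8_def one_r8_def plus_r8_def minus_r8_def uminus_r8_def times_r8_def

definition r8_const :: "'k::comm_ring_1 \<Rightarrow> 'k r8" where "r8_const c = R8 c 0 0 0 0 0 0 0"
definition r8_x :: "'k::comm_ring_1 r8" where "r8_x = R8 0 1 0 0 0 0 0 0"
definition r8_y :: "'k::comm_ring_1 r8" where "r8_y = R8 0 0 1 0 0 0 0 0"

definition r8_gen :: "R_gen \<Rightarrow> 'k::comm_ring_1 r8"
  where "r8_gen g = (case g of X1 \<Rightarrow> r8_x | X2 \<Rightarrow> r8_y)"

lemmas r8_elem_defs = r8_const_def r8_x_def r8_y_def r8_gen_def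

interpretation r8: nc_evaluation "r8_const :: 'k::comm_ring_1 \<Rightarrow> 'k r8" r8_gen
  by standard (simp_all add: r8_elem_defs r8_defs mult.commute)

lemma eval_R_rels: "r \<in> R_rels \<Longrightarrow> r8.eval_nc r = 0"
  by (auto simp: R_rels_def r8.eval_monomial r8.eval_add) (simp_all add: r8_elem_defs r8_defs)

definition r8_lift :: "'k::comm_ring_1 r8 \<Rightarrow> (R_gen, 'k) nc_poly"
  where "r8_lift r = (let s = Poly_Mapping.single 0; x = monomial [X1]; y = monomial [X2] in
    s (c1 r) + s (cx r) * x + s (cy r) * y + s (cxy r) * (x * y) + s (cyx r) * (y * x) +
    s (cxyx r) * (x * y * x) + s (cyxy r) * (y * x * y) + s (cxyxy r) * (x * y * x * y))"

lemma r8_lift_add: "r8_lift (r + s) = r8_lift r + r8_lift s"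
  by (simp add: r8_lift_def Let_def plus_r8_def single_add distrib_right)

lemma r8_lift_const_mult: "r8_lift (r8_const c * r) = Poly_Mapping.single 0 c * r8_lift r"
  by (simp add: r8_lift_def Let_def r8_const_def times_r8_def single_zero_mult distrib_left mult.assoc)

lemma R_rels_ideal:
  fixes x y :: "(R_gen, 'k::comm_ring_1) nc_poly"
  defines "x \<equiv> monomial [X1]" and "y \<equiv> monomial [X2]"
  shows "x * x \<in> Idl\<^bsub>free_algebra\<^esub> R_rels" "y * y \<in> Idl\<^bsub>free_algebra\<^esub> R_rels"
    "x * y * x * y + y * x * y * x \<in> Idl\<^bsub>free_algebra\<^esub> R_rels"
proof -
  have "monomial [X1, X1] = x * x" "monomial [X2, X2] = y * y"
    "monomial [X1, X2, X1, X2] = x * y * x * y" "monomial [X2, X1, X2, X1] = y * x * y * x"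
    by (simp_all add: x_def y_def mult.assoc flip: monomial_append)
  then show "x * x \<in> Idl\<^bsub>free_algebra\<^esub> R_rels" "y * y \<in> Idl\<^bsub>free_algebra\<^esub> R_rels"
    "x * y * x * y + y * x * y * x \<in> Idl\<^bsub>free_algebra\<^esub> R_rels"
    using rels_subset_ideal[of "R_rels :: (R_gen, 'k) nc_poly set"] by (auto simp: R_rels_def)
qed

text \<open>Explicit certificates of membership in the ideal. On the left, x produces either a basis
  word or a word containing xx; y also meets xyx, where the quartic relation is needed.\<close>

lemma r8_lift_gen_mult:
  "monomial [g] * r8_lift r - r8_lift (r8_gen g * r) \<in> Idl\<^bsub>free_algebra\<^esub> (R_rels :: (R_gen, 'k::comm_ring_1) nc_poly set)"
proof -
  define x y :: "(R_gen, 'k) nc_poly" where "x = monomial [X1]" and "y = monomial [X2]"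
  define s :: "'k \<Rightarrow> (R_gen, 'k) nc_poly" where "s = Poly_Mapping.single 0"
  note rel = R_rels_ideal[where 'k = 'k, folded x_def y_def]
  note cl = ideal_rels_closed[where rels = "R_rels :: (R_gen, 'k) nc_poly set"]
  have comm: "p * (s c * q) = s c * (p * q)" "p * s c = s c * p" for p q c
    using single_zero_commute[of p c] by (simp_all add: s_def flip: mult.assoc)
  have s0: "s 0 = 0" "s (- c) = - s c" for c by (simp_all add: s_def single_uminus)
  have lift: "r8_lift r = s (c1 r) + s (cx r) * x + s (cy r) * y + s (cxy r) * (x * y) + s (cyx r) * (y * x) +
    s (cxyx r) * (x * y * x) + s (cyxy r) * (y * x * y) + s (cxyxy r) * (x * y * x * y)" for r
    by (simp add: r8_lift_def Let_def x_def y_def s_def)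
  show ?thesis
  proof (cases g)
    case X1
    have "x * r8_lift r - r8_lift (r8_x * r) =
        x * x * (s (cx r) + s (cxy r) * y + s (cxyx r) * (y * x) + s (cxyxy r) * (y * x * y))"
      unfolding lift by (simp add: r8_x_def times_r8_def s0 comm algebra_simps)
    also have "\<dots> \<in> Idl\<^bsub>free_algebra\<^esub> R_rels" by (rule cl(5)[OF rel(1)])
    finally show ?thesis by (simp add: X1 r8_gen_def x_def)
  next
    case X2
    \<comment> \<open>The last summand disposes of the word yxyxy of length five, written as (xyxy +
      yxyx) y - xyx yy.\<close>
    have "y * r8_lift r - r8_lift (r8_y * r) =
        y * y * (s (cy r) + s (cyx r) * x + s (cyxy r) * (x * y)) +
        s (cxyx r) * (x * y * x * y + y * x * y * x) +
        s (cxyxy r) * ((x * y * x * y + y * x * y * x) * y - x * y * x * (y * y))"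
      unfolding lift by (simp add: r8_y_def times_r8_def s0 comm algebra_simps)
    also have "\<dots> \<in> Idl\<^bsub>free_algebra\<^esub> R_rels"
      by (intro cl(2) cl(3) cl(4)[OF rel(3)] cl(4)[OF cl(3)] cl(5)[OF rel(2)] cl(5)[OF rel(3)] cl(4)[OF rel(2)])
    finally show ?thesis by (simp add: X2 r8_gen_def y_def)
  qed
qed

text \<open>The eight words span the quotient: modulo the ideal their span contains 1 and is stable
  under left multiplication by the generators, so every word is reached letter by letter.\<close>

lemma r8_lift_eval:
  "p - r8_lift (r8.eval_nc p) \<in> Idl\<^bsub>free_algebra\<^esub> (R_rels :: (R_gen, 'k::comm_ring_1) nc_poly set)"
proof (induction p rule: nc_poly_induct)
  case (scaled_monomial c w)
  note cl = ideal_rels_closed[where rels = "R_rels :: (R_gen, 'k) nc_poly set"]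
  have w: "monomial w - r8_lift (prod_list (map r8_gen w)) \<in> Idl\<^bsub>free_algebra\<^esub> (R_rels :: (R_gen, 'k) nc_poly set)"
  proof (induction w)
    case Nil
    have "r8_lift 1 = (1 :: (R_gen, 'k) nc_poly)" by (simp add: r8_lift_def Let_def one_r8_def)
    then show ?case by (simp add: monomial_Nil cl(1))
  next
    case (Cons g w)
    let ?v = "prod_list (map r8_gen w) :: 'k r8"
    have "monomial (g # w) - r8_lift (r8_gen g * ?v) =
        monomial [g] * (monomial w - r8_lift ?v) + (monomial [g] * r8_lift ?v - r8_lift (r8_gen g * ?v))"
      by (simp add: monomial_Cons[of g w] right_diff_distrib)
    then show ?case
      using cl(2)[OF cl(4)[OF Cons.IH, of "monomial [g]"] r8_lift_gen_mult[of g ?v]]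
      by (simp only: list.map(2) prod_list.Cons)
  qed
  show ?case
    using cl(4)[OF w, of "Poly_Mapping.single 0 c"]
    by (simp add: r8.eval_scaled_monomial r8_lift_const_mult right_diff_distrib)
next
  case (add p q)
  then show ?case
    using ideal_rels_closed(2)[OF add] by (simp add: r8.eval_add r8_lift_add algebra_simps)
qed

text \<open>Evaluation has exactly the ideal of relations as its kernel, so membership in the ideal
  amounts to eight scalar equations.\<close>

lemma eval_eq_iff: "r8.eval_nc p = r8.eval_nc q \<longleftrightarrow> p - q \<in> Idl\<^bsub>free_algebra\<^esub> R_rels"
proof
  assume "r8.eval_nc p = r8.eval_nc q"
  then show "p - q \<in> Idl\<^bsub>free_algebra\<^esub> R_rels"
    using ideal_rels_closed(3)[OF r8_lift_eval[of p] r8_lift_eval[of q]] by simp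
next
  assume "p - q \<in> Idl\<^bsub>free_algebra\<^esub> R_rels"
  then show "r8.eval_nc p = r8.eval_nc q"
    using r8.eval_Idl[OF eval_R_rels, where p = "p - q"] by (simp add: r8.eval_diff)
qed

lemma eval_r8_lift: "r8.eval_nc (r8_lift r) = r"
  by (simp add: r8_lift_def Let_def r8.eval_add r8.eval_mult r8.eval_const r8.eval_monomial)
    (simp add: r8_elem_defs r8_defs r8_eq_iff)

definition r8_of :: "(R_gen, 'k::comm_ring_1) nc_poly set \<Rightarrow> 'k r8"
  where "r8_of = coset_map r8.eval_nc"

abbreviation "R_coset p \<equiv> Idl\<^bsub>free_algebra\<^esub> R_rels +>\<^bsub>free_algebra\<^esub> p"

lemma r8_of_coset: "r8_of (R_coset p) = r8.eval_nc p"
  unfolding r8_of_def by (rule coset_map_coset) (simp add: eval_eq_iff)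

lemma R_algebra_cases:
  assumes "r \<in> carrier R_algebra" obtains p where "r = R_coset p"
  using assms by (auto simp: R_algebra_def presented_algebra_simps)

lemma r8_of_hom:
  "\<lbrakk>r \<in> carrier R_algebra; s \<in> carrier R_algebra\<rbrakk> \<Longrightarrow> r8_of (r \<oplus>\<^bsub>R_algebra\<^esub> s) = r8_of r + r8_of s"
  "\<lbrakk>r \<in> carrier R_algebra; s \<in> carrier R_algebra\<rbrakk> \<Longrightarrow> r8_of (r \<otimes>\<^bsub>R_algebra\<^esub> s) = r8_of r * r8_of s"
  "r8_of \<one>\<^bsub>R_algebra\<^esub> = 1" "r8_of \<zero>\<^bsub>R_algebra\<^esub> = 0"
  "r \<in> carrier R_algebra \<Longrightarrow> r8_of (c \<odot>\<^bsub>R_algebra\<^esub> r) = r8_const c * r8_of r"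
  by (auto elim!: R_algebra_cases simp: R_algebra_def presented_algebra_simps r8_of_coset
      r8.eval_add r8.eval_mult r8.eval_one r8.eval_zero r8.eval_const)

lemma r8_of_inj: "\<lbrakk>r \<in> carrier R_algebra; s \<in> carrier R_algebra; r8_of r = r8_of s\<rbrakk> \<Longrightarrow> r = s"
  by (elim R_algebra_cases) (simp add: r8_of_coset eval_eq_iff presented_coset_eq_iff)

definition of_r8 :: "'k::comm_ring_1 r8 \<Rightarrow> (R_gen, 'k) nc_poly set"
  where "of_r8 r = R_coset (r8_lift r)"

lemma of_r8_closed [simp]: "of_r8 r \<in> carrier R_algebra"
  by (simp add: of_r8_def R_algebra_def presented_algebra_simps)

lemma r8_of_of_r8 [simp]: "r8_of (of_r8 r) = r"
  by (simp add: of_r8_def r8_of_coset eval_r8_lift)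

lemma c1_simps [simp]: "c1 (r + s) = c1 r + c1 s" "c1 (r * s) = c1 r * c1 s" "c1 0 = 0" "c1 1 = 1"
  "c1 (r - s) = c1 r - c1 s" "c1 (- r) = - c1 r" "c1 (r8_const c) = c" "c1 r8_x = 0" "c1 r8_y = 0"
  by (simp_all add: r8_defs r8_elem_defs)

lemma c1_sum [simp]: "c1 (sum f A) = (\<Sum>a\<in>A. c1 (f a))"
  by (induction A rule: infinite_finite_induct) simp_all

lemma c1_eval:
  fixes p :: "(R_gen, 'k::comm_ring_1) nc_poly"
  shows "c1 (r8.eval_nc p) = Poly_Mapping.lookup p 0"
proof (induction p rule: nc_poly_induct)
  case (scaled_monomial c w)
  have "Poly_Mapping.lookup (Poly_Mapping.single 0 c * monomial w) 0 = (if w = [] then c else 0)"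
    by (simp add: lookup_single zero_free_word_def flip: single_eq_monomial[of "Free_Word w", simplified])
  moreover have "c1 (r8_gen g :: 'k r8) = 0" for g by (cases g) (simp_all add: r8_gen_def)
  ultimately show ?case
    by (cases w) (auto simp: r8.eval_scaled_monomial)
qed (simp add: r8.eval_add lookup_add)

lemma trivial_module_simps [simp]:
  "carrier trivial_module = UNIV" "x \<oplus>\<^bsub>trivial_module\<^esub> y = x + y" "\<zero>\<^bsub>trivial_module\<^esub> = 0"
  by (simp_all add: trivial_module_def)

text \<open>All representatives of a coset share their constant coefficient, since by
  \<open>c1_eval\<close> it is the first coordinate of their common evaluation. The image in the
  definition of the action is therefore a singleton.\<close>

lemma trivial_module_smult:
  assumes "r \<in> carrier R_algebra" shows "r \<odot>\<^bsub>trivial_module\<^esub> c = c1 (r8_of r) * c"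
proof -
  obtain p where r: "r = R_coset p" using assms by (rule R_algebra_cases)
  have "Poly_Mapping.lookup q 0 = c1 (r8_of r)" if "q \<in> R_coset p" for q
    using that by (simp add: r mem_coset_iff r8_of_coset flip: eval_eq_iff c1_eval)
  moreover have "p \<in> R_coset p" by (simp add: mem_coset_iff ideal_rels_closed)
  ultimately have "(\<lambda>q. Poly_Mapping.lookup q 0) ` r = {c1 (r8_of r)}"
    unfolding r by (auto simp: image_iff)
  then show ?thesis by (simp add: trivial_module_def)
qed

section \<open>Kernels and syzygies of right multiplication by x and y\<close>

lemma r8_kernel_augmentation:
  assumes "c1 r = 0" shows "\<exists>p q. r = p * r8_x + q * r8_y"
  using assms
  \<comment> \<open>The witnesses strip the last letter: \<open>p\<close> collects the words ending
    in x and \<open>q\<close> those ending in y. The word xyxy is treated as - yxyx, so its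
    coefficient enters \<open>p\<close> with a minus sign.\<close>
  by (intro exI[of _ "R8 (cx r) 0 (cyx r) (cxyx r) 0 0 (- cxyxy r) 0"] exI[of _ "R8 (cy r) (cxy r) 0 0 (cyxy r) 0 0 0"])
    (simp add: r8_elem_defs r8_defs r8_eq_iff)

text \<open>Besides multiples of x and of y there is the syzygy (yxy, xyx) given by yxyx + xyxy = 0.
  The hypothesis forces the coefficient of yxy in \<open>r\<close> to equal that of xyx in
  \<open>s\<close>; this scalar is the witness for \<open>c\<close>.\<close>

lemma r8_syzygy:
  assumes "r * r8_x + s * r8_y = 0"
  shows "\<exists>p q c. r = p * r8_x + c * (r8_y * r8_x * r8_y) \<and> s = q * r8_y + c * (r8_x * r8_y * r8_x)"
  using assms
  by (intro exI[of _ "R8 (cx r) 0 (cyx r) (cxyx r) 0 0 (- cxyxy r) 0"]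
        exI[of _ "R8 (cy s) (cxy s) 0 0 (cyxy s) (cxyxy s) 0 0"] exI[of _ "R8 (cyxy r) 0 0 0 0 0 0 0"])
    (simp add: r8_elem_defs r8_defs r8_eq_iff)

lemma r8_annihilator:
  "r * r8_x = 0 \<Longrightarrow> \<exists>p. r = p * r8_x"
  "r * r8_y = 0 \<Longrightarrow> \<exists>p. r = p * r8_y"
  by (rule exI[of _ "R8 (cx r) 0 (cyx r) (cxyx r) 0 0 (- cxyxy r) 0"], simp add: r8_elem_defs r8_defs r8_eq_iff)
    (rule exI[of _ "R8 (cy r) (cxy r) 0 0 (cyxy r) (cxyxy r) 0 0"], simp add: r8_elem_defs r8_defs r8_eq_iff)

text \<open>Compare the coefficients of yxy: \<open>r * r8_x\<close> has none, and the other summand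
  contributes the constant term of \<open>s\<close>.\<close>

lemma r8_augmentation_zero:
  assumes "r * r8_x + s * (r8_y * r8_x * r8_y) = 0"
  shows "c1 s = 0"
  using assms by (simp add: r8_elem_defs r8_defs r8_eq_iff)

lemma ring_R_algebra: "ring R_algebra"
  by (simp add: R_algebra_def ring_presented_algebra)

section \<open>A resolution of the trivial module\<close>

text \<open>\<open>v a b\<close> is the coefficient of \<open>u\<^sub>a\<^sub>b\<close>. Functions
  on all pairs that vanish off one antidiagonal let all degrees share a type, as
  \<open>free_resolution\<close> demands. Coefficients lie in the model, while the cosets of
  \<open>R_algebra\<close> act through \<open>r8_of\<close>.\<close>

definition res_module :: "nat \<Rightarrow> ((R_gen, 'k::comm_ring_1) nc_poly set, nat \<Rightarrow> nat \<Rightarrow> 'k r8) module"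
  where "res_module n =
    \<lparr>carrier = {v. \<forall>a b. a + b \<noteq> n \<longrightarrow> v a b = 0}, monoid.mult = undefined, one = undefined,
     ring.zero = (\<lambda>a b. 0), add = (\<lambda>v w a b. v a b + w a b),
     module.smult = (\<lambda>r v a b. r8_of r * v a b)\<rparr>"

lemma res_module_simps:
  "v \<in> carrier (res_module n) \<longleftrightarrow> (\<forall>a b. a + b \<noteq> n \<longrightarrow> v a b = 0)"
  "\<zero>\<^bsub>res_module n\<^esub> = (\<lambda>a b. 0)" "v \<oplus>\<^bsub>res_module n\<^esub> w = (\<lambda>a b. v a b + w a b)"
  "r \<odot>\<^bsub>res_module n\<^esub> v = (\<lambda>a b. r8_of r * v a b)"
  by (simp_all add: res_module_def)

lemma left_module_res_module: "left_module R_algebra (res_module n)"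
proof (intro left_module.intro left_module_axioms.intro)
  show "abelian_group (res_module n :: ((R_gen, 'k::comm_ring_1) nc_poly set, _) module)"
  proof (rule abelian_groupI)
    fix v :: "nat \<Rightarrow> nat \<Rightarrow> 'k r8" assume "v \<in> carrier (res_module n)"
    then show "\<exists>w\<in>carrier (res_module n). w \<oplus>\<^bsub>res_module n\<^esub> v = \<zero>\<^bsub>res_module n :: ((R_gen, 'k) nc_poly set, _) module\<^esub>"
      by (intro bexI[of _ "\<lambda>a b. - v a b"]) (simp_all add: res_module_simps)
  qed (auto simp: res_module_simps add_ac)
qed (simp_all add: ring_R_algebra ring_R_algebra[THEN ring.is_abelian_group] res_module_simps r8_of_hom algebra_simps)

lemma left_module_trivial: "left_module R_algebra (trivial_module :: ((R_gen, 'k::comm_ring_1) nc_poly set, 'k) module)"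
proof (intro left_module.intro left_module_axioms.intro)
  show "abelian_group (trivial_module :: ((R_gen, 'k::comm_ring_1) nc_poly set, 'k) module)"
    by (rule abelian_groupI) (auto simp: add_ac intro: exI[of _ "- _"])
  interpret ring R_algebra by (rule ring_R_algebra)
qed (simp_all add: ring_R_algebra trivial_module_smult ring.ring_simprules[OF ring_R_algebra] r8_of_hom algebra_simps)

lemma finsum_res_module:
  assumes "finite A" "f \<in> A \<rightarrow> carrier (res_module n)"
  shows "finsum (res_module n) f A = (\<lambda>a b. \<Sum>s\<in>A. f s a b)"
proof -
  interpret left_module R_algebra "res_module n" by (rule left_module_res_module)
  show ?thesis
    using assms by (induction A rule: finite_induct) (simp_all add: M.finsum_insert res_module_simps(2,3) Pi_def)
qed

definition res_unit :: "nat \<Rightarrow> nat \<Rightarrow> nat \<Rightarrow> nat \<Rightarrow> 'k::comm_ring_1 r8"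
  where "res_unit n i = (\<lambda>a b. if a = i \<and> a + b = n then 1 else 0)"

lemma res_unit_closed: "res_unit n i \<in> carrier (res_module n)"
  by (simp add: res_module_simps res_unit_def)

lemma res_unit_inj: "inj_on (res_unit n :: nat \<Rightarrow> nat \<Rightarrow> nat \<Rightarrow> 'k::comm_ring_1 r8) {..n}"
proof (rule inj_onI)
  fix i j assume ij: "i \<in> {..n}" "j \<in> {..n}" and eq: "(res_unit n i :: nat \<Rightarrow> nat \<Rightarrow> 'k r8) = res_unit n j"
  have "(res_unit n i :: nat \<Rightarrow> nat \<Rightarrow> 'k r8) i (n - i) = res_unit n j i (n - i)"
    by (simp only: eq)
  then show "i = j" using ij by (simp add: res_unit_def split: if_splits)
qed

lemma free_res_module: "free_left_module R_algebra (res_module n :: ((R_gen, 'k::comm_ring_1) nc_poly set, _) module)"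
proof -
  let ?R = "R_algebra :: ('k, (R_gen, 'k) nc_poly set) module"
  let ?Q = "res_module n :: ((R_gen, 'k) nc_poly set, _) module"
  interpret left_module ?R ?Q by (rule left_module_res_module)
  define S where "S = (res_unit n ` {..n} :: (nat \<Rightarrow> nat \<Rightarrow> 'k r8) set)"
  have SQ: "S \<subseteq> carrier ?Q" by (auto simp: S_def res_unit_closed)
  have comb: "finsum ?Q (\<lambda>s. c s \<odot>\<^bsub>?Q\<^esub> s) {s \<in> S. c s \<noteq> \<zero>\<^bsub>?R\<^esub>} =
      (\<lambda>a b. if a + b = n then r8_of (c (res_unit n a)) else 0)"
    if c: "c \<in> S \<rightarrow> carrier ?R" for c
  proof -
    have "finsum ?Q (\<lambda>s. c s \<odot>\<^bsub>?Q\<^esub> s) {s \<in> S. c s \<noteq> \<zero>\<^bsub>?R\<^esub>} = finsum ?Q (\<lambda>s. c s \<odot>\<^bsub>?Q\<^esub> s) S"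
      using c SQ by (intro comb_superset) (auto simp: S_def)
    also have "\<dots> = (\<lambda>a b. \<Sum>s\<in>S. r8_of (c s) * s a b)"
      using c SQ by (subst finsum_res_module) (auto simp: S_def smult_closed Pi_def res_module_simps)
    also have "\<dots> = (\<lambda>a b. \<Sum>i\<le>n. r8_of (c (res_unit n i)) * res_unit n i a b)"
      unfolding S_def by (simp add: sum.reindex[OF res_unit_inj])
    also have "\<dots> = (\<lambda>a b. if a + b = n then r8_of (c (res_unit n a)) else 0)"
      by (auto simp: fun_eq_iff res_unit_def if_distrib[of "\<lambda>x. _ * x"] cong: if_cong)
    finally show ?thesis .
  qed
  have "\<exists>!c. c \<in> S \<rightarrow>\<^sub>E carrier ?R \<and> finite {s \<in> S. c s \<noteq> \<zero>\<^bsub>?R\<^esub>} \<and>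
      v = finsum ?Q (\<lambda>s. c s \<odot>\<^bsub>?Q\<^esub> s) {s \<in> S. c s \<noteq> \<zero>\<^bsub>?R\<^esub>}" if v: "v \<in> carrier ?Q" for v
  proof (rule ex1I)
    define i where "i s = inv_into {..n} (res_unit n) s" for s :: "nat \<Rightarrow> nat \<Rightarrow> 'k r8"
    have i: "i (res_unit n a) = a" if "a \<le> n" for a
      unfolding i_def using that by (intro inv_into_f_f res_unit_inj) simp
    \<comment> \<open>Coordinates have to be cosets, so the coefficients in the model are sent back
      by \<open>of_r8\<close>; their uniqueness will rest on the injectivity of
      \<open>r8_of\<close>.\<close>
    let ?c = "\<lambda>s\<in>S. of_r8 (v (i s) (n - i s))"
    have c: "?c \<in> S \<rightarrow>\<^sub>E carrier ?R" by auto
    have "v = (\<lambda>a b. if a + b = n then r8_of (?c (res_unit n a)) else 0)"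
    proof (intro ext)
      fix a b
      have "res_unit n a \<in> S" if "a + b = n" using that by (auto simp: S_def)
      then show "v a b = (if a + b = n then r8_of (?c (res_unit n a)) else 0)"
        using v i[of a] by (auto simp: res_module_simps)
    qed
    then show "?c \<in> S \<rightarrow>\<^sub>E carrier ?R \<and> finite {s \<in> S. ?c s \<noteq> \<zero>\<^bsub>?R\<^esub>} \<and>
        v = finsum ?Q (\<lambda>s. ?c s \<odot>\<^bsub>?Q\<^esub> s) {s \<in> S. ?c s \<noteq> \<zero>\<^bsub>?R\<^esub>}"
      using c comb[of ?c] by (auto simp: S_def)
    fix c assume asm: "c \<in> S \<rightarrow>\<^sub>E carrier ?R \<and> finite {s \<in> S. c s \<noteq> \<zero>\<^bsub>?R\<^esub>} \<and>
        v = finsum ?Q (\<lambda>s. c s \<odot>\<^bsub>?Q\<^esub> s) {s \<in> S. c s \<noteq> \<zero>\<^bsub>?R\<^esub>}"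
    then have veq: "v = (\<lambda>a b. if a + b = n then r8_of (c (res_unit n a)) else 0)"
      using comb[of c] by auto
    show "c = ?c"
    proof (rule PiE_ext)
      show "c \<in> S \<rightarrow>\<^sub>E carrier ?R" using asm by blast
      show "?c \<in> S \<rightarrow>\<^sub>E carrier ?R" by (rule c)
      fix s assume s: "s \<in> S"
      then obtain a where a: "s = res_unit n a" "a \<le> n" by (auto simp: S_def)
      have "r8_of (c s) = r8_of (?c s)"
        using s a i[of a] by (simp add: veq)
      then show "c s = ?c s"
        using s asm by (intro r8_of_inj) auto
    qed
  qed
  then have "is_basis ?R ?Q S" using SQ by (simp add: is_basis_def)
  then show ?thesis
    using left_module_res_module by (auto simp: free_left_module_def)
qed

text \<open>
  \<open>coef_x a b\<close> and \<open>coef_y a b\<close> are the coefficients of \<open>u\<^sub>a\<^sub>b\<close> in the images of \<open>u\<^sub>a\<^sub>+\<^sub>1\<^sub>,\<^sub>b\<close> and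
  \<open>u\<^sub>a\<^sub>,\<^sub>b\<^sub>+\<^sub>1\<close>; the indices refer to the target.
\<close>

definition coef_x :: "nat \<Rightarrow> nat \<Rightarrow> 'k::comm_ring_1 r8"
  where "coef_x a b = (if b \<le> a then r8_x else r8_x * r8_y * r8_x)"

definition coef_y :: "nat \<Rightarrow> nat \<Rightarrow> 'k::comm_ring_1 r8"
  where "coef_y a b = (if a \<le> b then r8_y else r8_y * r8_x * r8_y)"

definition res_diff :: "(nat \<Rightarrow> nat \<Rightarrow> 'k::comm_ring_1 r8) \<Rightarrow> nat \<Rightarrow> nat \<Rightarrow> 'k r8"
  where "res_diff v = (\<lambda>a b. v (Suc a) b * coef_x a b + v a (Suc b) * coef_y a b)"

text \<open>Words of the form x, xyx begin and end in x, so their products contain xx; likewise for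
  y. In each mixed product one factor has length one and the other three, so the sum is always yxyx
  + xyxy. The plus sign of the relation is why the differential has no alternating signs.\<close>

lemma coef_products:
  "coef_x (Suc a) b * coef_x a b = 0" "coef_y a (Suc b) * coef_y a b = 0"
  "coef_y (Suc a) b * coef_x a b + coef_x a (Suc b) * coef_y a b = 0"
  by (auto simp: coef_x_def coef_y_def r8_elem_defs r8_defs)

lemma c1_coef [simp]: "c1 (coef_x a b) = 0" "c1 (coef_y a b) = 0"
  by (simp_all add: coef_x_def coef_y_def)

lemma coef_Suc [simp]: "coef_x (Suc a) (Suc b) = coef_x a b" "coef_y (Suc a) (Suc b) = coef_y a b"
  by (simp_all add: coef_x_def coef_y_def)

lemma res_diff_diff: "res_diff (res_diff v) = (\<lambda>a b. 0)"
proof (intro ext)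
  fix a b
  have "res_diff (res_diff v) a b = v (Suc (Suc a)) b * (coef_x (Suc a) b * coef_x a b) +
      v (Suc a) (Suc b) * (coef_y (Suc a) b * coef_x a b + coef_x a (Suc b) * coef_y a b) +
      v a (Suc (Suc b)) * (coef_y a (Suc b) * coef_y a b)"
    by (simp only: res_diff_def distrib_left distrib_right mult.assoc add.assoc)
  then show "res_diff (res_diff v) a b = 0" by (simp only: coef_products mult_zero_right add_0_right)
qed

lemma res_diff_add: "res_diff (\<lambda>a b. v a b + w a b) = (\<lambda>a b. res_diff v a b + res_diff w a b)"
  by (simp add: res_diff_def fun_eq_iff algebra_simps)

lemma res_diff_minus: "res_diff (\<lambda>a b. v a b - w a b) = (\<lambda>a b. res_diff v a b - res_diff w a b)"
  by (simp add: res_diff_def fun_eq_iff algebra_simps)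

lemma res_diff_smult: "res_diff (\<lambda>a b. r * v a b) = (\<lambda>a b. r * res_diff v a b)"
  by (simp add: res_diff_def fun_eq_iff algebra_simps)

section \<open>Exactness of the explicit complex\<close>

abbreviation supported :: "nat \<Rightarrow> (nat \<Rightarrow> nat \<Rightarrow> 'k::comm_ring_1 r8) \<Rightarrow> bool"
  where "supported n v \<equiv> \<forall>a b. a + b \<noteq> n \<longrightarrow> v a b = 0"

lemma supported_res_diff: "supported (Suc n) v \<Longrightarrow> supported n (res_diff v)"
  by (simp add: res_diff_def)

lemma res_exact_0:
  assumes v: "supported 0 v" "c1 (v 0 0) = 0"
  shows "\<exists>w. supported (Suc 0) w \<and> res_diff w = v"
proof -
  obtain p q where pq: "v 0 0 = p * r8_x + q * r8_y" using r8_kernel_augmentation[OF v(2)] by blast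
  let ?w = "\<lambda>a b. if a = 1 \<and> b = 0 then p else if a = 0 \<and> b = 1 then q else 0"
  have "res_diff ?w = v"
  proof (intro ext)
    fix a b show "res_diff ?w a b = v a b"
      using pq v(1) by (cases "a = 0 \<and> b = 0") (auto simp: res_diff_def coef_x_def coef_y_def)
  qed
  then show ?thesis by (intro exI[of _ ?w]) auto
qed

text \<open>The three kinds of solutions in \<open>r8_syzygy\<close> are multiples of the images of
  \<open>u\<^sub>2\<^sub>0\<close>, \<open>u\<^sub>0\<^sub>2\<close> and
  \<open>u\<^sub>1\<^sub>1\<close>, so \<open>p\<close>, \<open>q\<close> and \<open>c\<close> are
  the coefficients of a preimage.\<close>

lemma res_exact_1:
  assumes v: "supported 1 v" "res_diff v = (\<lambda>a b. 0)"
  shows "\<exists>w. supported 2 w \<and> res_diff w = v"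
proof -
  have "v 1 0 * r8_x + v 0 1 * r8_y = 0"
    using fun_cong[OF fun_cong[OF v(2)], of 0 0] by (simp add: res_diff_def coef_x_def coef_y_def)
  then obtain p q c where pq: "v 1 0 = p * r8_x + c * (r8_y * r8_x * r8_y)" "v 0 1 = q * r8_y + c * (r8_x * r8_y * r8_x)"
    using r8_syzygy by blast
  let ?w = "\<lambda>a b. if a = 2 \<and> b = 0 then p else if a = 0 \<and> b = 2 then q else if a = 1 \<and> b = 1 then c else 0"
  have "res_diff ?w = v"
  proof (intro ext)
    fix a b :: nat
    consider "a = 1 \<and> b = 0" | "a = 0 \<and> b = 1" | "a + b \<noteq> 1"
      by (cases "a = 0"; cases "b = 0"; cases "a + b = 1") auto
    then show "res_diff ?w a b = v a b"
      by cases (use pq v(1) in \<open>auto simp: res_diff_def coef_x_def coef_y_def add.commute\<close>)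
  qed
  then show ?thesis by (intro exI[of _ ?w]) auto
qed

text \<open>Away from the axes a = 0 and b = 0, a cycle is a shifted cycle two degrees lower, whose
  preimage can be shifted back. What remains sits at the two ends of the antidiagonal and is
  annihilated there by x or by y alone.\<close>

lemma res_exact:
  "supported (Suc n) v \<Longrightarrow> res_diff v = (\<lambda>a b. 0) \<Longrightarrow> \<exists>w. supported (Suc (Suc n)) w \<and> res_diff w = v"
proof (induction n arbitrary: v rule: less_induct)
  case (less n)
  note v = less.prems
  show ?case
  proof (cases n)
    case 0
    then show ?thesis using res_exact_1[of v] v by (simp add: numeral_2_eq_2)
  next
    case (Suc m)
    define v' where "v' = (\<lambda>a b. v (Suc a) (Suc b))"
    have v': "supported m v'" using v(1) by (simp add: v'_def Suc)
    have "res_diff v' a b = res_diff v (Suc a) (Suc b)" for a b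
      by (simp add: res_diff_def v'_def)
    then have v'd: "res_diff v' = (\<lambda>a b. 0)" using v(2) by (simp add: fun_eq_iff)
    have "\<exists>w. supported (Suc m) w \<and> res_diff w = v'"
    proof (cases m)
      case 0
      \<comment> \<open>In degree 0 exactness asks for zero augmentation instead of zero
        differential. The component of the cycle equation at (1, 0) supplies it.\<close>
      have "v 2 0 * r8_x + v 1 1 * (r8_y * r8_x * r8_y) = 0"
        using fun_cong[OF fun_cong[OF v(2)], of 1 0]
        by (simp add: res_diff_def coef_x_def coef_y_def numeral_2_eq_2)
      then have "c1 (v 1 1) = 0" by (rule r8_augmentation_zero)
      then show ?thesis using res_exact_0[of v'] v' 0 by (simp add: v'_def)
    next
      case (Suc l)
      then show ?thesis using less.IH[of l v'] v' v'd \<open>n = Suc m\<close> by simp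
    qed
    then obtain w' where w': "supported (Suc m) w'" "res_diff w' = v'" by blast
    \<comment> \<open>Extended by zero to the axes. Off the axes its image under the differential is
      \<open>v\<close>, but on them it may differ from \<open>v\<close>; the correction
      \<open>w1\<close> repairs this.\<close>
    define w0 where "w0 a b = (if a = 0 \<or> b = 0 then 0 else w' (a - 1) (b - 1))" for a b
    have w0: "supported (Suc (Suc n)) w0" using w'(1) by (auto simp: w0_def Suc)
    have w0d: "res_diff w0 (Suc a) (Suc b) = v (Suc a) (Suc b)" for a b
      using fun_cong[OF fun_cong[OF w'(2)], of a b] by (simp add: res_diff_def w0_def v'_def)
    define u where "u = (\<lambda>a b. v a b - res_diff w0 a b)"
    have u: "supported (Suc n) u" using v(1) supported_res_diff[OF w0] by (simp add: u_def)
    have ud: "res_diff u a b = 0" for a b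
      using v(2) res_diff_minus[of v "res_diff w0"] res_diff_diff[of w0] by (simp add: u_def)
    have u0: "u (Suc a) (Suc b) = 0" for a b by (simp add: u_def w0d)
    \<comment> \<open>The neighbouring coefficient \<open>u n 1\<close> lies off the axes and is
      zero, so one term is left of the cycle equation at (n, 0).\<close>
    have "u (Suc n) 0 * r8_x = 0"
      using ud[of n 0] u0[of m 0] by (simp add: res_diff_def coef_x_def Suc)
    then obtain p where p: "u (Suc n) 0 = p * r8_x" using r8_annihilator(1) by blast
    have "u 0 (Suc n) * r8_y = 0"
      using ud[of 0 n] u0[of 0 m] by (simp add: res_diff_def coef_y_def Suc)
    then obtain q where q: "u 0 (Suc n) = q * r8_y" using r8_annihilator(2) by blast
    define w1 where "w1 = (\<lambda>a b. if a = Suc (Suc n) \<and> b = 0 then p else if a = 0 \<and> b = Suc (Suc n) then q else 0)"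
    have "res_diff w1 a b = u a b" for a b
    proof -
      consider "a = Suc n \<and> b = 0" | "a = 0 \<and> b = Suc n" | "a + b \<noteq> Suc n" | "a \<noteq> 0 \<and> b \<noteq> 0"
        by (cases "a = 0"; cases "b = 0"; cases "a + b = Suc n") auto
      then show ?thesis
      proof cases
        case 4
        then show ?thesis using u0[of "a - 1" "b - 1"] by (simp add: w1_def res_diff_def)
      qed (use p q u in \<open>auto simp: w1_def res_diff_def coef_x_def coef_y_def\<close>)
    qed
    then have "res_diff (\<lambda>a b. w0 a b + w1 a b) = v"
      by (simp add: res_diff_add u_def)
    moreover have "supported (Suc (Suc n)) (\<lambda>a b. w0 a b + w1 a b)"
      using w0 by (simp add: w1_def)
    ultimately show ?thesis
      by (intro exI[of _ "\<lambda>a b. w0 a b + w1 a b"] conjI)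
  qed
qed

text \<open>Restricted because the members of \<open>lmod_hom\<close> are \<open>undefined\<close>
  outside the carrier of their source.\<close>

definition res_d :: "nat \<Rightarrow> (nat \<Rightarrow> nat \<Rightarrow> 'k::comm_ring_1 r8) \<Rightarrow> nat \<Rightarrow> nat \<Rightarrow> 'k r8"
  where "res_d n = restrict res_diff {v. supported (Suc n) v}"

definition res_aug :: "(nat \<Rightarrow> nat \<Rightarrow> 'k::comm_ring_1 r8) \<Rightarrow> 'k"
  where "res_aug = (\<lambda>v\<in>{v. supported 0 v}. c1 (v 0 0))"

lemma carrier_res_module: "carrier (res_module n) = {v. supported n v}"
  by (simp add: res_module_def)

theorem free_resolution_res:
  "free_resolution R_algebra (trivial_module :: ((R_gen, 'k::comm_ring_1) nc_poly set, 'k) module) res_module res_d res_aug"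
  unfolding free_resolution_def
proof (intro conjI allI)
  show "res_d n \<in> lmod_hom R_algebra (res_module (Suc n)) (res_module n)" for n
    unfolding res_d_def carrier_res_module[symmetric]
    by (intro lmod_homI left_module_res_module)
      (simp_all add: res_module_simps supported_res_diff res_diff_add res_diff_smult)
  show "res_aug \<in> lmod_hom R_algebra (res_module 0) trivial_module"
    unfolding res_aug_def carrier_res_module[symmetric]
    by (intro lmod_homI left_module_res_module)
      (simp_all add: res_module_simps trivial_module_smult)
  have "c \<in> res_aug ` carrier (res_module 0)" for c :: 'k
    by (rule image_eqI[of _ _ "\<lambda>a b. if a = 0 \<and> b = 0 then r8_const c else 0"])
      (simp_all add: res_aug_def carrier_res_module)
  then show "res_aug ` carrier (res_module 0) = carrier (trivial_module :: ((R_gen, 'k) nc_poly set, 'k) module)" by auto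
  show "res_d 0 ` carrier (res_module 1) =
      {v \<in> carrier (res_module 0). res_aug v = \<zero>\<^bsub>trivial_module :: ((R_gen, 'k) nc_poly set, 'k) module\<^esub>}"
  proof (intro equalityI subsetI)
    fix v :: "nat \<Rightarrow> nat \<Rightarrow> 'k r8"
    assume "v \<in> res_d 0 ` carrier (res_module 1)"
    then obtain w where "supported (Suc 0) w" "v = res_diff w" by (auto simp: res_d_def carrier_res_module)
    then show "v \<in> {v \<in> carrier (res_module 0). res_aug v = \<zero>\<^bsub>trivial_module :: ((R_gen, 'k) nc_poly set, 'k) module\<^esub>}"
      using supported_res_diff[of 0 w] by (simp add: carrier_res_module res_aug_def) (simp add: res_diff_def)
  next
    fix v :: "nat \<Rightarrow> nat \<Rightarrow> 'k r8"
    assume "v \<in> {v \<in> carrier (res_module 0). res_aug v = \<zero>\<^bsub>trivial_module :: ((R_gen, 'k) nc_poly set, 'k) module\<^esub>}"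
    then have "supported 0 v" "c1 (v 0 0) = 0" by (auto simp: carrier_res_module res_aug_def)
    then obtain w where "supported (Suc 0) w" "res_diff w = v" using res_exact_0 by blast
    then show "v \<in> res_d 0 ` carrier (res_module 1)"
      by (intro image_eqI[of _ _ w]) (simp_all add: carrier_res_module res_d_def)
  qed
  show "res_d (Suc n) ` carrier (res_module (Suc (Suc n))) =
      {v \<in> carrier (res_module (Suc n)). res_d n v = \<zero>\<^bsub>res_module n :: ((R_gen, 'k) nc_poly set, _) module\<^esub>}" for n
  proof (intro equalityI subsetI)
    fix v :: "nat \<Rightarrow> nat \<Rightarrow> 'k r8"
    assume "v \<in> res_d (Suc n) ` carrier (res_module (Suc (Suc n)))"
    then obtain w where "supported (Suc (Suc n)) w" "v = res_diff w" by (auto simp: res_d_def carrier_res_module)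
    then show "v \<in> {v \<in> carrier (res_module (Suc n)). res_d n v = \<zero>\<^bsub>res_module n :: ((R_gen, 'k) nc_poly set, _) module\<^esub>}"
      using supported_res_diff[of "Suc n" w] by (simp add: carrier_res_module res_d_def res_diff_diff res_module_simps)
  next
    fix v :: "nat \<Rightarrow> nat \<Rightarrow> 'k r8"
    assume "v \<in> {v \<in> carrier (res_module (Suc n)). res_d n v = \<zero>\<^bsub>res_module n :: ((R_gen, 'k) nc_poly set, _) module\<^esub>}"
    then have "supported (Suc n) v" "res_diff v = (\<lambda>a b. 0)" by (auto simp: carrier_res_module res_d_def res_module_simps)
    then obtain w where "supported (Suc (Suc n)) w" "res_diff w = v" using res_exact by blast
    then show "v \<in> res_d (Suc n) ` carrier (res_module (Suc (Suc n)))"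
      by (intro image_eqI[of _ _ w]) (simp_all add: carrier_res_module res_d_def)
  qed
qed (rule left_module_trivial free_res_module)+

text \<open>
  The chain lift of the functional dual to \<open>u\<^sub>i\<^sub>j\<close> sends \<open>u\<^sub>a\<^sub>+\<^sub>i\<^sub>,\<^sub>b\<^sub>+\<^sub>j\<close> to \<open>shift_coef i j a b\<close> times \<open>u\<^sub>a\<^sub>b\<close>.
  The correction terms \<open>yx\<close> and \<open>xy\<close> next to the diagonal are forced by the change of the
  differential there.
\<close>

definition shift_coef :: "nat \<Rightarrow> nat \<Rightarrow> nat \<Rightarrow> nat \<Rightarrow> 'k::comm_ring_1 r8"
  where "shift_coef i j a b =
    (if i = j then 1
     else if j < i then (if b \<le> a then 1 else if b = Suc a then r8_y * r8_x else 0)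
     else (if a \<le> b then 1 else if a = Suc b then r8_x * r8_y else 0))"

text \<open>For j < i the coefficient yx makes up for the missing length: xyx = x yx in the first
  identity at b = a + 1, and yx y = yxy in the second at b = a. One line further from the diagonal,
  every product with yx contains xx or yy. The case i < j is symmetric.\<close>

lemma shift_coef_chain:
  "shift_coef i j (Suc a) b * coef_x a b = coef_x (a + i) (b + j) * shift_coef i j a b"
  "shift_coef i j a (Suc b) * coef_y a b = coef_y (a + i) (b + j) * shift_coef i j a b"
  by (auto simp: shift_coef_def coef_x_def coef_y_def r8_elem_defs r8_defs)

definition res_shift :: "nat \<Rightarrow> nat \<Rightarrow> (nat \<Rightarrow> nat \<Rightarrow> 'k::comm_ring_1 r8) \<Rightarrow> nat \<Rightarrow> nat \<Rightarrow> 'k r8"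
  where "res_shift i j v = (\<lambda>a b. v (a + i) (b + j) * shift_coef i j a b)"

lemma res_diff_shift: "res_diff (res_shift i j v) = res_shift i j (res_diff v)"
proof (intro ext)
  fix a b
  have "res_diff (res_shift i j v) a b =
      v (Suc a + i) (b + j) * (shift_coef i j (Suc a) b * coef_x a b) +
      v (a + i) (Suc b + j) * (shift_coef i j a (Suc b) * coef_y a b)"
    by (simp add: res_diff_def res_shift_def mult.assoc)
  also have "\<dots> = res_shift i j (res_diff v) a b"
    unfolding shift_coef_chain by (simp add: res_diff_def res_shift_def mult.assoc distrib_right)
  finally show "res_diff (res_shift i j v) a b = res_shift i j (res_diff v) a b" .
qed

section \<open>Coordinates on the Ext groups\<close>

text \<open>The corrections yx and xy have no constant term, so a dual functional composed with a
  shift sees only pairs that lie in a common closed half of the quadrant. This is the source of the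
  product rule for the \<theta> basis.\<close>

lemma shift_coef_augmentation:
  "c1 (shift_coef i j a b) = (if (b \<le> a \<and> j \<le> i) \<or> (a \<le> b \<and> i \<le> j) then 1 else 0)"
  by (auto simp: shift_coef_def)

text \<open>The cochain with coefficients \<open>c\<close> in the dual basis. Only the values of
  \<open>c\<close> with a + b = n matter, so one function of two indices can encode coordinates in
  all degrees.\<close>

definition res_functional :: "nat \<Rightarrow> (nat \<Rightarrow> nat \<Rightarrow> 'k) \<Rightarrow> (nat \<Rightarrow> nat \<Rightarrow> 'k::comm_ring_1 r8) \<Rightarrow> 'k"
  where "res_functional n c = (\<lambda>v\<in>{v. supported n v}. \<Sum>a\<le>n. c a (n - a) * c1 (v a (n - a)))"

lemma res_functional_hom: "res_functional n c \<in> lmod_hom R_algebra (res_module n) trivial_module"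
  unfolding res_functional_def carrier_res_module[symmetric]
  by (intro lmod_homI left_module_res_module)
    (simp_all add: res_module_simps trivial_module_smult sum.distrib sum_distrib_left algebra_simps)

lemma res_functional_unit: "a \<le> n \<Longrightarrow> res_functional n c (res_unit n a) = c a (n - a)"
  by (simp add: res_functional_def res_unit_def if_distrib[of "\<lambda>x. _ * c1 x"] if_distrib[of c1] if_distrib[of "\<lambda>x. _ * x"] cong: if_cong)

lemma res_functional_diff: "supported (Suc n) v \<Longrightarrow> res_functional n c (res_diff v) = 0"
  using supported_res_diff[of n v] by (simp add: res_functional_def) (simp add: res_diff_def)

lemma res_functional_cong:
  assumes "\<And>a b. a + b = n \<Longrightarrow> c a b = c' a b"
  shows "res_functional n c = res_functional n c'"
  unfolding res_functional_def by (intro restrict_ext sum.cong) (simp_all add: assms)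

text \<open>A homomorphism is determined on the basis, and the trivial module sees a coefficient
  only through its augmentation.\<close>

lemma hom_res_functional:
  fixes f :: "(nat \<Rightarrow> nat \<Rightarrow> 'k::comm_ring_1 r8) \<Rightarrow> 'k"
  assumes f: "f \<in> lmod_hom R_algebra (res_module n) trivial_module"
  shows "f = res_functional n (\<lambda>a b. f (res_unit n a))"
proof -
  let ?Q = "res_module n :: ((R_gen, 'k) nc_poly set, _) module"
  let ?M = "trivial_module :: ((R_gen, 'k) nc_poly set, 'k) module"
  interpret Q: left_module R_algebra ?Q by (rule left_module_res_module)
  interpret M: left_module R_algebra ?M by (rule left_module_trivial)
  have fs: "finsum ?M g A = sum g A" if "finite A" for g :: "nat \<Rightarrow> 'k" and A
    using that by (induction A rule: finite_induct) (simp_all add: M.M.finsum_insert)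
  have eq: "f v = (\<Sum>a\<le>n. f (res_unit n a) * c1 (v a (n - a)))" if v: "supported n v" for v
  proof -
    have cl: "(\<lambda>a. of_r8 (v a (n - a)) \<odot>\<^bsub>?Q\<^esub> res_unit n a) \<in> {..n} \<rightarrow> carrier ?Q"
      by (auto intro!: Q.smult_closed res_unit_closed)
    have "v = finsum ?Q (\<lambda>a. of_r8 (v a (n - a)) \<odot>\<^bsub>?Q\<^esub> res_unit n a) {..n}"
      unfolding finsum_res_module[OF finite_atMost cl]
    proof (intro ext)
      fix a b
      show "v a b = (\<Sum>s\<le>n. (of_r8 (v s (n - s)) \<odot>\<^bsub>?Q\<^esub> res_unit n s) a b)"
        using v by (cases "a + b = n")
          (auto simp: res_module_simps res_unit_def if_distrib[of "\<lambda>x. _ * x"] cong: if_cong)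
    qed
    then have "f v = finsum ?M (\<lambda>a. f (of_r8 (v a (n - a)) \<odot>\<^bsub>?Q\<^esub> res_unit n a)) {..n}"
      using lmod_hom_finsum[OF f left_module_res_module left_module_trivial finite_atMost cl] by simp
    also have "\<dots> = (\<Sum>a\<le>n. f (res_unit n a) * c1 (v a (n - a)))"
      by (simp add: fs lmod_hom_smult[OF f _ res_unit_closed] trivial_module_smult mult.commute)
    finally show ?thesis .
  qed
  have "f = restrict f {v. supported n v}"
    using lmod_hom_restrict[OF f] by (simp add: carrier_res_module)
  also have "\<dots> = res_functional n (\<lambda>a b. f (res_unit n a))"
    unfolding res_functional_def by (rule restrict_ext) (simp add: eq)
  finally show ?thesis .
qed

text \<open>The combination of the shifts that corresponds to the cochain with coefficients
  \<open>c\<close>. The elements \<open>r8_const\<close> are central, so multiplying by them on the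
  left keeps the map linear for the left action.\<close>

definition res_lift :: "nat \<Rightarrow> (nat \<Rightarrow> nat \<Rightarrow> 'k) \<Rightarrow> nat \<Rightarrow> (nat \<Rightarrow> nat \<Rightarrow> 'k::comm_ring_1 r8) \<Rightarrow> nat \<Rightarrow> nat \<Rightarrow> 'k r8"
  where "res_lift q c i =
    (\<lambda>v\<in>{v. supported (q + i) v}. \<lambda>a b. \<Sum>j\<le>q. r8_const (c j (q - j)) * res_shift j (q - j) v a b)"

lemma res_diff_sum: "res_diff (\<lambda>a b. \<Sum>s\<in>A. f s a b) = (\<lambda>a b. \<Sum>s\<in>A. res_diff (f s) a b)"
  by (simp add: res_diff_def fun_eq_iff sum.distrib sum_distrib_right)

lemma res_lift_chain_lift:
  fixes c :: "nat \<Rightarrow> nat \<Rightarrow> 'k::comm_ring_1"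
  shows "res_lift q c \<in> chain_lifts R_algebra res_module res_d res_aug q (res_functional q c)"
  unfolding chain_lifts_def mem_Collect_eq
proof (intro conjI allI ballI)
  have supported: "supported i (\<lambda>a b. \<Sum>j\<le>q. r8_const (c j (q - j)) * res_shift j (q - j) v a b)" if "supported (q + i) v" for i v
    using that by (auto simp: res_shift_def intro!: sum.neutral)
  show "res_lift q c i \<in> lmod_hom R_algebra (res_module (q + i)) (res_module i)" for i
    unfolding res_lift_def carrier_res_module[symmetric]
  proof (intro lmod_homI left_module_res_module)
    fix v :: "nat \<Rightarrow> nat \<Rightarrow> 'k r8" assume v: "v \<in> carrier (res_module (q + i))"
    then show "(\<lambda>a b. \<Sum>j\<le>q. r8_const (c j (q - j)) * res_shift j (q - j) v a b) \<in> carrier (res_module i)"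
      using supported[of i v] by (simp add: carrier_res_module)
  next
    fix v w :: "nat \<Rightarrow> nat \<Rightarrow> 'k r8"
    show "(\<lambda>a b. \<Sum>j\<le>q. r8_const (c j (q - j)) * res_shift j (q - j) (v \<oplus>\<^bsub>res_module (q + i)\<^esub> w) a b) =
      (\<lambda>a b. \<Sum>j\<le>q. r8_const (c j (q - j)) * res_shift j (q - j) v a b) \<oplus>\<^bsub>res_module i\<^esub>
      (\<lambda>a b. \<Sum>j\<le>q. r8_const (c j (q - j)) * res_shift j (q - j) w a b)"
      by (simp add: res_module_simps res_shift_def distrib_left distrib_right sum.distrib)
  next
    fix r and v :: "nat \<Rightarrow> nat \<Rightarrow> 'k r8"
    have "r8_const x * (y * z) = y * (r8_const x * z)" for x :: 'k and y z
      by (metis mult.assoc r8.con_central)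
    then show "(\<lambda>a b. \<Sum>j\<le>q. r8_const (c j (q - j)) * res_shift j (q - j) (r \<odot>\<^bsub>res_module (q + i)\<^esub> v) a b) =
      r \<odot>\<^bsub>res_module i\<^esub> (\<lambda>a b. \<Sum>j\<le>q. r8_const (c j (q - j)) * res_shift j (q - j) v a b)"
      by (simp add: res_module_simps res_shift_def sum_distrib_left mult.assoc)
  qed
  show "res_aug (res_lift q c 0 v) = res_functional q c v" if "v \<in> carrier (res_module q)" for v :: "nat \<Rightarrow> nat \<Rightarrow> 'k r8"
    using that supported[of 0 v]
    by (simp add: carrier_res_module res_aug_def res_lift_def res_functional_def res_shift_def shift_coef_augmentation)
      (intro sum.cong; auto)
  show "res_d i (res_lift q c (Suc i) v) = res_lift q c i (res_d (q + i) v)"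
    if "v \<in> carrier (res_module (q + Suc i))" for i and v :: "nat \<Rightarrow> nat \<Rightarrow> 'k r8"
  proof -
    have v: "supported (Suc (q + i)) v" using that by (simp add: carrier_res_module)
    then have "res_lift q c i (res_d (q + i) v) =
        (\<lambda>a b. \<Sum>j\<le>q. r8_const (c j (q - j)) * res_shift j (q - j) (res_diff v) a b)"
      using supported_res_diff[of "q + i" v] by (simp add: res_lift_def res_d_def)
    moreover have "res_d i (res_lift q c (Suc i) v) =
        res_diff (\<lambda>a b. \<Sum>j\<le>q. r8_const (c j (q - j)) * res_shift j (q - j) v a b)"
      using v supported[of "Suc i" v] by (simp add: res_lift_def res_d_def)
    ultimately show ?thesis
      by (simp add: res_diff_sum res_diff_smult res_diff_shift)
  qed
qed

section \<open>The product rule in coordinates\<close>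

definition same_chamber :: "nat \<Rightarrow> nat \<Rightarrow> nat \<Rightarrow> nat \<Rightarrow> bool"
  where "same_chamber a b i j \<longleftrightarrow> b \<le> a \<and> j \<le> i \<or> a \<le> b \<and> i \<le> j"

text \<open>The contribution of the left factor's component of degree \<open>p\<close>; the product
  of \<open>ext_algebra\<close> is a sum over this degree.\<close>

definition chamber_prod_part ::
    "nat \<Rightarrow> (nat \<Rightarrow> nat \<Rightarrow> 'k) \<Rightarrow> (nat \<Rightarrow> nat \<Rightarrow> 'k) \<Rightarrow> nat \<Rightarrow> nat \<Rightarrow> 'k::comm_ring_1"
  where "chamber_prod_part p c c' i j = (\<Sum>a\<le>i. \<Sum>b\<le>j.
    if a + b = p \<and> same_chamber a b (i - a) (j - b) then c a b * c' (i - a) (j - b) else 0)"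

definition chamber_prod :: "(nat \<Rightarrow> nat \<Rightarrow> 'k) \<Rightarrow> (nat \<Rightarrow> nat \<Rightarrow> 'k) \<Rightarrow> nat \<Rightarrow> nat \<Rightarrow> 'k::comm_ring_1"
  where "chamber_prod c c' i j = (\<Sum>a\<le>i. \<Sum>b\<le>j.
    if same_chamber a b (i - a) (j - b) then c a b * c' (i - a) (j - b) else 0)"

lemma chamber_prod_parts: "chamber_prod c c' i j = (\<Sum>p\<le>i + j. chamber_prod_part p c c' i j)"
proof -
  let ?t = "\<lambda>a b. if same_chamber a b (i - a) (j - b) then c a b * c' (i - a) (j - b) else 0"
  have "(\<Sum>p\<le>i + j. chamber_prod_part p c c' i j) = (\<Sum>p\<le>i + j. \<Sum>a\<le>i. \<Sum>b\<le>j. if a + b = p then ?t a b else 0)"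
    unfolding chamber_prod_part_def by (intro sum.cong refl) simp
  also have "\<dots> = (\<Sum>a\<le>i. \<Sum>p\<le>i + j. \<Sum>b\<le>j. if a + b = p then ?t a b else 0)"
    by (rule sum.swap)
  also have "\<dots> = (\<Sum>a\<le>i. \<Sum>b\<le>j. \<Sum>p\<le>i + j. if a + b = p then ?t a b else 0)"
    by (intro sum.cong refl sum.swap)
  also have "\<dots> = (\<Sum>a\<le>i. \<Sum>b\<le>j. ?t a b)"
    by (intro sum.cong refl) (subst sum.delta', auto)
  finally show ?thesis by (simp add: chamber_prod_def)
qed

text \<open>By \<open>shift_coef_augmentation\<close> only pairs in one chamber survive. The rest is
  a change of summation: the indices (a, p - a) of the left factor and (j, q - j) of the right one
  are grouped by the first index i = a + j of the target.\<close>

lemma res_functional_lift: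
  fixes c :: "nat \<Rightarrow> nat \<Rightarrow> 'k::comm_ring_1"
  shows "compose (carrier (res_module (p + q))) (res_functional p c) (res_lift q c' p) =
    res_functional (p + q) (chamber_prod_part p c c')"
proof (rule ext)
  fix v :: "nat \<Rightarrow> nat \<Rightarrow> 'k r8"
  show "compose (carrier (res_module (p + q))) (res_functional p c) (res_lift q c' p) v =
      res_functional (p + q) (chamber_prod_part p c c') v"
  proof (cases "supported (p + q) v")
    case v: True
    define V where "V i = c1 (v i (p + q - i))" for i
    define G where "G a b i j = (if same_chamber a b i j then c a b * c' i j else 0)" for a b i j
    have v': "supported (q + p) v" using v by (simp add: add.commute)
    have "supported p (res_lift q c' p v)"
      using lmod_hom_closed[of "res_lift q c' p" R_algebra "res_module (q + p)" "res_module p" v]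
        res_lift_chain_lift[of q c'] v' by (simp add: chain_lifts_def carrier_res_module)
    then have "res_functional p c (res_lift q c' p v) =
        (\<Sum>a\<le>p. c a (p - a) * c1 (\<Sum>j\<le>q. r8_const (c' j (q - j)) * res_shift j (q - j) v a (p - a)))"
      using v' by (simp add: res_functional_def res_lift_def)
    also have "\<dots> = (\<Sum>a\<le>p. \<Sum>j\<le>q. G a (p - a) j (q - j) * V (a + j))"
      by (intro sum.cong refl)
        (auto simp: sum_distrib_left res_shift_def shift_coef_augmentation G_def V_def same_chamber_def intro!: sum.cong)
    also have "\<dots> = (\<Sum>(a, j)\<in>{..p} \<times> {..q}. G a (p - a) j (q - j) * V (a + j))"
      by (simp add: sum.cartesian_product)
    also have "\<dots> = (\<Sum>(i, a, b)\<in>{(i, a, b). i \<le> p + q \<and> a \<le> i \<and> b \<le> p + q - i \<and> a + b = p}.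
        G a b (i - a) (p + q - i - b) * V i)"
    proof (rule sum.reindex_bij_witness[where i = "\<lambda>(i, a, b). (a, i - a)" and j = "\<lambda>(a, j). (a + j, a, p - a)"])
      fix x assume "x \<in> {..p} \<times> {..q}"
      then obtain a j where x: "x = (a, j)" "a \<le> p" "j \<le> q" by auto
      then have "p + q - (a + j) - (p - a) = q - j" by simp
      with x show "(case case x of (a, j) \<Rightarrow> (a + j, a, p - a) of
          (i, a, b) \<Rightarrow> G a b (i - a) (p + q - i - b) * V i) =
          (case x of (a, j) \<Rightarrow> G a (p - a) j (q - j) * V (a + j))" by simp
    qed auto
    also have "\<dots> = (\<Sum>(i, a, b)\<in>(SIGMA i:{..p + q}. {..i} \<times> {..p + q - i}).
        if a + b = p then G a b (i - a) (p + q - i - b) * V i else 0)"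
      by (intro sum.mono_neutral_cong_left finite_SigmaI finite_cartesian_product) (auto split: if_splits)
    also have "\<dots> = (\<Sum>i\<le>p + q. \<Sum>a\<le>i. \<Sum>b\<le>p + q - i.
        if a + b = p then G a b (i - a) (p + q - i - b) * V i else 0)"
      by (subst sum.Sigma[symmetric]) (simp_all add: sum.cartesian_product)
    also have "\<dots> = res_functional (p + q) (chamber_prod_part p c c') v"
      using v by (auto simp: res_functional_def chamber_prod_part_def sum_distrib_right G_def V_def intro!: sum.cong)
    finally show ?thesis using v by (simp add: compose_eq carrier_res_module)
  qed (auto simp: compose_def carrier_res_module res_functional_def restrict_def)
qed

section \<open>Coordinates of Ext classes for an arbitrary resolution\<close>

locale trivial_ext =
  resolution_comparison R_algebra trivial_module P d \<epsilon> res_module res_d res_aug F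
  for P :: "nat \<Rightarrow> ((R_gen, 'k::comm_ring_1) nc_poly set, 'm) module" and d \<epsilon> F
begin

lemma res_functional_cocycle: "res_functional n c \<in> carrier (Q.Z n)"
  by (simp add: Q.cocycle_iff res_functional_hom res_d_def carrier_res_module res_functional_diff)

text \<open>All coefficients of the differential have zero augmentation, so every functional
  vanishes on its image. Cochains and classes on the explicit resolution therefore coincide.\<close>

lemma res_coboundary: "Q.B n = {\<lambda>v\<in>carrier (res_module n). 0}"
proof -
  have zero: "f = (\<lambda>v\<in>carrier (res_module n). 0)" if f: "f \<in> Q.B n" for f
  proof (cases n)
    case (Suc m)
    obtain g where g: "g \<in> lmod_hom R_algebra (res_module m) trivial_module"
      "f = compose (carrier (res_module (Suc m))) g (res_d m)" using f Suc by auto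
    have "g (res_diff v) = 0" if "supported (Suc m) v" for v
      by (subst hom_res_functional[OF g(1)]) (rule res_functional_diff[OF that])
    then show ?thesis
      unfolding g(2) Suc compose_def
      by (intro restrict_ext) (simp add: carrier_res_module res_d_def)
  qed (use f in simp)
  show ?thesis
  proof (intro equalityI subsetI)
    fix f assume "f \<in> Q.B n"
    then show "f \<in> {\<lambda>v\<in>carrier (res_module n). 0}" unfolding singleton_iff by (rule zero)
  next
    fix f :: "(nat \<Rightarrow> nat \<Rightarrow> 'k r8) \<Rightarrow> 'k"
    assume "f \<in> {\<lambda>v\<in>carrier (res_module n). 0}"
    then show "f \<in> Q.B n" using Q.zero_coboundary[of n] by simp
  qed
qed

text \<open>Coordinates on the Ext groups of \<open>P\<close>, transported by \<open>F\<close>;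
  \<open>class_pull_surj\<close> makes them exhaustive and \<open>class_pull_inj\<close>
  faithful.\<close>

definition ext_coord :: "nat \<Rightarrow> (nat \<Rightarrow> nat \<Rightarrow> 'k) \<Rightarrow> ('m \<Rightarrow> 'k) set"
  where "ext_coord n c = P.cl n (pull n (res_functional n c))"

lemma ext_coord_cong: "(\<And>a b. a + b = n \<Longrightarrow> c a b = c' a b) \<Longrightarrow> ext_coord n c = ext_coord n c'"
  unfolding ext_coord_def using res_functional_cong[of n c c'] by simp

lemma ext_coord_carrier: "carrier (P.E n) = range (ext_coord n)"
proof -
  have "x \<in> range (ext_coord n)" if x: "x \<in> carrier (P.E n)" for x
  proof -
    obtain h where h: "h \<in> carrier (P.Z n)" "x = P.cl n h" using x by (auto simp: P.carrier_ext_group)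
    obtain f where f: "f \<in> carrier (Q.Z n)" "P.cl n (pull n f) = P.cl n h" using class_pull_surj[OF h(1)] by blast
    have "x = ext_coord n (\<lambda>a b. f (res_unit n a))"
      unfolding ext_coord_def using f(2) h(2) hom_res_functional[OF Q.cocycle_hom[OF f(1)]] by simp
    then show ?thesis by blast
  qed
  moreover have "ext_coord n c \<in> carrier (P.E n)" for c
    unfolding ext_coord_def P.carrier_ext_group by (intro imageI pull_cocycle res_functional_cocycle)
  ultimately show ?thesis by blast
qed

lemma ext_coord_closed: "ext_coord n c \<in> carrier (P.E n)"
  by (simp add: ext_coord_carrier)

lemma pull_add:
  "(\<lambda>x\<in>carrier (P n). pull n (res_functional n c) x \<oplus>\<^bsub>trivial_module\<^esub> pull n (res_functional n c') x) =
    pull n (res_functional n (\<lambda>a b. c a b + c' a b))"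
  using F_closed[of _ n]
  by (auto simp: compose_def fun_eq_iff res_functional_def carrier_res_module sum.distrib distrib_right)

lemma ext_coord_add: "ext_coord n (\<lambda>a b. c a b + c' a b) = ext_coord n c \<oplus>\<^bsub>P.E n\<^esub> ext_coord n c'"
  using P.class_add[OF pull_cocycle[OF res_functional_cocycle[of n c]] pull_cocycle[OF res_functional_cocycle[of n c']]]
  unfolding ext_coord_def pull_add by simp

lemma ext_coord_eq_zero_iff: "ext_coord n c = \<zero>\<^bsub>P.E n\<^esub> \<longleftrightarrow> (\<forall>a b. a + b = n \<longrightarrow> c a b = 0)"
proof
  assume "ext_coord n c = \<zero>\<^bsub>P.E n\<^esub>"
  then have "pull n (res_functional n c) \<in> P.B n"
    by (simp add: ext_coord_def P.zero_ext_group P.class_eq_zero_iff pull_cocycle res_functional_cocycle)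
  then have "res_functional n c \<in> Q.B n" by (rule class_pull_inj[OF res_functional_cocycle])
  then have z: "res_functional n c v = 0" if "v \<in> carrier (res_module n)" for v
    using that by (simp add: res_coboundary)
  show "\<forall>a b. a + b = n \<longrightarrow> c a b = 0"
  proof (intro allI impI)
    fix a b assume ab: "a + b = n"
    then have "a \<le> n" "n - a = b" by auto
    then show "c a b = 0"
      using z[OF res_unit_closed] res_functional_unit[of a n c] by simp
  qed
next
  assume "\<forall>a b. a + b = n \<longrightarrow> c a b = 0"
  then have "res_functional n c = res_functional n (\<lambda>a b. 0)" by (intro res_functional_cong) simp
  then have "pull n (res_functional n c) = (\<lambda>x\<in>carrier (P n). \<zero>\<^bsub>trivial_module :: ((R_gen, 'k) nc_poly set, 'k) module\<^esub>)"
    using F_closed[of _ n] by (auto simp: compose_def fun_eq_iff res_functional_def carrier_res_module)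
  then show "ext_coord n c = \<zero>\<^bsub>P.E n\<^esub>"
    using P.zero_coboundary[of n] P.class_eq_zero_iff[OF pull_cocycle[OF res_functional_cocycle], of n c]
    by (simp add: ext_coord_def P.zero_ext_group)
qed

lemma ext_coord_eq_iff: "ext_coord n c = ext_coord n c' \<longleftrightarrow> (\<forall>a b. a + b = n \<longrightarrow> c a b = c' a b)"
proof
  assume eq: "ext_coord n c = ext_coord n c'"
  have "ext_coord n c = ext_coord n (\<lambda>a b. c a b - c' a b) \<oplus>\<^bsub>P.E n\<^esub> ext_coord n c'"
    unfolding ext_coord_add[symmetric] by simp
  then have "ext_coord n (\<lambda>a b. c a b - c' a b) = \<zero>\<^bsub>P.E n\<^esub>"
    unfolding eq
    using P.E.add.r_cancel_one'[OF ext_coord_closed[of n c'] ext_coord_closed[of n "\<lambda>a b. c a b - c' a b"]]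
    by blast
  then show "\<forall>a b. a + b = n \<longrightarrow> c a b = c' a b" by (simp add: ext_coord_eq_zero_iff)
next
  assume "\<forall>a b. a + b = n \<longrightarrow> c a b = c' a b"
  then show "ext_coord n c = ext_coord n c'" by (intro ext_coord_cong) blast
qed

lemma ext_coord_sum:
  assumes "finite A"
  shows "finsum (P.E n) (\<lambda>s. ext_coord n (f s)) A = ext_coord n (\<lambda>a b. \<Sum>s\<in>A. f s a b)"
  using assms
proof (induction A rule: finite_induct)
  case empty
  then show ?case using ext_coord_eq_zero_iff[of n "\<lambda>a b. 0"] by simp
next
  case (insert s A)
  then show ?case by (simp add: P.E.finsum_insert ext_coord_closed Pi_def flip: ext_coord_add)
qed

text \<open>A scalar acts on a coset in \<open>quotient\<close> by a union over its representatives;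
  stability of the coboundaries under scaling makes the cosets in this union equal.\<close>

lemma scale_coboundary:
  assumes "f \<in> P.B n" shows "(\<lambda>x\<in>carrier (P n). t * f x) \<in> P.B n"
proof (cases n)
  case 0
  then show ?thesis using assms by (auto simp: fun_eq_iff)
next
  case (Suc m)
  obtain g where g: "g \<in> lmod_hom R_algebra (P m) trivial_module" "f = compose (carrier (P (Suc m))) g (d m)"
    using assms Suc by auto
  have "(\<lambda>x\<in>carrier (P m). t * g x) \<in> lmod_hom R_algebra (P m) trivial_module"
    using g(1) by (intro lmod_homI P.p(3))
      (simp_all add: lmod_hom_add lmod_hom_smult trivial_module_smult algebra_simps)
  moreover have "(\<lambda>x\<in>carrier (P n). t * f x) = compose (carrier (P (Suc m))) (\<lambda>x\<in>carrier (P m). t * g x) (d m)"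
    using P.p(11)[of _ m] by (auto simp: compose_def fun_eq_iff g(2) Suc)
  ultimately show ?thesis unfolding Suc using P.coboundaryI by simp
qed

lemma scale_cocycle:
  assumes "f \<in> carrier (P.Z n)" shows "(\<lambda>x\<in>carrier (P n). t * f x) \<in> carrier (P.Z n)"
proof -
  have "(\<lambda>x\<in>carrier (P n). t * f x) \<in> lmod_hom R_algebra (P n) trivial_module"
    using P.cocycle_hom[OF assms] by (intro lmod_homI P.p(3))
      (simp_all add: lmod_hom_add lmod_hom_smult trivial_module_smult algebra_simps)
  then show ?thesis using assms P.p(11) by (simp add: P.cocycle_iff)
qed

lemma ext_coord_smult: "t \<odot>\<^bsub>P.E n\<^esub> ext_coord n c = ext_coord n (\<lambda>a b. t * c a b)"
proof -
  let ?f = "pull n (res_functional n c)"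
  have f: "?f \<in> carrier (P.Z n)" by (rule pull_cocycle[OF res_functional_cocycle])
  have one: "\<one>\<^bsub>R_algebra\<^esub> \<in> carrier (R_algebra :: ('k, (R_gen, 'k) nc_poly set) module)"
    using ring_R_algebra by (rule ring.ring_simprules)
  have "t \<odot>\<^bsub>R_algebra\<^esub> \<one>\<^bsub>R_algebra\<^esub> \<in> carrier (R_algebra :: ('k, (R_gen, 'k) nc_poly set) module)"
    by (simp add: R_algebra_def presented_algebra_simps)
  then have sm: "t \<odot>\<^bsub>P.Z n\<^esub> g = (\<lambda>x\<in>carrier (P n). t * g x)" for g
    by (simp add: ext_cocycles_def trivial_module_smult r8_of_hom one)
  have minus: "x \<ominus>\<^bsub>trivial_module :: ((R_gen, 'k) nc_poly set, 'k) module\<^esub> y = x - y" for x y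
  proof -
    have "\<ominus>\<^bsub>trivial_module :: ((R_gen, 'k) nc_poly set, 'k) module\<^esub> y = - y"
      by (rule P.N.M.minus_equality) simp_all
    then show ?thesis by (simp add: a_minus_def)
  qed
  have "(\<Union>g\<in>P.cl n ?f. P.cl n (\<lambda>x\<in>carrier (P n). t * g x)) = P.cl n (\<lambda>x\<in>carrier (P n). t * ?f x)"
  proof (intro UN_constant_eq ballI)
    show "?f \<in> P.cl n ?f"
      using f P.zero_coboundary[of n] by (simp add: P.mem_class minus cong: restrict_cong)
    fix g assume "g \<in> P.cl n ?f"
    then have g: "g \<in> carrier (P.Z n)"
      and gB: "(\<lambda>x\<in>carrier (P n). g x \<ominus>\<^bsub>trivial_module :: ((R_gen, 'k) nc_poly set, 'k) module\<^esub> ?f x) \<in> P.B n"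
      by (simp_all add: P.mem_class f)
    show "P.cl n (\<lambda>x\<in>carrier (P n). t * g x) = P.cl n (\<lambda>x\<in>carrier (P n). t * ?f x)"
      using scale_coboundary[OF gB, of t]
      by (subst P.class_eq_iff[OF scale_cocycle[OF g] scale_cocycle[OF f]])
        (simp add: minus right_diff_distrib cong: restrict_cong)
  qed
  moreover have "(\<lambda>x\<in>carrier (P n). t * ?f x) = pull n (res_functional n (\<lambda>a b. t * c a b))"
    using F_closed[of _ n]
    by (auto simp: compose_def fun_eq_iff res_functional_def carrier_res_module sum_distrib_left mult.assoc)
  ultimately show ?thesis
    by (simp add: ext_coord_def ext_group_def quotient_def sm flip: ext_class_def)
qed

lemma ext_coord_yoneda:
  "yoneda_prod R_algebra trivial_module P d \<epsilon> p q (ext_coord p c) (ext_coord q c') =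
    ext_coord (p + q) (chamber_prod_part p c c')"
  unfolding ext_coord_def
  using yoneda_prod_pull[OF res_functional_cocycle[of p c] res_functional_cocycle res_lift_chain_lift[of q c']]
  by (simp add: res_functional_lift)

text \<open>The functional dual to \<open>u\<^sub>0\<^sub>0\<close> is \<open>res_aug\<close>, and
  its composite with \<open>F\<close> is \<epsilon>.\<close>

lemma ext_coord_one: "ext_coord 0 (\<lambda>a b. if a = 0 \<and> b = 0 then 1 else 0) = P.cl 0 \<epsilon>"
proof -
  have "pull 0 (res_functional 0 (\<lambda>a b. if a = 0 \<and> b = 0 then 1 else 0)) = restrict \<epsilon> (carrier (P 0))"
    unfolding compose_def
  proof (rule restrict_ext)
    fix x assume x: "x \<in> carrier (P 0)"
    then show "res_functional 0 (\<lambda>a b. if a = 0 \<and> b = 0 then 1 else 0) (F 0 x) = \<epsilon> x"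
      using F_aug[OF x] F_closed[OF x] by (simp add: res_aug_def res_functional_def carrier_res_module)
  qed
  then show ?thesis
    using lmod_hom_restrict[OF P.p(5)] by (simp add: ext_coord_def)
qed

end

section \<open>Presentation of the Ext algebra\<close>

definition exp1 :: "ext_gen list \<Rightarrow> nat"
  where "exp1 w = count_list w G_a1 + count_list w G_b"

definition exp2 :: "ext_gen list \<Rightarrow> nat"
  where "exp2 w = count_list w G_a2 + count_list w G_b"

text \<open>
  A word with at most one of the letters \<open>\<aa>\<^sub>1\<close>, \<open>\<aa>\<^sub>2\<close> is mapped to \<open>\<theta>\<^sub>a\<^sub>b\<close>, where \<open>(a, b)\<close> is given by \<open>exp1\<close> and
  \<open>exp2\<close>; the other words vanish.
\<close>

definition one_sided :: "ext_gen list \<Rightarrow> bool"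
  where "one_sided w \<longleftrightarrow> count_list w G_a1 = 0 \<or> count_list w G_a2 = 0"

text \<open>The coordinates which the image of \<open>p\<close> in the Ext algebra is to have,
  defined on words alone. That they respect products is verified against \<open>chamber_prod\<close>
  afterwards.\<close>

definition ext_coeff :: "(ext_gen, 'k::comm_ring_1) nc_poly \<Rightarrow> nat \<Rightarrow> nat \<Rightarrow> 'k"
  where "ext_coeff p a b = lin_ext (\<lambda>w c. if one_sided w \<and> exp1 w = a \<and> exp2 w = b then c else 0) p"

lemma ext_coeff_add: "ext_coeff (p + q) = (\<lambda>a b. ext_coeff p a b + ext_coeff q a b)"
  unfolding ext_coeff_def fun_eq_iff by (intro allI lin_ext_add) simp

lemma ext_coeff_scaled_monomial:
  "ext_coeff (Poly_Mapping.single 0 c * monomial w) = (\<lambda>a b. if one_sided w \<and> exp1 w = a \<and> exp2 w = b then c else 0)"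
  unfolding ext_coeff_def fun_eq_iff by (intro allI lin_ext_monomial) simp

lemma ext_coeff_zero: "ext_coeff 0 = (\<lambda>a b. 0)"
  by (simp add: fun_eq_iff ext_coeff_def lin_ext_def)

lemma ext_coeff_uminus: "ext_coeff (- p) = (\<lambda>a b. - ext_coeff p a b)"
  using ext_coeff_add[of p "- p"]
  by (auto simp: ext_coeff_zero fun_eq_iff eq_neg_iff_add_eq_0 add.commute)

lemma ext_coeff_diff: "ext_coeff (p - q) = (\<lambda>a b. ext_coeff p a b - ext_coeff q a b)"
  using ext_coeff_add[of p "- q"] by (simp add: ext_coeff_uminus)

lemma ext_coeff_sum: "finite A \<Longrightarrow> ext_coeff (\<Sum>s\<in>A. f s) = (\<lambda>a b. \<Sum>s\<in>A. ext_coeff (f s) a b)"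
  by (induction A rule: finite_induct) (simp_all add: ext_coeff_zero ext_coeff_add)

lemma ext_coeff_monomial:
  "ext_coeff (monomial w) = (\<lambda>a b. if one_sided w \<and> exp1 w = a \<and> exp2 w = b then 1 else 0)"
  using ext_coeff_scaled_monomial[of 1 w] by simp

lemma chamber_prod_add:
  "chamber_prod (\<lambda>a b. c a b + c' a b) e = (\<lambda>i j. chamber_prod c e i j + chamber_prod c' e i j)"
  "chamber_prod e (\<lambda>a b. c a b + c' a b) = (\<lambda>i j. chamber_prod e c i j + chamber_prod e c' i j)"
  unfolding chamber_prod_def fun_eq_iff sum.distrib[symmetric]
  by (intro allI sum.cong refl; simp add: algebra_simps)+

text \<open>The product of multiples of \<open>\<theta>\<^sub>A\<^sub>B\<close> and
  \<open>\<theta>\<^sub>A\<^sub>'\<^sub>B\<^sub>'\<close>. The guards \<open>G\<close> and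
  \<open>G'\<close> will stand for \<open>one_sided\<close>, so that words with image zero are
  covered by the same formula.\<close>

lemma chamber_prod_delta:
  "chamber_prod (\<lambda>a b. if G \<and> A = a \<and> B = b then x else 0) (\<lambda>a b. if G' \<and> A' = a \<and> B' = b then y else 0) =
    (\<lambda>i j. if G \<and> G' \<and> same_chamber A B A' B' \<and> A + A' = i \<and> B + B' = j then x * y else (0::'k::comm_ring_1))"
proof (intro ext)
  fix i j
  let ?T = "if G \<and> G' \<and> same_chamber A B A' B' \<and> A' = i - A \<and> B' = j - B then x * y else 0"
  have inner: "(\<Sum>b\<le>j. if same_chamber a b (i - a) (j - b)
      then (if G \<and> A = a \<and> B = b then x else 0) * (if G' \<and> A' = i - a \<and> B' = j - b then y else 0) else 0) =
      (if a = A then if B \<le> j then ?T else 0 else 0)" for a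
  proof -
    have "(\<Sum>b\<le>j. if same_chamber a b (i - a) (j - b)
      then (if G \<and> A = a \<and> B = b then x else 0) * (if G' \<and> A' = i - a \<and> B' = j - b then y else 0) else 0) =
      (\<Sum>b\<le>j. if b = B then if a = A then ?T else 0 else 0)"
      by (intro sum.cong refl) auto
    then show ?thesis by simp
  qed
  have "chamber_prod (\<lambda>a b. if G \<and> A = a \<and> B = b then x else 0) (\<lambda>a b. if G' \<and> A' = a \<and> B' = b then y else 0) i j =
     (\<Sum>a\<le>i. if a = A then if B \<le> j then ?T else 0 else 0)"
    unfolding chamber_prod_def inner ..
  also have "\<dots> = (if A \<le> i \<and> B \<le> j \<and> G \<and> G' \<and> same_chamber A B A' B' \<and> A' = i - A \<and> B' = j - B then x * y else 0)"
    by auto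
  also have "\<dots> = (if G \<and> G' \<and> same_chamber A B A' B' \<and> A + A' = i \<and> B + B' = j then x * y else 0)"
    by (rule if_cong) auto
  finally show "chamber_prod (\<lambda>a b. if G \<and> A = a \<and> B = b then x else 0) (\<lambda>a b. if G' \<and> A' = a \<and> B' = b then y else 0) i j =
    (if G \<and> G' \<and> same_chamber A B A' B' \<and> A + A' = i \<and> B + B' = j then x * y else 0)" .
qed

text \<open>The letter \<open>G_b\<close> raises both exponents equally. For a one-sided word the
  comparison of \<open>exp1\<close> with \<open>exp2\<close> therefore reveals which of the letters
  \<open>G_a1\<close>, \<open>G_a2\<close> is absent, and lying in a common chamber means that one
  of them is absent from both factors.\<close>

lemma one_sided_append:
  "one_sided (u @ v) \<longleftrightarrow> one_sided u \<and> one_sided v \<and> same_chamber (exp1 u) (exp2 u) (exp1 v) (exp2 v)"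
  by (auto simp: one_sided_def same_chamber_def exp1_def exp2_def)

lemma ext_coeff_mult:
  fixes p q :: "(ext_gen, 'k::comm_ring_1) nc_poly"
  shows "ext_coeff (p * q) = chamber_prod (ext_coeff p) (ext_coeff q)"
proof (induction p rule: nc_poly_induct)
  case (scaled_monomial c w)
  show ?case
  proof (induction q rule: nc_poly_induct)
    case (scaled_monomial c' w')
    have "Poly_Mapping.single 0 c * monomial w * (Poly_Mapping.single 0 c' * monomial w') =
        Poly_Mapping.single 0 (c * c') * monomial (w @ w')"
      unfolding single_zero_mult monomial_append mult.assoc
      by (metis mult.assoc single_zero_commute)
    moreover have "exp1 (w @ w') = exp1 w + exp1 w'" "exp2 (w @ w') = exp2 w + exp2 w'"
      by (simp_all add: exp1_def exp2_def)
    ultimately show ?case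
      by (simp add: ext_coeff_scaled_monomial chamber_prod_delta one_sided_append)
  qed (simp add: distrib_left ext_coeff_add chamber_prod_add)
qed (simp add: distrib_right ext_coeff_add chamber_prod_add)

lemma ext_coeff_one: "ext_coeff 1 = (\<lambda>a b. if a = 0 \<and> b = 0 then 1 else 0)"
  using ext_coeff_monomial[of "[]"] by (auto simp: monomial_Nil one_sided_def exp1_def exp2_def fun_eq_iff)

lemma ext_coeff_smult: "ext_coeff (Poly_Mapping.single 0 c * p) = (\<lambda>a b. c * ext_coeff p a b)"
proof (induction p rule: nc_poly_induct)
  case (scaled_monomial c' w)
  have "Poly_Mapping.single 0 c * (Poly_Mapping.single 0 c' * monomial w) = Poly_Mapping.single 0 (c * c') * monomial w"
    by (simp add: single_zero_mult mult.assoc)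
  then show ?case by (auto simp: ext_coeff_scaled_monomial fun_eq_iff)
qed (simp add: ext_coeff_add distrib_left)

lemma chamber_prod_zero: "chamber_prod (\<lambda>a b. 0) c = (\<lambda>i j. 0)" "chamber_prod c (\<lambda>a b. 0) = (\<lambda>i j. 0)"
  by (auto simp: chamber_prod_def fun_eq_iff intro!: sum.neutral)

lemma ext_coeff_Idl:
  assumes "p \<in> Idl\<^bsub>free_algebra\<^esub> ext_rels" shows "ext_coeff p = (\<lambda>a b. 0)"
proof -
  let ?K = "{p. ext_coeff p = (\<lambda>a b. 0)}"
  have "ideal ?K free_algebra"
  proof (rule idealI[OF ring_free_algebra])
    show "subgroup ?K (add_monoid free_algebra)"
      by (rule free.add.subgroupI) (auto simp: ext_coeff_zero ext_coeff_add ext_coeff_uminus intro: exI[of _ 0])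
  qed (auto simp: ext_coeff_mult chamber_prod_zero)
  moreover have "ext_rels \<subseteq> ?K"
    by (auto simp: ext_rels_def ext_coeff_diff ext_coeff_monomial one_sided_def exp1_def exp2_def fun_eq_iff)
  ultimately show ?thesis
    using free.genideal_minimal[of ?K ext_rels] assms by auto
qed

section \<open>Normal forms modulo the relations of the Ext algebra\<close>

definition nf_word :: "nat \<Rightarrow> nat \<Rightarrow> ext_gen list"
  where "nf_word a b = replicate (a - b) G_a1 @ replicate (b - a) G_a2 @ replicate (min a b) G_b"

lemma count_list_replicate': "count_list (replicate n x) y = (if x = y then n else 0)"
  by (induction n) auto

text \<open>Truncated subtraction leaves at most one of the blocks of \<open>G_a1\<close> and
  \<open>G_a2\<close> non-empty, which makes \<open>nf_word\<close> a section of the pair of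
  exponents.\<close>

lemma nf_word_stats: "one_sided (nf_word a b)" "exp1 (nf_word a b) = a" "exp2 (nf_word a b) = b"
  by (auto simp: nf_word_def one_sided_def exp1_def exp2_def count_list_replicate')

definition ext_nf :: "(ext_gen, 'k::comm_ring_1) nc_poly \<Rightarrow> (ext_gen, 'k) nc_poly"
  where "ext_nf = lin_ext (\<lambda>w c. if one_sided w then Poly_Mapping.single 0 c * monomial (nf_word (exp1 w) (exp2 w)) else 0)"

lemma ext_nf_add: "ext_nf (p + q) = ext_nf p + ext_nf q"
  unfolding ext_nf_def by (rule lin_ext_add) (simp add: single_add distrib_right)

lemma ext_nf_scaled_monomial: "ext_nf (Poly_Mapping.single 0 c * monomial w) =
    (if one_sided w then Poly_Mapping.single 0 c * monomial (nf_word (exp1 w) (exp2 w)) else 0)"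
  unfolding ext_nf_def by (rule lin_ext_monomial) simp

lemma lookup_scaled_monomial:
  "Poly_Mapping.lookup (Poly_Mapping.single 0 c * monomial w) (Free_Word u) = (if u = w then c else 0)"
proof -
  have "Poly_Mapping.single 0 c * monomial w = Poly_Mapping.single (Free_Word w) c"
    by (simp add: single_eq_monomial[of "Free_Word w"])
  then show ?thesis by (simp add: lookup_single when_def)
qed

text \<open>Distinct exponents give distinct normal words, so the coefficients of the normal form
  are precisely the coordinates. Vanishing coordinates thus force a vanishing normal form.\<close>

lemma lookup_ext_nf:
  "Poly_Mapping.lookup (ext_nf p) (Free_Word u) =
    (if u = nf_word (exp1 u) (exp2 u) then ext_coeff p (exp1 u) (exp2 u) else 0)"
proof (induction p rule: nc_poly_induct)
  case (scaled_monomial c w)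
  show ?case
  proof (cases "one_sided w")
    case True
    then show ?thesis
      by (auto simp: ext_nf_scaled_monomial lookup_scaled_monomial ext_coeff_scaled_monomial nf_word_stats)
  qed (simp add: ext_nf_scaled_monomial ext_coeff_scaled_monomial)
qed (simp add: ext_nf_add lookup_add ext_coeff_add)

lemma ext_nf_eq_zero:
  assumes "ext_coeff p = (\<lambda>a b. 0)" shows "ext_nf p = 0"
proof (rule poly_mapping_eqI)
  fix k :: "ext_gen free_word"
  show "Poly_Mapping.lookup (ext_nf p) k = Poly_Mapping.lookup 0 k"
    using assms by (cases k) (simp add: lookup_ext_nf)
qed

context
  fixes I :: "(ext_gen, 'k::comm_ring_1) nc_poly set"
  defines "I \<equiv> Idl\<^bsub>free_algebra\<^esub> ext_rels"
begin

lemmas I_closed = ideal_rels_closed[where rels = "ext_rels :: (ext_gen, 'k) nc_poly set", folded I_def]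

lemma ext_rels_ideal:
  "monomial [G_a2] * monomial [G_a1] \<in> I" "monomial [G_a1] * monomial [G_a2] \<in> I"
  "monomial [G_b] * monomial [G_a1] - monomial [G_a1] * monomial [G_b] \<in> I"
  "monomial [G_b] * monomial [G_a2] - monomial [G_a2] * monomial [G_b] \<in> I"
proof -
  have r: "monomial [G_a2, G_a1] \<in> I" "monomial [G_a1, G_a2] \<in> I"
    "monomial [G_a1, G_b] - monomial [G_b, G_a1] \<in> I" "monomial [G_a2, G_b] - monomial [G_b, G_a2] \<in> I"
    using rels_subset_ideal[of "ext_rels :: (ext_gen, 'k) nc_poly set"] by (auto simp: ext_rels_def I_def)
  then show "monomial [G_a2] * monomial [G_a1] \<in> I" "monomial [G_a1] * monomial [G_a2] \<in> I"
    "monomial [G_b] * monomial [G_a1] - monomial [G_a1] * monomial [G_b] \<in> I"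
    "monomial [G_b] * monomial [G_a2] - monomial [G_a2] * monomial [G_b] \<in> I"
    using I_closed(6)[OF r(3)] I_closed(6)[OF r(4)] by (simp_all flip: monomial_append)
qed

lemma b_commutes_replicate:
  assumes "monomial [G_b] * monomial [g] - monomial [g] * monomial [G_b] \<in> I"
  shows "monomial [G_b] * monomial (replicate n g) - monomial (replicate n g) * monomial [G_b] \<in> I"
proof (induction n)
  case 0
  then show ?case by (simp add: monomial_Nil I_closed(1))
next
  case (Suc n)
  have eq: "monomial [G_b] * monomial (replicate (Suc n) g) - monomial (replicate (Suc n) g) * monomial [G_b] =
      (monomial [G_b] * monomial [g] - monomial [g] * monomial [G_b]) * monomial (replicate n g) +
      monomial [g] * (monomial [G_b] * monomial (replicate n g) - monomial (replicate n g) * monomial [G_b])"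
    by (simp add: monomial_Cons[of g "replicate n g"] algebra_simps)
  show ?case
    unfolding eq by (intro I_closed(2) I_closed(5)[OF assms] I_closed(4)[OF Suc])
qed

text \<open>On the left of a normal word, \<open>G_a1\<close> or \<open>G_a2\<close> extends its own
  block or meets the other letter, which gives an element of the ideal. The letter
  \<open>G_b\<close> has to commute past the leading block to join the others.\<close>

lemma gen_nf_word:
  "monomial [G_a1] * monomial (nf_word a b) - (if b \<le> a then monomial (nf_word (Suc a) b) else 0) \<in> I"
  "monomial [G_a2] * monomial (nf_word a b) - (if a \<le> b then monomial (nf_word a (Suc b)) else 0) \<in> I"
  "monomial [G_b] * monomial (nf_word a b) - monomial (nf_word (Suc a) (Suc b)) \<in> I"
proof -
  show "monomial [G_a1] * monomial (nf_word a b) - (if b \<le> a then monomial (nf_word (Suc a) b) else 0) \<in> I"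
  proof (cases "b \<le> a")
    case True
    then have "nf_word (Suc a) b = [G_a1] @ nf_word a b" by (simp add: nf_word_def Suc_diff_le)
    then have "(monomial (nf_word (Suc a) b) :: (ext_gen, 'k) nc_poly) = monomial [G_a1] * monomial (nf_word a b)"
      by (simp only: monomial_append)
    then show ?thesis using True by (simp add: I_closed(1))
  next
    case False
    then obtain m where "b - a = Suc m" by (metis Suc_diff_Suc not_le)
    then have "(monomial [G_a1] * monomial (nf_word a b) :: (ext_gen, 'k) nc_poly) =
        monomial [G_a1] * monomial [G_a2] * monomial (replicate m G_a2 @ replicate (min a b) G_b)"
      using False by (simp add: nf_word_def flip: monomial_append)
    then show ?thesis using False I_closed(5)[OF ext_rels_ideal(2)] by simp
  qed
  show "monomial [G_a2] * monomial (nf_word a b) - (if a \<le> b then monomial (nf_word a (Suc b)) else 0) \<in> I"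
  proof (cases "a \<le> b")
    case True
    then have "nf_word a (Suc b) = [G_a2] @ nf_word a b" by (simp add: nf_word_def Suc_diff_le)
    then have "(monomial (nf_word a (Suc b)) :: (ext_gen, 'k) nc_poly) = monomial [G_a2] * monomial (nf_word a b)"
      by (simp only: monomial_append)
    then show ?thesis using True by (simp add: I_closed(1))
  next
    case False
    then obtain m where "a - b = Suc m" by (metis Suc_diff_Suc not_le)
    then have "(monomial [G_a2] * monomial (nf_word a b) :: (ext_gen, 'k) nc_poly) =
        monomial [G_a2] * monomial [G_a1] * monomial (replicate m G_a1 @ replicate (min a b) G_b)"
      using False by (simp add: nf_word_def flip: monomial_append)
    then show ?thesis using False I_closed(5)[OF ext_rels_ideal(1)] by simp
  qed
  define u where "u = replicate (a - b) G_a1"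
  define v where "v = replicate (b - a) G_a2"
  define t where "t = replicate (min a b) G_b"
  have u: "monomial [G_b] * monomial u - monomial u * monomial [G_b] \<in> I"
    unfolding u_def by (rule b_commutes_replicate[OF ext_rels_ideal(3)])
  have v: "monomial [G_b] * monomial v - monomial v * monomial [G_b] \<in> I"
    unfolding v_def by (rule b_commutes_replicate[OF ext_rels_ideal(4)])
  have "nf_word a b = u @ v @ t" "nf_word (Suc a) (Suc b) = u @ v @ [G_b] @ t"
    by (simp_all add: nf_word_def u_def v_def t_def)
  then have eq: "monomial [G_b] * monomial (nf_word a b) - monomial (nf_word (Suc a) (Suc b)) =
      (monomial [G_b] * monomial u - monomial u * monomial [G_b]) * (monomial v * monomial t) +
      monomial u * ((monomial [G_b] * monomial v - monomial v * monomial [G_b]) * monomial t)"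
    by (simp only: monomial_append) (simp add: algebra_simps)
  show "monomial [G_b] * monomial (nf_word a b) - monomial (nf_word (Suc a) (Suc b)) \<in> I"
    unfolding eq by (intro I_closed(2) I_closed(5)[OF u] I_closed(4)[OF I_closed(5)[OF v]])
qed

lemma gen_monomial_nf:
  assumes "one_sided w"
  shows "monomial [g] * monomial (nf_word (exp1 w) (exp2 w)) -
    (if one_sided (g # w) then monomial (nf_word (exp1 (g # w)) (exp2 (g # w))) else 0) \<in> I"
proof (cases g)
  case G_a1
  have "one_sided (g # w) \<longleftrightarrow> exp2 w \<le> exp1 w" "exp1 (g # w) = Suc (exp1 w)" "exp2 (g # w) = exp2 w"
    using assms by (auto simp: G_a1 one_sided_def exp1_def exp2_def)
  then show ?thesis using gen_nf_word(1)[of "exp1 w" "exp2 w"] by (simp add: G_a1 split: if_splits)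
next
  case G_a2
  have "one_sided (g # w) \<longleftrightarrow> exp1 w \<le> exp2 w" "exp1 (g # w) = exp1 w" "exp2 (g # w) = Suc (exp2 w)"
    using assms by (auto simp: G_a2 one_sided_def exp1_def exp2_def)
  then show ?thesis using gen_nf_word(2)[of "exp1 w" "exp2 w"] by (simp add: G_a2 split: if_splits)
next
  case G_b
  have "one_sided (g # w)" "exp1 (g # w) = Suc (exp1 w)" "exp2 (g # w) = Suc (exp2 w)"
    using assms by (auto simp: G_b one_sided_def exp1_def exp2_def)
  then show ?thesis using gen_nf_word(3)[of "exp1 w" "exp2 w"] by (simp add: G_b)
qed

text \<open>A word is built up from its right end, each new letter being absorbed by
  \<open>gen_monomial_nf\<close>. A suffix that is not one-sided already lies in the ideal, together
  with all its extensions to the left.\<close>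

lemma ext_nf_congruent: "p - ext_nf p \<in> I"
proof (induction p rule: nc_poly_induct)
  case (scaled_monomial c w)
  have w: "monomial w - (if one_sided w then monomial (nf_word (exp1 w) (exp2 w)) else 0) \<in> I"
  proof (induction w)
    case Nil
    then show ?case by (simp add: one_sided_def exp1_def exp2_def nf_word_def I_closed(1))
  next
    case (Cons g w)
    show ?case
    proof (cases "one_sided w")
      case True
      let ?n = "monomial (nf_word (exp1 w) (exp2 w)) :: (ext_gen, 'k) nc_poly"
      let ?m = "if one_sided (g # w) then monomial (nf_word (exp1 (g # w)) (exp2 (g # w))) else 0 :: (ext_gen, 'k) nc_poly"
      have "monomial [g] * (monomial w - ?n) + (monomial [g] * ?n - ?m) \<in> I"
        using Cons.IH True by (intro I_closed(2) I_closed(4) gen_monomial_nf) simp_all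
      moreover have "monomial (g # w) - ?m = monomial [g] * (monomial w - ?n) + (monomial [g] * ?n - ?m)"
        by (simp add: monomial_Cons[of g w] right_diff_distrib)
      ultimately show ?thesis by metis
    next
      case False
      then have "\<not> one_sided (g # w)" by (auto simp: one_sided_def)
      then show ?thesis using I_closed(4)[OF Cons.IH, of "monomial [g]"] False
        by (simp add: monomial_Cons[of g w])
    qed
  qed
  show ?case
    using I_closed(4)[OF w, of "Poly_Mapping.single 0 c"]
    by (simp add: ext_nf_scaled_monomial right_diff_distrib split: if_splits)
next
  case (add p q)
  then show ?case
    using I_closed(2)[OF add] by (simp add: ext_nf_add algebra_simps)
qed

text \<open>The kernel of the future isomorphism: elements of the ideal have zero coordinates, and
  conversely zero coordinates give a zero normal form, to which the polynomial is congruent.\<close>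

lemma ext_coeff_eq_iff: "ext_coeff p = ext_coeff q \<longleftrightarrow> p - q \<in> I"
proof
  assume "ext_coeff p = ext_coeff q"
  then have "ext_coeff (p - q) = (\<lambda>a b. 0)" by (simp add: ext_coeff_diff)
  then show "p - q \<in> I" using ext_nf_congruent[of "p - q"] by (simp add: ext_nf_eq_zero)
next
  assume "p - q \<in> I"
  then have "ext_coeff (p - q) = (\<lambda>a b. 0)" using ext_coeff_Idl unfolding I_def by blast
  then show "ext_coeff p = ext_coeff q" by (simp add: ext_coeff_diff fun_eq_iff)
qed

end

section \<open>The isomorphism from the presented algebra\<close>

context trivial_ext
begin

abbreviation "ext_alg \<equiv> ext_algebra R_algebra trivial_module P d \<epsilon>"

text \<open>Degree \<open>n\<close> reads the antidiagonal a + b = n of \<open>c\<close>. The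
  sequence lies in the carrier of \<open>ext_alg\<close> just when \<open>c\<close> has finite
  support.\<close>

definition ext_elem :: "(nat \<Rightarrow> nat \<Rightarrow> 'k) \<Rightarrow> nat \<Rightarrow> ('m \<Rightarrow> 'k) set"
  where "ext_elem c = (\<lambda>n. ext_coord n c)"

lemma ext_elem_eq_iff: "ext_elem c = ext_elem c' \<longleftrightarrow> c = c'"
  by (auto simp: ext_elem_def fun_eq_iff ext_coord_eq_iff)

lemma ext_elem_add: "ext_elem (\<lambda>a b. c a b + c' a b) = ext_elem c \<oplus>\<^bsub>ext_alg\<^esub> ext_elem c'"
  by (simp add: ext_elem_def ext_algebra_def ext_coord_add)

lemma ext_elem_smult: "ext_elem (\<lambda>a b. t * c a b) = t \<odot>\<^bsub>ext_alg\<^esub> ext_elem c"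
  by (simp add: ext_elem_def ext_algebra_def ext_coord_smult)

text \<open>The sum over the degree of the left factor in the definition of the product reassembles
  \<open>chamber_prod\<close> from its parts.\<close>

lemma ext_elem_mult: "ext_elem (chamber_prod c c') = ext_elem c \<otimes>\<^bsub>ext_alg\<^esub> ext_elem c'"
proof (rule ext)
  fix n
  have "(ext_elem c \<otimes>\<^bsub>ext_alg\<^esub> ext_elem c') n =
      finsum (P.E n) (\<lambda>p. yoneda_prod R_algebra trivial_module P d \<epsilon> p (n - p) (ext_coord p c) (ext_coord (n - p) c')) {..n}"
    by (simp add: ext_elem_def ext_algebra_def)
  also have "\<dots> = finsum (P.E n) (\<lambda>p. ext_coord n (chamber_prod_part p c c')) {..n}"
  proof (rule P.E.finsum_cong')
    fix p assume "p \<in> {..n}"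
    then show "yoneda_prod R_algebra trivial_module P d \<epsilon> p (n - p) (ext_coord p c) (ext_coord (n - p) c') =
        ext_coord n (chamber_prod_part p c c')"
      by (simp add: ext_coord_yoneda)
  qed (auto simp: ext_coord_closed)
  also have "\<dots> = ext_coord n (\<lambda>i j. \<Sum>p\<le>n. chamber_prod_part p c c' i j)"
    by (rule ext_coord_sum) simp
  also have "\<dots> = ext_elem (chamber_prod c c') n"
    unfolding ext_elem_def by (intro ext_coord_cong) (simp add: chamber_prod_parts)
  finally show "ext_elem (chamber_prod c c') n = (ext_elem c \<otimes>\<^bsub>ext_alg\<^esub> ext_elem c') n" by simp
qed

lemma ext_elem_in_degree:
  assumes "\<And>a b. a + b \<noteq> n \<Longrightarrow> c a b = 0"
  shows "ext_elem c = ext_in_degree R_algebra trivial_module P d n (ext_coord n c)"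
  using assms by (auto simp: ext_elem_def ext_in_degree_def fun_eq_iff ext_coord_eq_zero_iff)

lemma ext_elem_one: "ext_elem (\<lambda>a b. if a = 0 \<and> b = 0 then 1 else 0) = \<one>\<^bsub>ext_alg\<^esub>"
proof -
  have "ext_elem (\<lambda>a b. if a = 0 \<and> b = 0 then 1 else 0) =
      ext_in_degree R_algebra trivial_module P d 0 (ext_coord 0 (\<lambda>a b. if a = 0 \<and> b = 0 then 1 else 0))"
    by (rule ext_elem_in_degree) auto
  then show ?thesis by (simp add: ext_coord_one ext_algebra_def ext_class_def)
qed

lemma ext_coeff_finite: "finite {n. ext_coord n (ext_coeff p) \<noteq> \<zero>\<^bsub>P.E n\<^esub>}"
proof (rule finite_subset)
  show "{n. ext_coord n (ext_coeff p) \<noteq> \<zero>\<^bsub>P.E n\<^esub>} \<subseteq>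
      (\<lambda>k. exp1 (letters k) + exp2 (letters k)) ` Poly_Mapping.keys p"
  proof
    fix n assume "n \<in> {n. ext_coord n (ext_coeff p) \<noteq> \<zero>\<^bsub>P.E n\<^esub>}"
    then obtain a b where ab: "a + b = n" "ext_coeff p a b \<noteq> 0" by (auto simp: ext_coord_eq_zero_iff)
    then obtain k where "k \<in> Poly_Mapping.keys p" "exp1 (letters k) = a" "exp2 (letters k) = b"
      unfolding ext_coeff_def lin_ext_def
      by (auto elim!: sum.not_neutral_contains_not_neutral split: if_splits)
    with ab show "n \<in> (\<lambda>k. exp1 (letters k) + exp2 (letters k)) ` Poly_Mapping.keys p" by auto
  qed
qed simp

lemma ext_elem_surj: "range (\<lambda>p. ext_elem (ext_coeff p)) = carrier ext_alg"
proof (intro equalityI subsetI)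
  fix u assume "u \<in> range (\<lambda>p. ext_elem (ext_coeff p))"
  then show "u \<in> carrier ext_alg"
    using ext_coeff_finite by (auto simp: ext_elem_def ext_algebra_def ext_coord_closed)
next
  fix u assume "u \<in> carrier ext_alg"
  then have u: "\<And>n. u n \<in> carrier (P.E n)" and fin: "finite {n. u n \<noteq> \<zero>\<^bsub>P.E n\<^esub>}"
    by (auto simp: ext_algebra_def)
  define N where "N = {n. u n \<noteq> \<zero>\<^bsub>P.E n\<^esub>}"
  have "\<exists>c. u n = ext_coord n c" for n using u[of n] by (auto simp: ext_coord_carrier)
  then obtain c where c: "\<And>n. u n = ext_coord n (c n)" by metis
  \<comment> \<open>Each coordinate is realized by its normal word; only the finitely many degrees
    in \<open>N\<close> contribute, so this is a polynomial.\<close>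
  define p where "p = (\<Sum>n\<in>N. \<Sum>i\<le>n. Poly_Mapping.single 0 (c n i (n - i)) * monomial (nf_word i (n - i)))"
  have "ext_coeff p a b = (if a + b \<in> N then c (a + b) a b else 0)" for a b
  proof -
    have "ext_coeff p a b = (\<Sum>n\<in>N. \<Sum>i\<le>n. if i = a \<and> n - i = b then c n i (n - i) else 0)"
      using fin by (simp add: p_def N_def ext_coeff_sum ext_coeff_scaled_monomial nf_word_stats)
    also have "\<dots> = (\<Sum>n\<in>N. if n = a + b then c (a + b) a b else 0)"
    proof (intro sum.cong refl)
      fix n
      have "(\<Sum>i\<le>n. if i = a \<and> n - i = b then c n i (n - i) else 0) =
          (\<Sum>i\<le>n. if i = a then (if n = a + b then c (a + b) a b else 0) else 0)"
        by (intro sum.cong refl) auto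
      then show "(\<Sum>i\<le>n. if i = a \<and> n - i = b then c n i (n - i) else 0) = (if n = a + b then c (a + b) a b else 0)"
        by auto
    qed
    finally show ?thesis using fin by (simp add: N_def)
  qed
  then have "ext_coord n (ext_coeff p) = u n" for n
    using ext_coord_eq_iff[of n "ext_coeff p" "c n"] ext_coord_eq_zero_iff[of n "ext_coeff p"] c[of n]
    by (cases "n \<in> N") (auto simp: N_def)
  then show "u \<in> range (\<lambda>p. ext_elem (ext_coeff p))"
    by (intro image_eqI[of _ _ p]) (simp_all add: ext_elem_def fun_eq_iff)
qed

theorem ext_algebra_presented:
  "is_presented_by ext_alg (\<lambda>x. ext_elem (ext_coeff (monomial [x]))) ext_rels"
proof (rule is_presented_byI[where H = "\<lambda>p. ext_elem (ext_coeff p)"])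
  show "ext_elem (ext_coeff (Poly_Mapping.single 0 c * p)) = c \<odot>\<^bsub>ext_alg\<^esub> ext_elem (ext_coeff p)" for c p
    by (simp only: ext_coeff_smult ext_elem_smult)
qed (simp_all add: ext_elem_surj ext_coeff_add ext_elem_add ext_coeff_mult ext_elem_mult ext_coeff_one
    ext_elem_one ext_elem_eq_iff ext_coeff_eq_iff)

end

theorem proposition2p1:
  fixes P :: "nat \<Rightarrow> ((R_gen, 'k::alg_closed_field) nc_poly set, 'm) module"
    and d :: "nat \<Rightarrow> 'm \<Rightarrow> 'm"
    and \<epsilon> :: "'m \<Rightarrow> 'k"
  assumes "CHAR('k) \<noteq> 2"
    and "free_resolution R_algebra trivial_module P d \<epsilon>"
  shows "\<exists>a1 \<in> carrier (ext_group R_algebra trivial_module P d 1).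
         \<exists>a2 \<in> carrier (ext_group R_algebra trivial_module P d 1).
         \<exists>b \<in> carrier (ext_group R_algebra trivial_module P d 2).
           is_presented_by (ext_algebra R_algebra trivial_module P d \<epsilon>)
             (\<lambda>x. case x of
                G_a1 \<Rightarrow> ext_in_degree R_algebra trivial_module P d 1 a1
              | G_a2 \<Rightarrow> ext_in_degree R_algebra trivial_module P d 1 a2
              | G_b \<Rightarrow> ext_in_degree R_algebra trivial_module P d 2 b)
             ext_rels"
proof -
  let ?M = "trivial_module :: ((R_gen, 'k) nc_poly set, 'k) module"
  note P = assms(2) and Q = free_resolution_res[where 'k = 'k]
  note p = free_resolutionD[OF P]
  obtain F where F: "F \<in> chain_lifts_between R_algebra P d res_module res_d res_aug 0 \<epsilon>"
    by (rule ex_chain_lift[OF P Q p(5) p(9)])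
  interpret trivial_ext P d \<epsilon> F
    by (intro trivial_ext.intro resolution_comparison.intro resolution_comparison_axioms.intro ext_groups.intro
        P Q F left_module_trivial)
  let ?g = "\<lambda>x. ext_coeff (monomial [x]) :: nat \<Rightarrow> nat \<Rightarrow> 'k"
  have "(\<lambda>x. ext_elem (?g x)) = (\<lambda>x. case x of
        G_a1 \<Rightarrow> ext_in_degree R_algebra trivial_module P d 1 (ext_coord 1 (?g G_a1))
      | G_a2 \<Rightarrow> ext_in_degree R_algebra trivial_module P d 1 (ext_coord 1 (?g G_a2))
      | G_b \<Rightarrow> ext_in_degree R_algebra trivial_module P d 2 (ext_coord 2 (?g G_b)))"
  proof
    fix x
    \<comment> \<open>The coordinates of a single letter are concentrated at (1, 0), (0, 1) or (1,
      1), so its image lives in one degree only.\<close>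
    have "ext_elem (?g G_a1) = ext_in_degree R_algebra trivial_module P d 1 (ext_coord 1 (?g G_a1))"
      "ext_elem (?g G_a2) = ext_in_degree R_algebra trivial_module P d 1 (ext_coord 1 (?g G_a2))"
      "ext_elem (?g G_b) = ext_in_degree R_algebra trivial_module P d 2 (ext_coord 2 (?g G_b))"
      by (rule ext_elem_in_degree; auto simp: ext_coeff_monomial exp1_def exp2_def)+
    then show "ext_elem (?g x) = (case x of
        G_a1 \<Rightarrow> ext_in_degree R_algebra trivial_module P d 1 (ext_coord 1 (?g G_a1))
      | G_a2 \<Rightarrow> ext_in_degree R_algebra trivial_module P d 1 (ext_coord 1 (?g G_a2))
      | G_b \<Rightarrow> ext_in_degree R_algebra trivial_module P d 2 (ext_coord 2 (?g G_b)))"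
      by (cases x) simp_all
  qed
  with ext_algebra_presented show ?thesis
    by (intro bexI[of _ "ext_coord 1 (?g G_a1)"] bexI[of _ "ext_coord 1 (?g G_a2)"] bexI[of _ "ext_coord 2 (?g G_b)"])
      (simp_all add: ext_coord_closed)
qed

end
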